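(* Let $\mu\in\mathcal{P}_1(\mathbb{R}^{dT})$. Then for all $\sigma\in(0,1]$, $\lim_{N\to\infty}\mathcal{AW}_1^{(\sigma)}(\mu,\mu^N)=0$, $\mathbb{P}$-a.s.
   Context: $d\ge1$ and $T\ge1$ are integers. Points of $\mathbb{R}^{dT}$ are paths $x=x_{1:T}=(x_1,\dots,x_T)$ with $x_t\in\mathbb{R}^d$; $x_{1:t}=(x_1,\dots,x_t)\in\mathbb{R}^{dt}$, and $\mathbb{R}^{dt}$ carries the norm $\|x_{1:t}\|=\sum_{s=1}^t\|x_s\|_{\mathbb{R}^d}$ (Euclidean norm on $\mathbb{R}^d$). $\mathcal{P}_1(\mathbb{R}^{dT})$ is the set of Borel probability measures with finite first moment. $\mu_{x_{1:t}}\in\mathcal{P}(\mathbb{R}^d)$ is the disintegration kernel of $\mu$ (conditional law of $x_{t+1}$ given $x_{1:t}$); analogously $\pi_{x_{1:t},y_{1:t}}$ is the conditional law of $(x_{t+1},y_{t+1})$ given $(x_{1:t},y_{1:t})$ under $\pi\in\mathcal{P}(\mathbb{R}^{dT}\times\mathbb{R}^{dT})$. $\mathrm{Cpl}(\mu,\nu)$ is the set of couplings of $\mu,\nu$. $\mathrm{Cpl}_{\mathrm{bc}}(\mu,\nu)$, the set of bi-causal couplings, consists of those $\pi\in\mathrm{Cpl}(\mu,\nu)$ with $\pi_{x_{1:t},y_{1:t}}\in\mathrm{Cpl}(\mu_{x_{1:t}},\nu_{y_{1:t}})$ for $\pi$-a.e. $(x,y)$ and all $t=1,\dots,T-1$.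 The adapted Wasserstein distance is $\mathcal{AW}_1(\mu,\nu)=\inf_{\pi\in\mathrm{Cpl}_{\mathrm{bc}}(\mu,\nu)}\int\|x-y\|\,\pi(dx,dy)$. With $\mathcal{N}_\sigma=\mathcal{N}(\mathbf{0},\sigma^2\mathbf{I}_{dT})$ and $\ast$ convolution of measures, $\mathcal{AW}_1^{(\sigma)}(\mu,\nu)=\mathcal{AW}_1(\mu\ast\mathcal{N}_\sigma,\nu\ast\mathcal{N}_\sigma)$. $(X^{(n)})_{n\in\mathbb{N}}$ are i.i.d. samples from $\mu$ on a probability space $(\Omega,\mathcal{F},\mathbb{P})$ and $\mu^N=\frac1N\sum_{n=1}^N\delta_{X^{(n)}}$. *)

theory Defs
  imports "HOL-Probability.Probability"
begin

(* A path (x_1, ..., x_T) with x_t in R^d is a function on {1..T}, extended by undefined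
   as in PiM; the dimension d \<ge> 1 is CARD('d). *)

definition path_space :: "nat \<Rightarrow> (nat \<Rightarrow> real^'d) measure" where
  "path_space T = (\<Pi>\<^sub>M t\<in>{1..T}. borel)"

definition path_norm :: "nat \<Rightarrow> (nat \<Rightarrow> real^'d) \<Rightarrow> real" where
  "path_norm T x = (\<Sum>t\<in>{1..T}. norm (x t))"

definition path_add :: "nat \<Rightarrow> (nat \<Rightarrow> real^'d) \<Rightarrow> (nat \<Rightarrow> real^'d) \<Rightarrow> (nat \<Rightarrow> real^'d)" where
  "path_add T x y = (\<lambda>t\<in>{1..T}. x t + y t)"

definition path_diff :: "nat \<Rightarrow> (nat \<Rightarrow> real^'d) \<Rightarrow> (nat \<Rightarrow> real^'d) \<Rightarrow> (nat \<Rightarrow> real^'d)" where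
  "path_diff T x y = (\<lambda>t\<in>{1..T}. x t - y t)"

definition path_prefix :: "nat \<Rightarrow> (nat \<Rightarrow> real^'d) \<Rightarrow> (nat \<Rightarrow> real^'d)" where
  "path_prefix t x = restrict x {1..t}"

definition P1 :: "nat \<Rightarrow> (nat \<Rightarrow> real^'d) measure set" where
  "P1 T = {\<mu> \<in> space (prob_algebra (path_space T)). (\<integral>\<^sup>+x. ennreal (path_norm T x) \<partial>\<mu>) < \<infinity>}"

(* K is a version of the regular conditional law, under M, of Y (with values in R)
   given X (with values in S). *)
definition is_cond_law ::
  "'m measure \<Rightarrow> 's measure \<Rightarrow> ('m \<Rightarrow> 's) \<Rightarrow> 'r measure \<Rightarrow> ('m \<Rightarrow> 'r) \<Rightarrow> ('s \<Rightarrow> 'r measure) \<Rightarrow> bool" where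
  "is_cond_law M S X R Y K \<longleftrightarrow>
     K \<in> S \<rightarrow>\<^sub>M prob_algebra R \<and>
     (\<forall>A\<in>sets S. \<forall>B\<in>sets R.
        emeasure M {\<omega> \<in> space M. X \<omega> \<in> A \<and> Y \<omega> \<in> B} =
        (\<integral>\<^sup>+\<omega>. emeasure (K (X \<omega>)) B * indicator A (X \<omega>) \<partial>M))"

definition is_kernel ::
  "nat \<Rightarrow> (nat \<Rightarrow> real^'d) measure \<Rightarrow> ((nat \<Rightarrow> real^'d) \<Rightarrow> (real^'d) measure) \<Rightarrow> bool" where
  "is_kernel t \<mu> K \<longleftrightarrow>
     is_cond_law \<mu> (path_space t) (path_prefix t) borel (\<lambda>x. x (Suc t)) K"

definition is_pair_kernel ::
  "nat \<Rightarrow> ((nat \<Rightarrow> real^'d) \<times> (nat \<Rightarrow> real^'d)) measure \<Rightarrow>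
   ((nat \<Rightarrow> real^'d) \<times> (nat \<Rightarrow> real^'d) \<Rightarrow> ((real^'d) \<times> (real^'d)) measure) \<Rightarrow> bool" where
  "is_pair_kernel t \<pi> K \<longleftrightarrow>
     is_cond_law \<pi>
       (path_space t \<Otimes>\<^sub>M path_space t) (\<lambda>(x, y). (path_prefix t x, path_prefix t y))
       (borel \<Otimes>\<^sub>M borel) (\<lambda>(x, y). (x (Suc t), y (Suc t))) K"

definition Cpl :: "'a measure \<Rightarrow> 'b measure \<Rightarrow> ('a \<times> 'b) measure set" where
  "Cpl \<mu> \<nu> = {\<pi> \<in> space (prob_algebra (\<mu> \<Otimes>\<^sub>M \<nu>)). distr \<pi> \<mu> fst = \<mu> \<and> distr \<pi> \<nu> snd = \<nu>}"

(* Conditional laws are unique only up to null sets. Two versions agree almost everywhere,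
   and the first and second marginals of \<pi> are \<mu> and \<nu>, so the almost-everywhere condition
   below does not depend on which versions are taken. *)
definition Cpl_bc ::
  "nat \<Rightarrow> (nat \<Rightarrow> real^'d) measure \<Rightarrow> (nat \<Rightarrow> real^'d) measure \<Rightarrow>
   ((nat \<Rightarrow> real^'d) \<times> (nat \<Rightarrow> real^'d)) measure set" where
  "Cpl_bc T \<mu> \<nu> = {\<pi> \<in> Cpl \<mu> \<nu>. \<forall>t\<in>{1..<T}.
     \<exists>K\<mu> K\<nu> K\<pi>. is_kernel t \<mu> K\<mu> \<and> is_kernel t \<nu> K\<nu> \<and> is_pair_kernel t \<pi> K\<pi> \<and>
       (AE (x, y) in \<pi>. K\<pi> (path_prefix t x, path_prefix t y)
                         \<in> Cpl (K\<mu> (path_prefix t x)) (K\<nu> (path_prefix t y)))}"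

definition AW1 :: "nat \<Rightarrow> (nat \<Rightarrow> real^'d) measure \<Rightarrow> (nat \<Rightarrow> real^'d) measure \<Rightarrow> ennreal" where
  "AW1 T \<mu> \<nu> = (INF \<pi>\<in>Cpl_bc T \<mu> \<nu>. \<integral>\<^sup>+(x, y). ennreal (path_norm T (path_diff T x y)) \<partial>\<pi>)"

(* N(0, \<sigma>^2 I_{dT}): the density factorizes over the d T coordinates, and the product of the
   Lebesgue measures on R^d is the Lebesgue measure on R^{dT}. *)
definition gaussian :: "nat \<Rightarrow> real \<Rightarrow> (nat \<Rightarrow> real^'d) measure" where
  "gaussian T \<sigma> = density (\<Pi>\<^sub>M t\<in>{1..T}. lborel)
     (\<lambda>x. ennreal (\<Prod>t\<in>{1..T}. \<Prod>i\<in>UNIV. normal_density 0 \<sigma> (x t $ i)))"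

(* The library constant convolution lives on the Borel sets of a type and does not apply to
   path_space, whose points are only the functions undefined outside {1..T}. *)
definition path_convolution ::
  "nat \<Rightarrow> (nat \<Rightarrow> real^'d) measure \<Rightarrow> (nat \<Rightarrow> real^'d) measure \<Rightarrow> (nat \<Rightarrow> real^'d) measure" where
  "path_convolution T \<mu> \<nu> = distr (\<mu> \<Otimes>\<^sub>M \<nu>) (path_space T) (\<lambda>(x, y). path_add T x y)"

definition smooth_AW1 ::
  "nat \<Rightarrow> real \<Rightarrow> (nat \<Rightarrow> real^'d) measure \<Rightarrow> (nat \<Rightarrow> real^'d) measure \<Rightarrow> ennreal" where
  "smooth_AW1 T \<sigma> \<mu> \<nu> =
     AW1 T (path_convolution T \<mu> (gaussian T \<sigma>)) (path_convolution T \<nu> (gaussian T \<sigma>))"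

(* (1/N) \<Sum>_{n=1}^N \<delta>_{x_n}, as the image of the uniform distribution on {1..N} under n \<mapsto> x_n. *)
definition empirical_measure ::
  "nat \<Rightarrow> nat \<Rightarrow> (nat \<Rightarrow> (nat \<Rightarrow> real^'d)) \<Rightarrow> (nat \<Rightarrow> real^'d) measure" where
  "empirical_measure T N x = distr (uniform_count_measure {1..N}) (path_space T) x"

end

theory Submission
  imports Defs
begin

text \<open>
  Let \<open>p\<close> and \<open>q\<close> be the densities of \<open>\<mu> * N\<close> and \<open>\<nu> * N\<close>, where \<open>N\<close> is the Gaussian. For each \<open>t\<close> their first \<open>t\<close>
  coordinates have the densities \<open>p\<^sub>t\<close> and \<open>q\<^sub>t\<close>, which are positive everywhere, so that the next coordinate has the
  conditional densities \<open>f\<^sub>t = p\<^sub>t\<^sub>+\<^sub>1 / p\<^sub>t\<close> and \<open>g\<^sub>t = q\<^sub>t\<^sub>+\<^sub>1 / q\<^sub>t\<close>. A bicausal coupling is built step by step: as long as the two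
  paths agree, the next points are chosen to agree with density \<open>min f\<^sub>t g\<^sub>t\<close>, and after the first disagreement the
  paths move independently (\<open>coupling_bicausal\<close>). The paths then agree throughout with density
  \<open>m = (\<Prod>t. min f\<^sub>t g\<^sub>t)\<close>, and bounding the distance by the sum of the norms elsewhere gives
  (\<open>AW1_le_overlap\<close>, \<open>smooth_AW1_le_overlap\<close>)

  \<open>AW + 2 \<integral> \<parallel>x\<parallel> m(x) dx \<le> \<integral> \<parallel>x\<parallel> p(x) dx + \<integral> \<parallel>x\<parallel> q(x) dx\<close>.

  Now let \<open>\<nu>\<close> be the empirical measure. For fixed \<open>x\<close> the value \<open>q\<^sub>t(x)\<close> is the mean of i.i.d. bounded variables, so by the
  strong law and Fubini's theorem almost surely \<open>q\<^sub>t \<rightarrow> p\<^sub>t\<close> almost everywhere for all \<open>t\<close> (\<open>AE_smoothed_empirical\<close>),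
  whence \<open>m \<rightarrow> p\<close>. Fatou's lemma and \<open>m \<le> p\<close> give \<open>\<integral> \<parallel>x\<parallel> m \<rightarrow> \<integral> \<parallel>x\<parallel> p\<close>. The strong law, applied to the integrable function
  \<open>z \<mapsto> \<integral> \<parallel>z + w\<parallel> N(dw)\<close>, gives \<open>\<integral> \<parallel>x\<parallel> q \<rightarrow> \<integral> \<parallel>x\<parallel> p\<close> (\<open>AE_smoothed_moment_empirical\<close>). Hence the upper bound for
  \<open>AW\<close> tends to \<open>0\<close> (\<open>smooth_AW1_tendsto_0\<close>). The strong law is only needed for nonnegative variables
  (\<open>strong_law_of_large_numbers_nonneg\<close>).
\<close>

section \<open>The strong law of large numbers for nonnegative summands\<close>

lemma cesaro_mean:
  fixes a :: "nat \<Rightarrow> real"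
  assumes "a \<longlonglongrightarrow> l"
  shows "(\<lambda>N. (\<Sum>n=1..N. a n) / N) \<longlonglongrightarrow> l"
proof (rule LIMSEQ_I)
  fix r :: real assume r: "0 < r"
  from LIMSEQ_D[OF assms, of "r / 2"] r obtain K where K: "\<And>n. n \<ge> K \<Longrightarrow> \<bar>a n - l\<bar> < r / 2"
    by auto
  define B where "B = (\<Sum>n=1..K. \<bar>a n - l\<bar>)"
  obtain N0 :: nat where N0: "2 * B / r < N0" using reals_Archimedean2 by blast
  show "\<exists>N0. \<forall>N\<ge>N0. norm ((\<Sum>n=1..N. a n) / N - l) < r"
  proof (intro exI[of _ "max (max N0 K) 1"] allI impI)
    fix N assume "max (max N0 K) 1 \<le> N"
    then have N: "N \<ge> N0" "N \<ge> K" "N \<ge> 1" by auto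
    have "(\<Sum>n=1..N. a n) / N - l = (\<Sum>n=1..N. a n - l) / N"
      using N by (simp add: sum_subtractf field_simps)
    also have "\<bar>\<dots>\<bar> \<le> (\<Sum>n=1..N. \<bar>a n - l\<bar>) / N"
      by (simp add: divide_right_mono)
    also have "(\<Sum>n=1..N. \<bar>a n - l\<bar>) = B + (\<Sum>n=K+1..N. \<bar>a n - l\<bar>)"
      unfolding B_def using N sum.ub_add_nat[of 1 K "\<lambda>n. \<bar>a n - l\<bar>" "N - K"] by simp
    also have "(\<Sum>n=K+1..N. \<bar>a n - l\<bar>) \<le> (\<Sum>n=K+1..N. r / 2)"
      by (intro sum_mono) (use K in \<open>force intro: less_imp_le\<close>)
    also have "(\<Sum>n=K+1..N. r / 2) \<le> N * (r / 2)"
      using r by (simp add: mult_right_mono)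
    finally have "\<bar>(\<Sum>n=1..N. a n) / N - l\<bar> \<le> (B + N * (r / 2)) / N"
      by (simp add: divide_right_mono)
    also have "\<dots> = B / N + r / 2" using N by (simp add: field_simps)
    also have "B / N < r / 2"
    proof -
      have "2 * B / r < N" using N0 N(1) by linarith
      then show ?thesis using r N by (simp add: field_simps)
    qed
    finally show "norm ((\<Sum>n=1..N. a n) / N - l) < r" by simp
  qed
qed

text \<open>For a nondecreasing sequence of partial sums, convergence of the means along the integer parts of
  \<open>\<alpha> ^ j\<close> bounds all means up to a factor \<open>\<alpha>\<close>. The ratios \<open>\<alpha> = 1 + 1 / (m + 1)\<close> decrease to \<open>1\<close>.\<close>

lemma tendsto_mean_of_geometric_subsequences:
  fixes s :: "nat \<Rightarrow> real"
  assumes s: "mono s" and s0: "\<And>n. 0 \<le> s n"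
    and lim: "\<And>m. (\<lambda>j. s (nat \<lfloor>(1 + 1 / Suc m) ^ j\<rfloor>) / (1 + 1 / Suc m) ^ j) \<longlonglongrightarrow> l"
  shows "(\<lambda>N. s N / N) \<longlonglongrightarrow> l"
proof (rule LIMSEQ_I)
  fix r :: real assume r: "0 < r"
  have a1: "(\<lambda>m. 1 + 1 / real (Suc m)) \<longlonglongrightarrow> 1 + 0"
    by (intro tendsto_intros LIMSEQ_Suc[OF lim_1_over_n])
  have "(\<lambda>m. (1 + 1 / real (Suc m)) * (l + r / 2)) \<longlonglongrightarrow> (1 + 0) * (l + r / 2)"
    "(\<lambda>m. (l - r / 2) / (1 + 1 / real (Suc m))) \<longlonglongrightarrow> (l - r / 2) / (1 + 0)"
    by (intro tendsto_intros a1, simp)+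
  then have "\<forall>\<^sub>F m in sequentially. (1 + 1 / real (Suc m)) * (l + r / 2) < l + r"
    "\<forall>\<^sub>F m in sequentially. l - r < (l - r / 2) / (1 + 1 / real (Suc m))"
    using r by (auto intro: order_tendstoD)
  then have "\<forall>\<^sub>F m in sequentially. (1 + 1 / real (Suc m)) * (l + r / 2) < l + r \<and>
      l - r < (l - r / 2) / (1 + 1 / real (Suc m))"
    by (rule eventually_conj)
  then obtain m where m: "(1 + 1 / real (Suc m)) * (l + r / 2) < l + r"
      "l - r < (l - r / 2) / (1 + 1 / real (Suc m))"
    by (auto simp: eventually_sequentially)
  define \<alpha> where "\<alpha> = 1 + 1 / real (Suc m)"
  have \<alpha>: "\<alpha> > 1" by (simp add: \<alpha>_def)
  from LIMSEQ_D[OF lim[of m], of "r / 2"] r obtain J where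
    J: "\<And>j. j \<ge> J \<Longrightarrow> \<bar>s (nat \<lfloor>\<alpha> ^ j\<rfloor>) / \<alpha> ^ j - l\<bar> < r / 2"
    by (auto simp: \<alpha>_def)
  obtain N0 :: nat where N0: "\<alpha> ^ J < N0" using reals_Archimedean2 by blast
  show "\<exists>N0. \<forall>N\<ge>N0. norm (s N / N - l) < r"
  proof (intro exI[of _ "max N0 1"] allI impI)
    fix N assume "max N0 1 \<le> N"
    then have N: "\<alpha> ^ J < N" "N \<ge> 1" using N0 by auto
    \<comment> \<open>The exponent \<open>j\<close> obtained below satisfies \<open>\<alpha> ^ j \<le> N < \<alpha> ^ (j + 1)\<close>.\<close>
    define i where "i = (LEAST i. N < \<alpha> ^ i)"
    have i: "N < \<alpha> ^ i" unfolding i_def by (rule LeastI_ex) (rule real_arch_pow[OF \<alpha>])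
    have "i \<noteq> 0" using i N by (intro notI) simp
    then obtain j where j: "i = Suc j" by (cases i) auto
    have "\<not> N < \<alpha> ^ j" using not_less_Least[of j "\<lambda>i. N < \<alpha> ^ i"] j by (simp add: i_def)
    then have jN: "\<alpha> ^ j \<le> N" by simp
    have Nj: "N < \<alpha> ^ Suc j" using i j by simp
    have "J < Suc j" using N(1) Nj \<alpha> by (meson less_trans power_less_imp_less_exp)
    then have Jj: "j \<ge> J" by simp
    have pos: "0 < \<alpha> ^ j" "0 < real N" using \<alpha> N by auto
    have "s N / N \<le> s (nat \<lfloor>\<alpha> ^ Suc j\<rfloor>) / \<alpha> ^ j"
    proof (intro frac_le s0)
      have "N \<le> nat \<lfloor>\<alpha> ^ Suc j\<rfloor>" using Nj by (simp add: le_nat_floor)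
      then show "s N \<le> s (nat \<lfloor>\<alpha> ^ Suc j\<rfloor>)" by (rule monoD[OF s])
    qed (use jN pos in auto)
    also have "\<dots> = \<alpha> * (s (nat \<lfloor>\<alpha> ^ Suc j\<rfloor>) / \<alpha> ^ Suc j)" using \<alpha> by simp
    also have "\<dots> \<le> \<alpha> * (l + r / 2)"
    proof (intro mult_left_mono)
      show "s (nat \<lfloor>\<alpha> ^ Suc j\<rfloor>) / \<alpha> ^ Suc j \<le> l + r / 2"
        using J[of "Suc j"] Jj unfolding abs_less_iff by linarith
    qed (use \<alpha> in simp)
    also have "\<dots> < l + r" using m(1) by (simp add: \<alpha>_def)
    finally have up: "s N / N < l + r" .
    have "l - r < (l - r / 2) / \<alpha>" using m(2) by (simp add: \<alpha>_def)
    also have "\<dots> \<le> (s (nat \<lfloor>\<alpha> ^ j\<rfloor>) / \<alpha> ^ j) / \<alpha>"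
    proof (intro divide_right_mono)
      show "l - r / 2 \<le> s (nat \<lfloor>\<alpha> ^ j\<rfloor>) / \<alpha> ^ j"
        using J[of j] Jj unfolding abs_less_iff by linarith
    qed (use \<alpha> in simp)
    also have "\<dots> = s (nat \<lfloor>\<alpha> ^ j\<rfloor>) / \<alpha> ^ Suc j" by simp
    also have "\<dots> \<le> s N / N"
    proof (intro frac_le s0)
      have "nat \<lfloor>\<alpha> ^ j\<rfloor> \<le> N" using jN by linarith
      then show "s (nat \<lfloor>\<alpha> ^ j\<rfloor>) \<le> s N" by (rule monoD[OF s])
    qed (use Nj pos in auto)
    finally show "norm (s N / N - l) < r" using up by (simp add: abs_less_iff)
  qed
qed

text \<open>The terms with \<open>y \<le> \<alpha> ^ j\<close> form a geometric series whose first term is at most \<open>y\<close>. This is what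
  makes the variances along a geometric subsequence summable under a first moment assumption only.\<close>

lemma sum_truncated_squares_le:
  fixes \<alpha> y :: real
  assumes \<alpha>: "\<alpha> > 1" and y: "y \<ge> 0"
  shows "(\<Sum>j<n. (if y \<le> \<alpha> ^ j then y\<^sup>2 else 0) / \<alpha> ^ j) \<le> \<alpha> / (\<alpha> - 1) * y"
proof -
  \<comment> \<open>The summands are dominated by the differences of this decreasing sequence.\<close>
  define b where "b j = \<alpha> / (\<alpha> - 1) * min y (y\<^sup>2 / \<alpha> ^ j)" for j :: nat
  have "(if y \<le> \<alpha> ^ j then y\<^sup>2 else 0) / \<alpha> ^ j \<le> b j - b (Suc j)" for j
  proof (cases "y \<le> \<alpha> ^ j")
    case True
    have pos: "\<alpha> ^ j > 0" using \<alpha> by simp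
    have "y\<^sup>2 / \<alpha> ^ j \<le> y" using mult_left_mono[OF True y] pos by (simp add: power2_eq_square field_simps)
    moreover have "y\<^sup>2 / \<alpha> ^ Suc j \<le> y\<^sup>2 / \<alpha> ^ j"
      using \<alpha> pos by (intro divide_left_mono) auto
    ultimately have "b j - b (Suc j) = \<alpha> / (\<alpha> - 1) * (y\<^sup>2 / \<alpha> ^ j - y\<^sup>2 / \<alpha> ^ Suc j)"
      by (simp add: b_def right_diff_distrib)
    also have "\<dots> = y\<^sup>2 / \<alpha> ^ j" using \<alpha> by (simp add: field_simps)
    finally show ?thesis using True by simp
  next
    case False
    have "y\<^sup>2 / \<alpha> ^ Suc j \<le> y\<^sup>2 / \<alpha> ^ j"
      using \<alpha> by (intro divide_left_mono) auto
    then have "b (Suc j) \<le> b j" unfolding b_def using \<alpha> by (intro mult_left_mono) auto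
    then show ?thesis using False by simp
  qed
  then have "(\<Sum>j<n. (if y \<le> \<alpha> ^ j then y\<^sup>2 else 0) / \<alpha> ^ j) \<le> (\<Sum>j<n. b j - b (Suc j))"
    by (rule sum_mono)
  also have "\<dots> = b 0 - b n" by (rule sum_lessThan_telescope')
  also have "\<dots> \<le> b 0" using \<alpha> y by (simp add: b_def)
  also have "\<dots> \<le> \<alpha> / (\<alpha> - 1) * y" unfolding b_def using \<alpha> by (intro mult_left_mono) auto
  finally show ?thesis .
qed

lemma sum_indicator_less_le:
  fixes y :: real
  assumes "y \<ge> 0"
  shows "(\<Sum>n<N. if real (Suc n) < y then 1 else 0) \<le> y"
proof -
  have "(\<Sum>n<N. if real (Suc n) < y then 1 else 0) \<le> min (real N) y"
    using assms by (induction N) auto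
  then show ?thesis by simp
qed

lemma AE_tendsto_zero_of_nn_integral_suminf:
  fixes V :: "nat \<Rightarrow> 'a \<Rightarrow> real"
  assumes [measurable]: "\<And>j. V j \<in> borel_measurable M" and V0: "\<And>j \<omega>. 0 \<le> V j \<omega>"
    and fin: "(\<Sum>j. \<integral>\<^sup>+\<omega>. V j \<omega> \<partial>M) < \<infinity>"
  shows "AE \<omega> in M. (\<lambda>j. V j \<omega>) \<longlonglongrightarrow> 0"
proof -
  have "(\<integral>\<^sup>+\<omega>. (\<Sum>j. ennreal (V j \<omega>)) \<partial>M) = (\<Sum>j. \<integral>\<^sup>+\<omega>. V j \<omega> \<partial>M)"
    by (rule nn_integral_suminf) measurable
  then have "AE \<omega> in M. (\<Sum>j. ennreal (V j \<omega>)) \<noteq> \<infinity>"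
    using fin by (intro nn_integral_PInf_AE) auto
  then show ?thesis
  proof eventually_elim
    fix \<omega> assume "(\<Sum>j. ennreal (V j \<omega>)) \<noteq> \<infinity>"
    then have "summable (\<lambda>j. V j \<omega>)"
      using V0 by (intro summable_suminf_not_top) auto
    then show "(\<lambda>j. V j \<omega>) \<longlonglongrightarrow> 0" by (rule summable_LIMSEQ_zero)
  qed
qed

lemma (in prob_space) variance_sum_indep:
  fixes X :: "'i \<Rightarrow> 'a \<Rightarrow> real"
  assumes fin: "finite I" and indep: "indep_vars (\<lambda>_. borel) X I"
    and int: "\<And>i. i \<in> I \<Longrightarrow> integrable M (X i)" and int2: "\<And>i. i \<in> I \<Longrightarrow> integrable M (\<lambda>\<omega>. (X i \<omega>)\<^sup>2)"
  shows "integrable M (\<lambda>\<omega>. ((\<Sum>i\<in>I. X i \<omega>) - expectation (\<lambda>\<omega>. \<Sum>i\<in>I. X i \<omega>))\<^sup>2)"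
    and "variance (\<lambda>\<omega>. \<Sum>i\<in>I. X i \<omega>) = (\<Sum>i\<in>I. variance (X i))"
proof -
  define W where "W i \<omega> = X i \<omega> - expectation (X i)" for i \<omega>
  have W_int: "integrable M (W i)" if "i \<in> I" for i
    unfolding W_def using int[OF that] by simp
  have W0: "expectation (W i) = 0" if "i \<in> I" for i
    unfolding W_def using int[OF that] by (simp add: prob_space)
  have W2: "integrable M (\<lambda>\<omega>. W i \<omega> * W i \<omega>)" if "i \<in> I" for i
    unfolding W_def using int[OF that] int2[OF that]
    by (simp add: algebra_simps power2_eq_square)
  have pair: "expectation (\<lambda>\<omega>. W i \<omega> * W j \<omega>) = 0 \<and> integrable M (\<lambda>\<omega>. W i \<omega> * W j \<omega>)"
    if "i \<in> I" "j \<in> I" "i \<noteq> j" for i j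
  proof -
    have "indep_vars (\<lambda>_. borel) W {i, j}"
      unfolding W_def[abs_def]
      by (rule indep_vars_compose2[OF indep_vars_subset[OF indep]]) (use that in auto)
    from indep_vars_lebesgue_integral[OF _ this] indep_vars_integrable[OF _ this]
    show ?thesis using that W_int W0 by auto
  qed
  have mixed: "integrable M (\<lambda>\<omega>. W i \<omega> * W j \<omega>)" if "i \<in> I" "j \<in> I" for i j
    using W2 pair that by (cases "i = j") auto
  have mixed0: "expectation (\<lambda>\<omega>. W i \<omega> * W j \<omega>) = (if i = j then variance (X i) else 0)"
    if "i \<in> I" "j \<in> I" for i j
    using pair that by (cases "i = j") (simp_all add: W_def power2_eq_square)
  have eq: "((\<Sum>i\<in>I. X i \<omega>) - expectation (\<lambda>\<omega>. \<Sum>i\<in>I. X i \<omega>))\<^sup>2 = (\<Sum>i\<in>I. \<Sum>j\<in>I. W i \<omega> * W j \<omega>)" for \<omega>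
    using int by (simp add: W_def power2_eq_square sum_product[symmetric] sum_subtractf)
  show "integrable M (\<lambda>\<omega>. ((\<Sum>i\<in>I. X i \<omega>) - expectation (\<lambda>\<omega>. \<Sum>i\<in>I. X i \<omega>))\<^sup>2)"
    unfolding eq by (intro Bochner_Integration.integrable_sum mixed)
  have "variance (\<lambda>\<omega>. \<Sum>i\<in>I. X i \<omega>) = (\<Sum>i\<in>I. \<Sum>j\<in>I. expectation (\<lambda>\<omega>. W i \<omega> * W j \<omega>))"
    unfolding eq using mixed by (simp add: Bochner_Integration.integral_sum)
  also have "\<dots> = (\<Sum>i\<in>I. variance (X i))"
    using fin by (intro sum.cong refl) (simp add: mixed0)
  finally show "variance (\<lambda>\<omega>. \<Sum>i\<in>I. X i \<omega>) = (\<Sum>i\<in>I. variance (X i))" .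
qed

text \<open>Etemadi's argument. The summand \<open>Y n\<close> is truncated at height \<open>n\<close>, which almost surely changes only finitely
  many summands because \<open>\<Sum>n. P (Y 1 > n) \<le> E (Y 1)\<close>. Along geometric subsequences the variances of the
  truncated means are summable, so these means converge, and nonnegativity makes the partial sums monotone,
  which fills the gaps. Nonnegativity is assumed at every point rather than almost everywhere.\<close>

theorem (in prob_space) strong_law_of_large_numbers_nonneg:
  fixes Y :: "nat \<Rightarrow> 'a \<Rightarrow> real"
  assumes indep: "indep_vars (\<lambda>_. borel) Y {1..}"
    and ident: "\<And>n. n \<ge> 1 \<Longrightarrow> distr M borel (Y n) = D"
    and nonneg: "\<And>n \<omega>. 0 \<le> Y n \<omega>"
    and int: "integrable M (Y 1)"
  shows "AE \<omega> in M. (\<lambda>N. (\<Sum>n=1..N. Y n \<omega>) / N) \<longlonglongrightarrow> expectation (Y 1)"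
proof -
  define \<tau> :: "real \<Rightarrow> real \<Rightarrow> real" where "\<tau> c y = (if y \<le> c then y else 0)" for c y
  define Z where "Z n \<omega> = \<tau> (real n) (Y n \<omega>)" for n \<omega>
  define S where "S k \<omega> = (\<Sum>n=1..k. Z n \<omega>)" for k \<omega>
  have \<tau>_meas [measurable]: "\<tau> c \<in> borel_measurable borel" for c
    unfolding \<tau>_def by measurable
  have rv: "random_variable borel (Y n)" if "n \<ge> 1" for n
    using indep that by (simp add: indep_vars_def2)
  have [measurable]: "random_variable borel (Y (Suc n))" for n by (rule rv) simp
  have Y1 [measurable]: "random_variable borel (Y 1)" by (rule rv) simp
  have Z_meas: "Z n \<in> borel_measurable M" if "n \<ge> 1" for n
    unfolding Z_def using measurable_compose[OF rv[OF that] \<tau>_meas] by simp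
  have S_meas [measurable]: "S k \<in> borel_measurable M" for k
    unfolding S_def by (intro borel_measurable_sum Z_meas) auto
  have D: "distr M borel (Y n) = distr M borel (Y 1)" if "n \<ge> 1" for n
    using ident[OF that] ident[of 1] by simp
  have ident_int: "expectation (\<lambda>\<omega>. h (Y n \<omega>)) = expectation (\<lambda>\<omega>. h (Y 1 \<omega>))"
    if "n \<ge> 1" and [measurable]: "h \<in> borel_measurable borel" for n and h :: "real \<Rightarrow> real"
    using integral_distr[OF rv[OF that(1)] that(2)] integral_distr[OF Y1 that(2)] D[OF that(1)] by simp
  have ident_nn: "(\<integral>\<^sup>+\<omega>. h (Y n \<omega>) \<partial>M) = (\<integral>\<^sup>+\<omega>. h (Y 1 \<omega>) \<partial>M)"
    if "n \<ge> 1" and [measurable]: "h \<in> borel_measurable borel" for n and h :: "real \<Rightarrow> ennreal"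
    using nn_integral_distr[OF rv[OF that(1)], of h] nn_integral_distr[OF Y1, of h] D[OF that(1)] by simp
  have \<tau>_bound: "0 \<le> \<tau> c y \<and> \<tau> c y \<le> y" "(\<tau> c y)\<^sup>2 \<le> c\<^sup>2" if "0 \<le> y" for c y
    using that by (auto simp: \<tau>_def power_mono)
  have Z_bound: "0 \<le> Z n \<omega>" "Z n \<omega> \<le> real n" for n \<omega>
    using nonneg[of n \<omega>] by (auto simp: Z_def \<tau>_def)
  have Z_int: "integrable M (Z n)" if "n \<ge> 1" for n
    using Z_bound[of n] by (intro integrable_const_bound[of _ "real n"] Z_meas that) auto
  have Z2_int: "integrable M (\<lambda>\<omega>. (Z n \<omega>)\<^sup>2)" if "n \<ge> 1" for n
    using Z_bound[of n] Z_meas[OF that]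
    by (intro integrable_const_bound[of _ "(real n)\<^sup>2"]) (auto intro!: power_mono)
  have fin_mean: "(\<integral>\<^sup>+\<omega>. Y 1 \<omega> \<partial>M) < \<infinity>"
    using int nonneg[of 1] by (subst nn_integral_eq_integral) auto

  have truncation: "AE \<omega> in M. (\<lambda>n. Y n \<omega> - Z n \<omega>) \<longlonglongrightarrow> 0"
  proof -
    have "AE \<omega> in M. (\<lambda>n. if real (Suc n) < Y (Suc n) \<omega> then 1 else 0 :: real) \<longlonglongrightarrow> 0"
    proof (rule AE_tendsto_zero_of_nn_integral_suminf)
      have "(\<Sum>n. \<integral>\<^sup>+\<omega>. ennreal (if real (Suc n) < Y (Suc n) \<omega> then 1 else 0) \<partial>M) =
          (\<Sum>n. \<integral>\<^sup>+\<omega>. ennreal (if real (Suc n) < Y 1 \<omega> then 1 else 0) \<partial>M)"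
      proof (intro arg_cong[where f=suminf] ext)
        fix n
        show "(\<integral>\<^sup>+\<omega>. ennreal (if real (Suc n) < Y (Suc n) \<omega> then 1 else 0) \<partial>M) =
            (\<integral>\<^sup>+\<omega>. ennreal (if real (Suc n) < Y 1 \<omega> then 1 else 0) \<partial>M)"
          by (rule ident_nn[of "Suc n" "\<lambda>y. ennreal (if real (Suc n) < y then 1 else 0)"]) measurable
      qed
      also have "\<dots> = (\<integral>\<^sup>+\<omega>. (\<Sum>n. ennreal (if real (Suc n) < Y 1 \<omega> then 1 else 0)) \<partial>M)"
        by (rule nn_integral_suminf[symmetric]) measurable
      also have "\<dots> \<le> (\<integral>\<^sup>+\<omega>. Y 1 \<omega> \<partial>M)"
      proof (intro nn_integral_mono)
        fix \<omega>
        show "(\<Sum>n. ennreal (if real (Suc n) < Y 1 \<omega> then 1 else 0)) \<le> Y 1 \<omega>"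
          unfolding suminf_eq_SUP
          by (intro SUP_least, subst sum_ennreal) (use sum_indicator_less_le[OF nonneg[of 1 \<omega>]] in \<open>auto intro!: ennreal_leI\<close>)
      qed
      finally show "(\<Sum>n. \<integral>\<^sup>+\<omega>. ennreal (if real (Suc n) < Y (Suc n) \<omega> then 1 else 0) \<partial>M) < \<infinity>"
        using fin_mean by (rule le_less_trans)
    qed auto
    then show ?thesis
    proof eventually_elim
      fix \<omega> assume "(\<lambda>n. if real (Suc n) < Y (Suc n) \<omega> then 1 else 0 :: real) \<longlonglongrightarrow> 0"
      from order_tendstoD(2)[OF this, of 1]
      have "\<forall>\<^sub>F n in sequentially. Y (Suc n) \<omega> - Z (Suc n) \<omega> = 0"
        by (auto elim!: eventually_mono simp: Z_def \<tau>_def split: if_splits)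
      then have "\<forall>\<^sub>F n in sequentially. Y n \<omega> - Z n \<omega> = 0"
        by (rule eventually_sequentially_Suc[THEN iffD1])
      then show "(\<lambda>n. Y n \<omega> - Z n \<omega>) \<longlonglongrightarrow> 0" by (rule tendsto_eventually)
    qed
  qed

  have mean: "(\<lambda>k. expectation (S k) / k) \<longlonglongrightarrow> expectation (Y 1)"
  proof -
    have "(\<lambda>n. expectation (\<lambda>\<omega>. \<tau> (real n) (Y 1 \<omega>))) \<longlonglongrightarrow> expectation (Y 1)"
    proof (rule integral_dominated_convergence[where w="Y 1"])
      show "AE \<omega> in M. (\<lambda>n. \<tau> (real n) (Y 1 \<omega>)) \<longlonglongrightarrow> Y 1 \<omega>"
      proof (rule AE_I2)
        fix \<omega>
        obtain n0 :: nat where "Y 1 \<omega> \<le> n0" using real_arch_simple by blast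
        then have "\<forall>\<^sub>F n in sequentially. \<tau> (real n) (Y 1 \<omega>) = Y 1 \<omega>"
          by (intro eventually_sequentiallyI[of n0]) (auto simp: \<tau>_def)
        then show "(\<lambda>n. \<tau> (real n) (Y 1 \<omega>)) \<longlonglongrightarrow> Y 1 \<omega>" by (rule tendsto_eventually)
      qed
    qed (use int nonneg \<tau>_bound in auto)
    from cesaro_mean[OF this]
    have "(\<lambda>k. (\<Sum>n=1..k. expectation (\<lambda>\<omega>. \<tau> (real n) (Y 1 \<omega>))) / k) \<longlonglongrightarrow> expectation (Y 1)" .
    moreover have "expectation (S k) = (\<Sum>n=1..k. expectation (\<lambda>\<omega>. \<tau> (real n) (Y 1 \<omega>)))" for k
    proof -
      have "expectation (S k) = (\<Sum>n=1..k. expectation (Z n))"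
        unfolding S_def by (intro Bochner_Integration.integral_sum Z_int) auto
      also have "\<dots> = (\<Sum>n=1..k. expectation (\<lambda>\<omega>. \<tau> (real n) (Y 1 \<omega>)))"
        unfolding Z_def by (intro sum.cong refl ident_int) auto
      finally show ?thesis .
    qed
    ultimately show ?thesis by simp
  qed

  have S_variance: "(\<integral>\<^sup>+\<omega>. ennreal ((S k \<omega> - expectation (S k))\<^sup>2) \<partial>M) \<le> k * (\<integral>\<^sup>+\<omega>. ennreal ((\<tau> c (Y 1 \<omega>))\<^sup>2) \<partial>M)"
    if kc: "real k \<le> c" for k c
  proof -
    have indepZ: "indep_vars (\<lambda>_. borel) Z {1..k}"
      unfolding Z_def[abs_def]
      by (rule indep_vars_compose2[OF indep_vars_subset[OF indep]]) auto
    note V = variance_sum_indep[OF _ indepZ, unfolded S_def[symmetric]]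
    have "(\<integral>\<^sup>+\<omega>. ennreal ((S k \<omega> - expectation (S k))\<^sup>2) \<partial>M) = ennreal (variance (S k))"
      using V(1) Z_int Z2_int by (subst nn_integral_eq_integral) auto
    also have "variance (S k) = (\<Sum>n\<in>{1..k}. variance (Z n))"
      using V(2) Z_int Z2_int by simp
    also have "\<dots> \<le> (\<Sum>n\<in>{1..k}. expectation (\<lambda>\<omega>. (\<tau> c (Y 1 \<omega>))\<^sup>2))"
    proof (rule sum_mono)
      fix n assume n: "n \<in> {1..k}"
      have "variance (Z n) \<le> expectation (\<lambda>\<omega>. (Z n \<omega>)\<^sup>2)"
        using n Z_int Z2_int by (subst variance_eq) auto
      also have "\<dots> = expectation (\<lambda>\<omega>. (\<tau> (real n) (Y 1 \<omega>))\<^sup>2)"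
        unfolding Z_def using n by (intro ident_int[of n "\<lambda>y. (\<tau> (real n) y)\<^sup>2"]) auto
      also have "\<dots> \<le> expectation (\<lambda>\<omega>. (\<tau> c (Y 1 \<omega>))\<^sup>2)"
        using n kc nonneg[of 1] \<tau>_bound(2)[OF nonneg[of 1]]
        by (intro integral_mono)
           (auto intro!: integrable_const_bound[of _ "(real n)\<^sup>2"] integrable_const_bound[of _ "c\<^sup>2"] simp: \<tau>_def power_mono)
      finally show "variance (Z n) \<le> expectation (\<lambda>\<omega>. (\<tau> c (Y 1 \<omega>))\<^sup>2)" .
    qed
    also have "\<dots> = k * expectation (\<lambda>\<omega>. (\<tau> c (Y 1 \<omega>))\<^sup>2)" by simp
    also have "ennreal \<dots> = k * (\<integral>\<^sup>+\<omega>. ennreal ((\<tau> c (Y 1 \<omega>))\<^sup>2) \<partial>M)"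
    proof -
      have "integrable M (\<lambda>\<omega>. (\<tau> c (Y 1 \<omega>))\<^sup>2)"
        using \<tau>_bound(2)[OF nonneg[of 1]] by (intro integrable_const_bound[of _ "c\<^sup>2"]) auto
      then show ?thesis by (simp add: nn_integral_eq_integral ennreal_mult ennreal_of_nat_eq_real_of_nat)
    qed
    finally show ?thesis by (simp add: ennreal_leI)
  qed

  have subsequence: "AE \<omega> in M. (\<lambda>j. S (nat \<lfloor>\<alpha> ^ j\<rfloor>) \<omega> / \<alpha> ^ j) \<longlonglongrightarrow> expectation (Y 1)" if \<alpha>: "\<alpha> > 1" for \<alpha> :: real
  proof -
    define k where "k j = nat \<lfloor>\<alpha> ^ j\<rfloor>" for j
    have pos: "0 < \<alpha> ^ j" for j using \<alpha> by simp
    have k_le: "real (k j) \<le> \<alpha> ^ j" for j unfolding k_def using pos[of j] by linarith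
    have "AE \<omega> in M. (\<lambda>j. ((S (k j) \<omega> - expectation (S (k j))) / \<alpha> ^ j)\<^sup>2) \<longlonglongrightarrow> 0"
    proof (rule AE_tendsto_zero_of_nn_integral_suminf)
      have "(\<integral>\<^sup>+\<omega>. ennreal (((S (k j) \<omega> - expectation (S (k j))) / \<alpha> ^ j)\<^sup>2) \<partial>M) \<le>
          (\<integral>\<^sup>+\<omega>. ennreal ((if Y 1 \<omega> \<le> \<alpha> ^ j then (Y 1 \<omega>)\<^sup>2 else 0) / \<alpha> ^ j) \<partial>M)" for j
      proof -
        let ?c = "\<alpha> ^ j"
        have "(\<integral>\<^sup>+\<omega>. ennreal (((S (k j) \<omega> - expectation (S (k j))) / ?c)\<^sup>2) \<partial>M) =
            (\<integral>\<^sup>+\<omega>. ennreal (1 / ?c\<^sup>2) * ennreal ((S (k j) \<omega> - expectation (S (k j)))\<^sup>2) \<partial>M)"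
          by (simp add: ennreal_mult[symmetric] power_divide)
        also have "\<dots> = ennreal (1 / ?c\<^sup>2) * (\<integral>\<^sup>+\<omega>. ennreal ((S (k j) \<omega> - expectation (S (k j)))\<^sup>2) \<partial>M)"
          by (rule nn_integral_cmult) measurable
        also have "\<dots> \<le> ennreal (1 / ?c\<^sup>2) * (k j * (\<integral>\<^sup>+\<omega>. ennreal ((\<tau> ?c (Y 1 \<omega>))\<^sup>2) \<partial>M))"
          by (intro mult_left_mono S_variance k_le) auto
        also have "\<dots> \<le> ennreal (1 / ?c\<^sup>2) * (ennreal ?c * (\<integral>\<^sup>+\<omega>. ennreal ((\<tau> ?c (Y 1 \<omega>))\<^sup>2) \<partial>M))"
          using k_le[of j] by (intro mult_left_mono mult_right_mono) (auto simp: ennreal_of_nat_eq_real_of_nat intro!: ennreal_leI)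
        also have "\<dots> = ennreal (1 / ?c) * (\<integral>\<^sup>+\<omega>. ennreal ((\<tau> ?c (Y 1 \<omega>))\<^sup>2) \<partial>M)"
          using pos[of j] by (simp add: mult.assoc[symmetric] ennreal_mult[symmetric] power2_eq_square)
        also have "\<dots> = (\<integral>\<^sup>+\<omega>. ennreal (1 / ?c) * ennreal ((\<tau> ?c (Y 1 \<omega>))\<^sup>2) \<partial>M)"
          by (rule nn_integral_cmult[symmetric]) measurable
        also have "\<dots> = (\<integral>\<^sup>+\<omega>. ennreal ((if Y 1 \<omega> \<le> ?c then (Y 1 \<omega>)\<^sup>2 else 0) / ?c) \<partial>M)"
          using pos[of j] by (intro nn_integral_cong) (auto simp: ennreal_mult[symmetric] \<tau>_def)
        finally show ?thesis .
      qed
      then have "(\<Sum>j. \<integral>\<^sup>+\<omega>. ennreal (((S (k j) \<omega> - expectation (S (k j))) / \<alpha> ^ j)\<^sup>2) \<partial>M) \<le>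
          (\<Sum>j. \<integral>\<^sup>+\<omega>. ennreal ((if Y 1 \<omega> \<le> \<alpha> ^ j then (Y 1 \<omega>)\<^sup>2 else 0) / \<alpha> ^ j) \<partial>M)"
        by (intro suminf_le) auto
      also have "\<dots> = (\<integral>\<^sup>+\<omega>. (\<Sum>j. ennreal ((if Y 1 \<omega> \<le> \<alpha> ^ j then (Y 1 \<omega>)\<^sup>2 else 0) / \<alpha> ^ j)) \<partial>M)"
        by (rule nn_integral_suminf[symmetric]) measurable
      also have "\<dots> \<le> (\<integral>\<^sup>+\<omega>. ennreal (\<alpha> / (\<alpha> - 1)) * ennreal (Y 1 \<omega>) \<partial>M)"
      proof (intro nn_integral_mono)
        fix \<omega>
        show "(\<Sum>j. ennreal ((if Y 1 \<omega> \<le> \<alpha> ^ j then (Y 1 \<omega>)\<^sup>2 else 0) / \<alpha> ^ j)) \<le> ennreal (\<alpha> / (\<alpha> - 1)) * ennreal (Y 1 \<omega>)"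
          unfolding suminf_eq_SUP
        proof (intro SUP_least)
          fix n
          have "(\<Sum>j<n. ennreal ((if Y 1 \<omega> \<le> \<alpha> ^ j then (Y 1 \<omega>)\<^sup>2 else 0) / \<alpha> ^ j)) =
              ennreal (\<Sum>j<n. (if Y 1 \<omega> \<le> \<alpha> ^ j then (Y 1 \<omega>)\<^sup>2 else 0) / \<alpha> ^ j)"
            using \<alpha> by (intro sum_ennreal) auto
          also have "\<dots> \<le> ennreal (\<alpha> / (\<alpha> - 1) * Y 1 \<omega>)"
            by (intro ennreal_leI sum_truncated_squares_le \<alpha> nonneg)
          also have "\<dots> = ennreal (\<alpha> / (\<alpha> - 1)) * ennreal (Y 1 \<omega>)"
            using \<alpha> nonneg[of 1 \<omega>] by (intro ennreal_mult) auto
          finally show "(\<Sum>j<n. ennreal ((if Y 1 \<omega> \<le> \<alpha> ^ j then (Y 1 \<omega>)\<^sup>2 else 0) / \<alpha> ^ j)) \<le>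
              ennreal (\<alpha> / (\<alpha> - 1)) * ennreal (Y 1 \<omega>)" .
        qed
      qed
      also have "\<dots> = ennreal (\<alpha> / (\<alpha> - 1)) * (\<integral>\<^sup>+\<omega>. ennreal (Y 1 \<omega>) \<partial>M)"
        by (rule nn_integral_cmult) measurable
      also have "\<dots> < \<infinity>" using fin_mean by (simp add: ennreal_mult_less_top)
      finally show "(\<Sum>j. \<integral>\<^sup>+\<omega>. ennreal (((S (k j) \<omega> - expectation (S (k j))) / \<alpha> ^ j)\<^sup>2) \<partial>M) < \<infinity>" .
    qed auto
    then show ?thesis
    proof eventually_elim
      fix \<omega> assume lim0: "(\<lambda>j. ((S (k j) \<omega> - expectation (S (k j))) / \<alpha> ^ j)\<^sup>2) \<longlonglongrightarrow> 0"
      have fluct: "(\<lambda>j. (S (k j) \<omega> - expectation (S (k j))) / \<alpha> ^ j) \<longlonglongrightarrow> 0"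
        using tendsto_real_sqrt[OF lim0]
        by (simp only: real_sqrt_abs real_sqrt_zero tendsto_rabs_zero_iff)
      have inv: "(\<lambda>j. inverse (\<alpha> ^ j)) \<longlonglongrightarrow> 0"
        using LIMSEQ_inverse_realpow_zero[OF \<alpha>] .
      have k_ratio: "(\<lambda>j. real (k j) / \<alpha> ^ j) \<longlonglongrightarrow> 1"
      proof (rule tendsto_sandwich[of "\<lambda>j. 1 - inverse (\<alpha> ^ j)" _ _ "\<lambda>_. 1"])
        show "\<forall>\<^sub>F j in sequentially. 1 - inverse (\<alpha> ^ j) \<le> real (k j) / \<alpha> ^ j"
        proof (intro always_eventually allI)
          fix j
          have "\<alpha> ^ j - 1 \<le> real (k j)" unfolding k_def using pos[of j] by linarith
          then have "(\<alpha> ^ j - 1) / \<alpha> ^ j \<le> real (k j) / \<alpha> ^ j"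
            using pos[of j] by (intro divide_right_mono) auto
          then show "1 - inverse (\<alpha> ^ j) \<le> real (k j) / \<alpha> ^ j"
            using \<alpha> by (simp add: diff_divide_distrib inverse_eq_divide)
        qed
        show "(\<lambda>j. 1 - inverse (\<alpha> ^ j)) \<longlonglongrightarrow> 1" using tendsto_diff[OF tendsto_const inv, of 1] by simp
      qed (use k_le pos in \<open>auto intro!: always_eventually\<close>)
      have k_top: "filterlim k at_top sequentially"
      proof -
        have "filterlim (\<lambda>j. \<alpha> ^ j) at_top sequentially"
          using \<alpha> pos
          by (intro filterlim_at_infinity_imp_filterlim_at_top filterlim_realpow_sequentially_gt1) auto
        then show ?thesis unfolding k_def
          by (intro filterlim_compose[OF filterlim_nat_sequentially] filterlim_compose[OF filterlim_floor_sequentially])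
      qed
      have "(\<lambda>j. (expectation (S (k j)) / real (k j)) * (real (k j) / \<alpha> ^ j)) \<longlonglongrightarrow> expectation (Y 1) * 1"
        by (intro tendsto_mult k_ratio filterlim_compose[OF mean k_top])
      moreover have "(expectation (S (k j)) / real (k j)) * (real (k j) / \<alpha> ^ j) = expectation (S (k j)) / \<alpha> ^ j" for j
      proof (cases "k j = 0")
        case True
        have "expectation (S 0) = 0" by (simp add: S_def[abs_def])
        then show ?thesis using True by simp
      qed simp
      ultimately have "(\<lambda>j. expectation (S (k j)) / \<alpha> ^ j) \<longlonglongrightarrow> expectation (Y 1)"
        by (simp only: mult_1_right)
      from tendsto_add[OF fluct this]
      show "(\<lambda>j. S (nat \<lfloor>\<alpha> ^ j\<rfloor>) \<omega> / \<alpha> ^ j) \<longlonglongrightarrow> expectation (Y 1)"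
        by (simp add: diff_divide_distrib k_def)
    qed
  qed

  have "AE \<omega> in M. \<forall>m. (\<lambda>j. S (nat \<lfloor>(1 + 1 / real (Suc m)) ^ j\<rfloor>) \<omega> / (1 + 1 / real (Suc m)) ^ j) \<longlonglongrightarrow> expectation (Y 1)"
    unfolding AE_all_countable by (intro allI subsequence) simp
  with truncation show ?thesis
  proof eventually_elim
    fix \<omega>
    assume tr: "(\<lambda>n. Y n \<omega> - Z n \<omega>) \<longlonglongrightarrow> 0"
      and sub: "\<forall>m. (\<lambda>j. S (nat \<lfloor>(1 + 1 / real (Suc m)) ^ j\<rfloor>) \<omega> / (1 + 1 / real (Suc m)) ^ j) \<longlonglongrightarrow> expectation (Y 1)"
    have "(\<lambda>N. S N \<omega> / N) \<longlonglongrightarrow> expectation (Y 1)"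
    proof (rule tendsto_mean_of_geometric_subsequences)
      show "mono (\<lambda>N. S N \<omega>)"
        unfolding mono_iff_le_Suc S_def using Z_bound by simp
      show "0 \<le> S n \<omega>" for n unfolding S_def by (intro sum_nonneg Z_bound)
    qed (use sub in simp)
    from tendsto_add[OF this cesaro_mean[OF tr]]
    show "(\<lambda>N. (\<Sum>n=1..N. Y n \<omega>) / N) \<longlonglongrightarrow> expectation (Y 1)"
      by (simp add: S_def sum_subtractf diff_divide_distrib)
  qed
qed

section \<open>Processes given by successive conditional densities\<close>

lemma (in sigma_finite_measure) density_prob_algebra:
  assumes k [measurable]: "(\<lambda>(x, a). k x a) \<in> borel_measurable (N \<Otimes>\<^sub>M M)"
    and k1: "\<And>x. x \<in> space N \<Longrightarrow> (\<integral>\<^sup>+a. k x a \<partial>M) = 1"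
  shows "(\<lambda>x. density M (k x)) \<in> N \<rightarrow>\<^sub>M prob_algebra M"
proof -
  have slice: "k x \<in> borel_measurable M" if "x \<in> space N" for x
    using measurable_compose[OF measurable_Pair1'[OF that] k] by simp
  have prob: "prob_space (density M (k x))" if "x \<in> space N" for x
    using k1[OF that] slice[OF that]
    by (intro prob_spaceI) (simp add: emeasure_density cong: nn_integral_cong)
  have "(\<lambda>x. density M (k x)) \<in> N \<rightarrow>\<^sub>M subprob_algebra M"
  proof (rule measurable_subprob_algebra)
    fix A assume A [measurable]: "A \<in> sets M"
    have "(\<lambda>p. k (fst p) (snd p) * indicator A (snd p)) \<in> borel_measurable (N \<Otimes>\<^sub>M M)"
      using k unfolding case_prod_unfold by (rule borel_measurable_times_ennreal) measurable
    from borel_measurable_nn_integral_fst[OF this]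
    have meas: "(\<lambda>x. \<integral>\<^sup>+a. k x a * indicator A a \<partial>M) \<in> borel_measurable N"
      by simp
    have eq: "emeasure (density M (k x)) A = (\<integral>\<^sup>+a. k x a * indicator A a \<partial>M)" if "x \<in> space N" for x
      using that A by (simp add: emeasure_density slice)
    show "(\<lambda>x. emeasure (density M (k x)) A) \<in> borel_measurable N"
      using meas by (subst measurable_cong[OF eq])
  qed (auto intro: prob_space_imp_subprob_space prob)
  then show ?thesis by (intro measurable_prob_algebraI prob)
qed

text \<open>The value \<open>k t x a\<close> is the density at \<open>a\<close>, with respect to \<open>M\<close>, of coordinate \<open>t + 1\<close> given that the
  coordinates \<open>1, \<dots>, t\<close> form the path \<open>x\<close>. The kernels need not be normalized here, so that
  sub-probability kernels (the overlap of two kernels) are covered as well.\<close>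

locale density_kernels = sigma_finite_measure M for M :: "'a measure" +
  fixes T :: nat and k :: "nat \<Rightarrow> (nat \<Rightarrow> 'a) \<Rightarrow> 'a \<Rightarrow> ennreal"
  assumes kernel_measurable [measurable]:
      "\<And>t. t < T \<Longrightarrow> (\<lambda>(x, a). k t x a) \<in> borel_measurable ((\<Pi>\<^sub>M s\<in>{1..t}. M) \<Otimes>\<^sub>M M)"
begin

text \<open>The product of the first \<open>t\<close> kernels; for normalized kernels, the law of the first \<open>t\<close> coordinates.
  The factors restrict \<open>x\<close> because paths are \<open>undefined\<close> outside their
  index set, and the kernels are only measurable on such paths.\<close>

definition chain :: "nat \<Rightarrow> (nat \<Rightarrow> 'a) measure" where
  "chain t = density (\<Pi>\<^sub>M s\<in>{1..t}. M) (\<lambda>x. \<Prod>s<t. k s (restrict x {1..s}) (x (Suc s)))"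

sublocale product_sigma_finite "\<lambda>_. M" by standard

lemma space_chain [simp]: "space (chain t) = space (\<Pi>\<^sub>M s\<in>{1..t}. M)"
  and sets_chain [simp, measurable_cong]: "sets (chain t) = sets (\<Pi>\<^sub>M s\<in>{1..t}. M)"
  by (simp_all add: chain_def)

lemma kernel_measurable_component:
  assumes "s < t" "t \<le> T"
  shows "(\<lambda>x. k s (restrict x {1..s}) (x (Suc s))) \<in> borel_measurable (\<Pi>\<^sub>M s\<in>{1..t}. M)"
proof -
  have "(\<lambda>x. (restrict x {1..s}, x (Suc s))) \<in> (\<Pi>\<^sub>M s\<in>{1..t}. M) \<rightarrow>\<^sub>M (\<Pi>\<^sub>M s\<in>{1..s}. M) \<Otimes>\<^sub>M M"
    using assms by (intro measurable_Pair measurable_restrict_subset measurable_component_singleton) auto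
  from measurable_compose[OF this kernel_measurable[of s]] show ?thesis using assms by simp
qed

lemma density_measurable [measurable]:
  assumes "t \<le> T"
  shows "(\<lambda>x. \<Prod>s<t. k s (restrict x {1..s}) (x (Suc s))) \<in> borel_measurable (\<Pi>\<^sub>M s\<in>{1..t}. M)"
  using assms by (intro borel_measurable_prod_ennreal kernel_measurable_component) auto

lemma nn_integral_chain_0:
  assumes "F \<in> borel_measurable (\<Pi>\<^sub>M s\<in>{1..0}. M)"
  shows "(\<integral>\<^sup>+x. F x \<partial>chain 0) = F (\<lambda>_. undefined)"
  using assms by (simp add: chain_def nn_integral_density PiM_empty nn_integral_count_space_finite)

lemma nn_integral_chain_Suc:
  assumes t: "t < T" and F: "F \<in> borel_measurable (\<Pi>\<^sub>M s\<in>{1..Suc t}. M)"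
  shows "(\<integral>\<^sup>+x. F x \<partial>chain (Suc t)) = (\<integral>\<^sup>+x. (\<integral>\<^sup>+a. k t x a * F (x(Suc t := a)) \<partial>M) \<partial>chain t)"
proof -
  define D where "D = (\<lambda>t x. \<Prod>s<t. k s (restrict x {1..s}) (x (Suc s)))"
  have D_meas: "D u \<in> borel_measurable (\<Pi>\<^sub>M s\<in>{1..u}. M)" if "u \<le> T" for u
    unfolding D_def using density_measurable[OF that] .
  have ins: "{1..Suc t} = insert (Suc t) {1..t}" by auto
  have upd: "(\<lambda>(x, a). x(Suc t := a)) \<in> (\<Pi>\<^sub>M s\<in>{1..t}. M) \<Otimes>\<^sub>M M \<rightarrow>\<^sub>M (\<Pi>\<^sub>M s\<in>{1..Suc t}. M)"
    unfolding ins by (rule measurable_add_dim)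
  have F': "(\<lambda>(x, a). F (x(Suc t := a))) \<in> borel_measurable ((\<Pi>\<^sub>M s\<in>{1..t}. M) \<Otimes>\<^sub>M M)"
    using measurable_compose[OF upd F] by (simp add: case_prod_unfold)
  have kF: "(\<lambda>(x, a). k t x a * F (x(Suc t := a))) \<in> borel_measurable ((\<Pi>\<^sub>M s\<in>{1..t}. M) \<Otimes>\<^sub>M M)"
    using kernel_measurable[OF t] F' unfolding case_prod_unfold by (rule borel_measurable_times_ennreal)
  have split: "D (Suc t) (x(Suc t := a)) = D t x * k t x a" if "x \<in> space (\<Pi>\<^sub>M s\<in>{1..t}. M)" for x a
  proof -
    have "restrict (x(Suc t := a)) {1..s} = restrict x {1..s}" if "s \<le> t" for s
      using that by (auto simp: restrict_def)
    moreover have "restrict x {1..t} = x"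
      using that by (auto simp: space_PiM)
    ultimately show ?thesis
      by (auto simp: D_def intro!: arg_cong2[where f="(*)"] prod.cong)
  qed
  have DF: "(\<lambda>x. D (Suc t) x * F x) \<in> borel_measurable (Pi\<^sub>M (insert (Suc t) {1..t}) (\<lambda>s. M))"
    using borel_measurable_times_ennreal[OF D_meas[of "Suc t"] F] t unfolding ins by simp
  have "(\<integral>\<^sup>+x. F x \<partial>chain (Suc t)) = (\<integral>\<^sup>+x. D (Suc t) x * F x \<partial>(\<Pi>\<^sub>M s\<in>{1..Suc t}. M))"
    using F D_meas[of "Suc t"] t by (simp add: chain_def D_def nn_integral_density)
  also have "\<dots> = (\<integral>\<^sup>+x. (\<integral>\<^sup>+a. D (Suc t) (x(Suc t := a)) * F (x(Suc t := a)) \<partial>M) \<partial>(\<Pi>\<^sub>M s\<in>{1..t}. M))"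
    unfolding ins by (rule product_nn_integral_insert) (use DF in auto)
  also have "\<dots> = (\<integral>\<^sup>+x. D t x * (\<integral>\<^sup>+a. k t x a * F (x(Suc t := a)) \<partial>M) \<partial>(\<Pi>\<^sub>M s\<in>{1..t}. M))"
  proof (intro nn_integral_cong)
    fix x assume x: "x \<in> space (\<Pi>\<^sub>M s\<in>{1..t}. M)"
    have "(\<lambda>a. k t x a * F (x(Suc t := a))) \<in> borel_measurable M"
      using measurable_compose[OF measurable_Pair1'[OF x] kF] by simp
    from nn_integral_cmult[OF this, of "D t x"] x
    show "(\<integral>\<^sup>+a. D (Suc t) (x(Suc t := a)) * F (x(Suc t := a)) \<partial>M) = D t x * (\<integral>\<^sup>+a. k t x a * F (x(Suc t := a)) \<partial>M)"
      by (simp add: split mult.assoc)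
  qed
  also have "\<dots> = (\<integral>\<^sup>+x. (\<integral>\<^sup>+a. k t x a * F (x(Suc t := a)) \<partial>M) \<partial>chain t)"
    using D_meas[of t] t borel_measurable_nn_integral_fst[OF kF]
    by (simp add: chain_def D_def nn_integral_density)
  finally show ?thesis .
qed

lemma kernel_slice_measurable:
  assumes "t < T" "x \<in> space (\<Pi>\<^sub>M s\<in>{1..t}. M)"
  shows "k t x \<in> borel_measurable M"
  using measurable_compose[OF measurable_Pair1'[OF assms(2)] kernel_measurable[OF assms(1)]] by simp

end

locale density_chain = density_kernels +
  assumes kernel_integral: "\<And>t x. t < T \<Longrightarrow> x \<in> space (\<Pi>\<^sub>M s\<in>{1..t}. M) \<Longrightarrow> (\<integral>\<^sup>+a. k t x a \<partial>M) = 1"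
begin

lemma nn_integral_chain_prefix:
  assumes "t \<le> u" "u \<le> T" and F: "F \<in> borel_measurable (\<Pi>\<^sub>M s\<in>{1..t}. M)"
  shows "(\<integral>\<^sup>+x. F (restrict x {1..t}) \<partial>chain u) = (\<integral>\<^sup>+x. F x \<partial>chain t)"
  using assms(1,2)
proof (induction u rule: dec_induct)
  case base
  show ?case by (intro nn_integral_cong) (auto simp: space_PiM)
next
  case (step u)
  have meas: "(\<lambda>x. F (restrict x {1..t})) \<in> borel_measurable (\<Pi>\<^sub>M s\<in>{1..Suc u}. M)"
    using step by (intro measurable_compose[OF measurable_restrict_subset F]) auto
  have "(\<integral>\<^sup>+x. F (restrict x {1..t}) \<partial>chain (Suc u)) =
    (\<integral>\<^sup>+x. (\<integral>\<^sup>+a. k u x a * F (restrict (x(Suc u := a)) {1..t}) \<partial>M) \<partial>chain u)"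
    using step by (intro nn_integral_chain_Suc meas) auto
  also have "\<dots> = (\<integral>\<^sup>+x. F (restrict x {1..t}) \<partial>chain u)"
  proof (intro nn_integral_cong)
    fix x assume x: "x \<in> space (chain u)"
    have "restrict (x(Suc u := a)) {1..t} = restrict x {1..t}" for a
      using step by (auto simp: restrict_def)
    then show "(\<integral>\<^sup>+a. k u x a * F (restrict (x(Suc u := a)) {1..t}) \<partial>M) = F (restrict x {1..t})"
      using x step by (simp add: nn_integral_multc kernel_slice_measurable kernel_integral)
  qed
  also have "\<dots> = (\<integral>\<^sup>+x. F x \<partial>chain t)"
    using step.prems by (intro step.IH) simp
  finally show ?case .
qed

lemma prob_space_chain:
  assumes "t \<le> T"
  shows "prob_space (chain t)"
proof
  have "(\<integral>\<^sup>+x. 1 \<partial>chain t) = (\<integral>\<^sup>+x. 1 \<partial>chain 0)"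
    using assms by (intro nn_integral_chain_prefix) auto
  also have "\<dots> = 1" by (rule nn_integral_chain_0) simp
  finally show "emeasure (chain t) (space (chain t)) = 1" by (simp only: nn_integral_const mult_1)
qed

lemma kernel_prob_algebra:
  assumes t: "t < T"
  shows "(\<lambda>x. density M (k t x)) \<in> (\<Pi>\<^sub>M s\<in>{1..t}. M) \<rightarrow>\<^sub>M prob_algebra M"
  using kernel_measurable[OF t] kernel_integral[OF t] by (rule density_prob_algebra)

lemma is_cond_law_chain:
  assumes t: "t < T"
  shows "is_cond_law (chain T) (\<Pi>\<^sub>M s\<in>{1..t}. M) (\<lambda>x. restrict x {1..t}) M (\<lambda>x. x (Suc t)) (\<lambda>x. density M (k t x))"
  unfolding is_cond_law_def
proof (intro conjI ballI)
  show "(\<lambda>x. density M (k t x)) \<in> (\<Pi>\<^sub>M s\<in>{1..t}. M) \<rightarrow>\<^sub>M prob_algebra M"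
    by (rule kernel_prob_algebra[OF t])
next
  fix A B assume A [measurable]: "A \<in> sets (\<Pi>\<^sub>M s\<in>{1..t}. M)" and B [measurable]: "B \<in> sets M"
  define G :: "(nat \<Rightarrow> 'a) \<Rightarrow> ennreal" where "G = (\<lambda>x. indicator A (restrict x {1..t}) * indicator B (x (Suc t)))"
  have restr: "(\<lambda>x. restrict x {1..t}) \<in> (\<Pi>\<^sub>M s\<in>{1..u}. M) \<rightarrow>\<^sub>M (\<Pi>\<^sub>M s\<in>{1..t}. M)" if "t \<le> u" for u
    using that by (intro measurable_restrict_subset) auto
  have comp: "(\<lambda>x. x (Suc t)) \<in> (\<Pi>\<^sub>M s\<in>{1..u}. M) \<rightarrow>\<^sub>M M" if "Suc t \<le> u" for u
    using that by (intro measurable_component_singleton) auto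
  have [measurable]: "(\<lambda>x. restrict x {1..t}) \<in> chain T \<rightarrow>\<^sub>M (\<Pi>\<^sub>M s\<in>{1..t}. M)"
    "(\<lambda>x. x (Suc t)) \<in> chain T \<rightarrow>\<^sub>M M"
    "(\<lambda>x. restrict x {1..t}) \<in> (\<Pi>\<^sub>M s\<in>{1..Suc t}. M) \<rightarrow>\<^sub>M (\<Pi>\<^sub>M s\<in>{1..t}. M)"
    "(\<lambda>x. x (Suc t)) \<in> (\<Pi>\<^sub>M s\<in>{1..Suc t}. M) \<rightarrow>\<^sub>M M"
    using t restr[of T] restr[of "Suc t"] comp[of T] comp[of "Suc t"]
    by (auto simp: measurable_cong_sets[OF sets_chain refl])
  have G: "G \<in> borel_measurable (\<Pi>\<^sub>M s\<in>{1..Suc t}. M)"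
    unfolding G_def by measurable
  have "{x \<in> space (chain T). restrict x {1..t} \<in> A \<and> x (Suc t) \<in> B} \<in> sets (chain T)"
    by measurable
  then have "emeasure (chain T) {x \<in> space (chain T). restrict x {1..t} \<in> A \<and> x (Suc t) \<in> B} =
      (\<integral>\<^sup>+x. indicator {x \<in> space (chain T). restrict x {1..t} \<in> A \<and> x (Suc t) \<in> B} x \<partial>chain T)"
    by simp
  also have "\<dots> = (\<integral>\<^sup>+x. G (restrict x {1..Suc t}) \<partial>chain T)"
    by (intro nn_integral_cong) (auto simp: G_def indicator_def min_def)
  also have "\<dots> = (\<integral>\<^sup>+x. G x \<partial>chain (Suc t))"
    using t by (intro nn_integral_chain_prefix G) auto
  also have "\<dots> = (\<integral>\<^sup>+x. (\<integral>\<^sup>+a. k t x a * G (x(Suc t := a)) \<partial>M) \<partial>chain t)"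
    by (rule nn_integral_chain_Suc[OF t G])
  also have "\<dots> = (\<integral>\<^sup>+x. emeasure (density M (k t x)) B * indicator A x \<partial>chain t)"
  proof (intro nn_integral_cong)
    fix x assume x: "x \<in> space (chain t)"
    then have rx: "restrict (x(Suc t := a)) {1..t} = x" for a
      by (auto simp: space_PiM restrict_def PiE_def extensional_def fun_eq_iff)
    have "(\<integral>\<^sup>+a. k t x a * G (x(Suc t := a)) \<partial>M) = (\<integral>\<^sup>+a. (k t x a * indicator B a) * indicator A x \<partial>M)"
      unfolding G_def rx by (simp add: ac_simps)
    also have "\<dots> = (\<integral>\<^sup>+a. k t x a * indicator B a \<partial>M) * indicator A x"
      using x t by (intro nn_integral_multc borel_measurable_times_ennreal kernel_slice_measurable) auto
    finally show "(\<integral>\<^sup>+a. k t x a * G (x(Suc t := a)) \<partial>M) = emeasure (density M (k t x)) B * indicator A x"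
      using x t by (simp add: emeasure_density kernel_slice_measurable)
  qed
  also have "\<dots> = (\<integral>\<^sup>+x. emeasure (density M (k t (restrict x {1..t}))) B * indicator A (restrict x {1..t}) \<partial>chain T)"
  proof (rule nn_integral_chain_prefix[symmetric])
    have [measurable]: "(\<lambda>x. density M (k t x)) \<in> (\<Pi>\<^sub>M s\<in>{1..t}. M) \<rightarrow>\<^sub>M subprob_algebra M"
      using kernel_prob_algebra[OF t] by (rule measurable_prob_algebraD)
    show "(\<lambda>x. emeasure (density M (k t x)) B * indicator A x) \<in> borel_measurable (\<Pi>\<^sub>M s\<in>{1..t}. M)"
      by measurable
  qed (use t in auto)
  finally show "emeasure (chain T) {x \<in> space (chain T). restrict x {1..t} \<in> A \<and> x (Suc t) \<in> B} =
    (\<integral>\<^sup>+x. emeasure (density M (k t (restrict x {1..t}))) B * indicator A (restrict x {1..t}) \<partial>chain T)" .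
qed

end

text \<open>Conditional laws are transported by a map \<open>g\<close> under which the conditioning variable changes by \<open>\<zeta>\<close> and the
  conditioned variable by \<open>h\<close>, provided that the image of the kernel depends on the condition only through \<open>\<zeta>\<close>.\<close>

lemma is_cond_law_distr:
  assumes K: "is_cond_law N S X R Y K"
    and X: "X \<in> N \<rightarrow>\<^sub>M S" and Y: "Y \<in> N \<rightarrow>\<^sub>M R" and g: "g \<in> N \<rightarrow>\<^sub>M N'"
    and X': "X' \<in> N' \<rightarrow>\<^sub>M S'" and Y': "Y' \<in> N' \<rightarrow>\<^sub>M R'"
    and \<zeta>: "\<zeta> \<in> S \<rightarrow>\<^sub>M S'" and h: "h \<in> R \<rightarrow>\<^sub>M R'"
    and XX': "\<And>\<omega>. \<omega> \<in> space N \<Longrightarrow> X' (g \<omega>) = \<zeta> (X \<omega>)"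
    and YY': "\<And>\<omega>. \<omega> \<in> space N \<Longrightarrow> Y' (g \<omega>) = h (Y \<omega>)"
    and K': "K' \<in> S' \<rightarrow>\<^sub>M prob_algebra R'"
    and KK': "\<And>x. x \<in> space S \<Longrightarrow> K' (\<zeta> x) = distr (K x) R' h"
  shows "is_cond_law (distr N N' g) S' X' R' Y' K'"
  unfolding is_cond_law_def
proof (intro conjI ballI K')
  fix A B assume A [measurable]: "A \<in> sets S'" and B [measurable]: "B \<in> sets R'"
  note [measurable] = X Y g X' Y' \<zeta> h
  have [measurable]: "K' \<in> S' \<rightarrow>\<^sub>M subprob_algebra R'" using K' by (rule measurable_prob_algebraD)
  have Ksp: "K \<in> S \<rightarrow>\<^sub>M prob_algebra R" using K by (simp add: is_cond_law_def)
  define A' B' where "A' = \<zeta> -` A \<inter> space S" and "B' = h -` B \<inter> space R"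
  have A': "A' \<in> sets S" and B': "B' \<in> sets R" unfolding A'_def B'_def by measurable
  have "emeasure (distr N N' g) {\<omega> \<in> space (distr N N' g). X' \<omega> \<in> A \<and> Y' \<omega> \<in> B} =
    emeasure N (g -` {\<omega> \<in> space N'. X' \<omega> \<in> A \<and> Y' \<omega> \<in> B} \<inter> space N)"
    by (subst emeasure_distr) auto
  also have "g -` {\<omega> \<in> space N'. X' \<omega> \<in> A \<and> Y' \<omega> \<in> B} \<inter> space N = {\<omega> \<in> space N. X \<omega> \<in> A' \<and> Y \<omega> \<in> B'}"
    using XX' YY' measurable_space[OF g] measurable_space[OF X] measurable_space[OF Y] by (auto simp: A'_def B'_def)
  also have "emeasure N \<dots> = (\<integral>\<^sup>+\<omega>. emeasure (K (X \<omega>)) B' * indicator A' (X \<omega>) \<partial>N)"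
    using K A' B' by (simp add: is_cond_law_def)
  also have "\<dots> = (\<integral>\<^sup>+\<omega>. emeasure (K' (X' (g \<omega>))) B * indicator A (X' (g \<omega>)) \<partial>N)"
  proof (intro nn_integral_cong)
    fix \<omega> assume w: "\<omega> \<in> space N"
    then have xs: "X \<omega> \<in> space S" using measurable_space[OF X] by auto
    then have "K (X \<omega>) \<in> space (prob_algebra R)" using measurable_space[OF Ksp] by auto
    then have sK: "sets (K (X \<omega>)) = sets R" by (simp add: space_prob_algebra)
    then have "emeasure (distr (K (X \<omega>)) R' h) B = emeasure (K (X \<omega>)) B'"
      using h sets_eq_imp_space_eq[OF sK] by (subst emeasure_distr) (auto simp: B'_def cong: measurable_cong_sets)
    then show "emeasure (K (X \<omega>)) B' * indicator A' (X \<omega>) = emeasure (K' (X' (g \<omega>))) B * indicator A (X' (g \<omega>))"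
      using xs w by (simp add: KK' XX' A'_def indicator_def)
  qed
  also have "\<dots> = (\<integral>\<^sup>+\<omega>. emeasure (K' (X' \<omega>)) B * indicator A (X' \<omega>) \<partial>distr N N' g)"
    by (subst nn_integral_distr) measurable
  finally show "emeasure (distr N N' g) {\<omega> \<in> space (distr N N' g). X' \<omega> \<in> A \<and> Y' \<omega> \<in> B} =
    (\<integral>\<^sup>+\<omega>. emeasure (K' (X' \<omega>)) B * indicator A (X' \<omega>) \<partial>distr N N' g)" .
qed

text \<open>If a coordinatewise map sends each kernel to a kernel that depends only on the image of the past, then it sends
  the chain to the chain of the image kernels. This identifies the marginals of the path coupling below.\<close>

lemma distr_chain:
  assumes "density_kernels M T k" and "density_kernels M' T k'" and h: "h \<in> M \<rightarrow>\<^sub>M M'"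
    and kk': "\<And>t z. t < T \<Longrightarrow> z \<in> space (\<Pi>\<^sub>M s\<in>{1..t}. M) \<Longrightarrow>
      distr (density M (k t z)) M' h = density M' (k' t (\<lambda>s\<in>{1..t}. h (z s)))"
  shows "t \<le> T \<Longrightarrow> distr (density_kernels.chain M k t) (\<Pi>\<^sub>M s\<in>{1..t}. M') (\<lambda>z. \<lambda>s\<in>{1..t}. h (z s)) = density_kernels.chain M' k' t"
proof -
  interpret C: density_kernels M T k by fact
  interpret C': density_kernels M' T k' by fact
  have map_meas [measurable]: "(\<lambda>z. \<lambda>s\<in>{1..t}. h (z s)) \<in> (\<Pi>\<^sub>M s\<in>{1..t}. M) \<rightarrow>\<^sub>M (\<Pi>\<^sub>M s\<in>{1..t}. M')" for t
    by (intro measurable_restrict measurable_compose[OF _ h] measurable_component_singleton)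
  have key: "(\<integral>\<^sup>+z. F (\<lambda>s\<in>{1..t}. h (z s)) \<partial>C.chain t) = (\<integral>\<^sup>+x. F x \<partial>C'.chain t)"
    if "t \<le> T" "F \<in> borel_measurable (\<Pi>\<^sub>M s\<in>{1..t}. M')" for t F
    using that
  proof (induction t arbitrary: F)
    case 0
    have "(\<integral>\<^sup>+z. F (\<lambda>s\<in>{1..0}. h (z s)) \<partial>C.chain 0) = F (\<lambda>s\<in>{1..0}. h undefined)"
      using 0(2) by (intro C.nn_integral_chain_0 measurable_compose[OF map_meas]) auto
    also have "(\<lambda>s\<in>{1..0::nat}. h undefined) = (\<lambda>_. undefined)" by auto
    also have "F (\<lambda>_. undefined) = (\<integral>\<^sup>+x. F x \<partial>C'.chain 0)"
      using 0(2) by (rule C'.nn_integral_chain_0[symmetric])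
    finally show ?case .
  next
    case (Suc t)
    then have t: "t < T" by simp
    note F = Suc.prems(2)
    have ins: "{1..Suc t} = insert (Suc t) {1..t}" by auto
    have upd: "(\<lambda>(x, a). x(Suc t := a)) \<in> (\<Pi>\<^sub>M s\<in>{1..t}. M') \<Otimes>\<^sub>M M' \<rightarrow>\<^sub>M (\<Pi>\<^sub>M s\<in>{1..Suc t}. M')"
      unfolding ins by (rule measurable_add_dim)
    have F' [measurable]: "(\<lambda>(x, a). F (x(Suc t := a))) \<in> borel_measurable ((\<Pi>\<^sub>M s\<in>{1..t}. M') \<Otimes>\<^sub>M M')"
      using measurable_compose[OF upd F] by (simp only: case_prod_unfold)
    have [measurable]: "(\<lambda>(x, a). k' t x a) \<in> borel_measurable ((\<Pi>\<^sub>M s\<in>{1..t}. M') \<Otimes>\<^sub>M M')"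
      using t by (rule C'.kernel_measurable)
    have "(\<integral>\<^sup>+z. F (\<lambda>s\<in>{1..Suc t}. h (z s)) \<partial>C.chain (Suc t)) =
      (\<integral>\<^sup>+z. (\<integral>\<^sup>+a. k t z a * F (\<lambda>s\<in>{1..Suc t}. h ((z(Suc t := a)) s)) \<partial>M) \<partial>C.chain t)"
      by (intro C.nn_integral_chain_Suc t measurable_compose[OF map_meas F])
    also have "\<dots> = (\<integral>\<^sup>+z. (\<integral>\<^sup>+a. k' t (\<lambda>s\<in>{1..t}. h (z s)) a * F ((\<lambda>s\<in>{1..t}. h (z s))(Suc t := a)) \<partial>M') \<partial>C.chain t)"
    proof (intro nn_integral_cong)
      fix z assume z: "z \<in> space (C.chain t)"
      let ?x = "\<lambda>s\<in>{1..t}. h (z s)"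
      have x: "?x \<in> space (\<Pi>\<^sub>M s\<in>{1..t}. M')"
        using z unfolding C.space_chain by (rule measurable_space[OF map_meas])
      have Fx [measurable]: "(\<lambda>a. F (?x(Suc t := a))) \<in> borel_measurable M'"
        using measurable_compose[OF measurable_Pair1'[OF x] F'] by simp
      note [measurable] = h C.kernel_slice_measurable[OF t z[unfolded C.space_chain]] C'.kernel_slice_measurable[OF t x]
      have "(\<lambda>s\<in>{1..Suc t}. h ((z(Suc t := a)) s)) = ?x(Suc t := h a)" for a
        by (auto simp: restrict_def fun_eq_iff)
      then have "(\<integral>\<^sup>+a. k t z a * F (\<lambda>s\<in>{1..Suc t}. h ((z(Suc t := a)) s)) \<partial>M) =
        (\<integral>\<^sup>+a. k t z a * F (?x(Suc t := h a)) \<partial>M)"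
        by (simp only:)
      also have "\<dots> = (\<integral>\<^sup>+a. F (?x(Suc t := h a)) \<partial>density M (k t z))"
        by (rule nn_integral_density[symmetric]) measurable
      also have "\<dots> = (\<integral>\<^sup>+a. F (?x(Suc t := a)) \<partial>distr (density M (k t z)) M' h)"
        by (rule nn_integral_distr[symmetric]) measurable
      also have "\<dots> = (\<integral>\<^sup>+a. k' t ?x a * F (?x(Suc t := a)) \<partial>M')"
        unfolding kk'[OF t z[unfolded C.space_chain]] by (rule nn_integral_density) measurable
      finally show "(\<integral>\<^sup>+a. k t z a * F (\<lambda>s\<in>{1..Suc t}. h ((z(Suc t := a)) s)) \<partial>M) =
        (\<integral>\<^sup>+a. k' t ?x a * F (?x(Suc t := a)) \<partial>M')" .
    qed
    also have "\<dots> = (\<integral>\<^sup>+x. (\<integral>\<^sup>+a. k' t x a * F (x(Suc t := a)) \<partial>M') \<partial>C'.chain t)"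
      using t by (intro Suc.IH) measurable
    also have "\<dots> = (\<integral>\<^sup>+x. F x \<partial>C'.chain (Suc t))"
      by (rule C'.nn_integral_chain_Suc[OF t F, symmetric])
    finally show ?case .
  qed
  show "distr (C.chain t) (\<Pi>\<^sub>M s\<in>{1..t}. M') (\<lambda>z. \<lambda>s\<in>{1..t}. h (z s)) = C'.chain t" if t: "t \<le> T"
  proof (rule measure_eqI)
    fix A assume A: "A \<in> sets (distr (C.chain t) (\<Pi>\<^sub>M s\<in>{1..t}. M') (\<lambda>z. \<lambda>s\<in>{1..t}. h (z s)))"
    have "emeasure (distr (C.chain t) (\<Pi>\<^sub>M s\<in>{1..t}. M') (\<lambda>z. \<lambda>s\<in>{1..t}. h (z s))) A =
      (\<integral>\<^sup>+x. indicator A x \<partial>distr (C.chain t) (\<Pi>\<^sub>M s\<in>{1..t}. M') (\<lambda>z. \<lambda>s\<in>{1..t}. h (z s)))"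
      using A by simp
    also have "\<dots> = (\<integral>\<^sup>+z. indicator A (\<lambda>s\<in>{1..t}. h (z s)) \<partial>C.chain t)"
    proof (rule nn_integral_distr)
      show "(\<lambda>z. \<lambda>s\<in>{1..t}. h (z s)) \<in> C.chain t \<rightarrow>\<^sub>M (\<Pi>\<^sub>M s\<in>{1..t}. M')" by measurable
    qed (use A in simp)
    also have "\<dots> = (\<integral>\<^sup>+x. indicator A x \<partial>C'.chain t)"
      using A by (intro key t) auto
    finally show "emeasure (distr (C.chain t) (\<Pi>\<^sub>M s\<in>{1..t}. M') (\<lambda>z. \<lambda>s\<in>{1..t}. h (z s))) A = emeasure (C'.chain t) A"
      using A by simp
  qed simp
qed

section \<open>Coupling two densities so that they agree as often as possible\<close>

text \<open>The mass on which two densities are made to agree. If the flag \<open>e\<close> is false, no agreement is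
  sought, and the coupling built below is the product coupling.\<close>

definition overlap :: "bool \<Rightarrow> ('a \<Rightarrow> ennreal) \<Rightarrow> ('a \<Rightarrow> ennreal) \<Rightarrow> 'a \<Rightarrow> ennreal" where
  "overlap e f g a = (if e then min (f a) (g a) else 0)"

text \<open>A coupling of the densities \<open>f\<close> and \<open>g\<close>, realized by a density on triples \<open>(a, b, s)\<close>. The first point is
  \<open>a\<close>; the second point is \<open>a\<close> if \<open>s\<close> holds and \<open>b\<close> otherwise. On \<open>s\<close> the point \<open>a\<close> has the overlap as its density
  and \<open>b\<close> is an unused variable with law \<open>g\<close>; off \<open>s\<close> the two points have the normalized product of the
  residual densities as their joint density. The flag \<open>s\<close> makes a coupling that charges the diagonal absolutely
  continuous. If the overlap has mass \<open>1\<close>, the division by zero is harmless since both residual densities vanish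
  almost everywhere.\<close>

definition coupling_density ::
  "'a measure \<Rightarrow> bool \<Rightarrow> ('a \<Rightarrow> ennreal) \<Rightarrow> ('a \<Rightarrow> ennreal) \<Rightarrow> 'a \<times> 'a \<times> bool \<Rightarrow> ennreal" where
  "coupling_density L e f g = (\<lambda>(a, b, s).
     if s then overlap e f g a * g b
     else (f a - overlap e f g a) * ((g b - overlap e f g b) / (1 - (\<integral>\<^sup>+c. overlap e f g c \<partial>L))))"

definition coupled_snd :: "'a \<times> 'a \<times> bool \<Rightarrow> 'a" where
  "coupled_snd = (\<lambda>(a, b, s). if s then a else b)"

text \<open>The reference measure for \<open>coupling_density\<close>.\<close>

abbreviation coupling_space :: "'a measure \<Rightarrow> ('a \<times> 'a \<times> bool) measure" where
  "coupling_space L \<equiv> L \<Otimes>\<^sub>M (L \<Otimes>\<^sub>M count_space UNIV)"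

lemma overlap_le: "overlap e f g a \<le> f a" "overlap e f g a \<le> g a"
  by (auto simp: overlap_def)

lemma overlap_measurable [measurable]:
  "f \<in> borel_measurable L \<Longrightarrow> g \<in> borel_measurable L \<Longrightarrow> overlap e f g \<in> borel_measurable L"
  unfolding overlap_def[abs_def] by (cases e) simp_all

lemma coupled_snd_measurable [measurable]: "coupled_snd \<in> coupling_space L \<rightarrow>\<^sub>M L"
proof -
  have "(\<lambda>z. if snd (snd z) then fst z else fst (snd z)) \<in> coupling_space L \<rightarrow>\<^sub>M L"
    by measurable
  then show ?thesis by (simp add: coupled_snd_def case_prod_unfold)
qed

context sigma_finite_measure
begin

lemma sigma_finite_coupling_space: "sigma_finite_measure (coupling_space M)"
proof -
  interpret B: sigma_finite_measure "count_space (UNIV :: bool set)"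
    by (rule sigma_finite_measure_count_space)
  interpret MB: pair_sigma_finite M "count_space (UNIV :: bool set)" ..
  interpret pair_sigma_finite M "M \<Otimes>\<^sub>M count_space (UNIV :: bool set)" ..
  show ?thesis ..
qed

lemma nn_integral_coupling_space:
  assumes [measurable]: "G \<in> borel_measurable (coupling_space M)"
  shows "(\<integral>\<^sup>+z. G z \<partial>coupling_space M) = (\<integral>\<^sup>+a. (\<integral>\<^sup>+b. G (a, b, True) + G (a, b, False) \<partial>M) \<partial>M)"
proof -
  interpret B: sigma_finite_measure "count_space (UNIV :: bool set)"
    by (rule sigma_finite_measure_count_space)
  interpret MB: pair_sigma_finite M "count_space (UNIV :: bool set)" ..
  have "(\<integral>\<^sup>+z. G z \<partial>coupling_space M) = (\<integral>\<^sup>+a. (\<integral>\<^sup>+y. G (a, y) \<partial>(M \<Otimes>\<^sub>M count_space (UNIV :: bool set))) \<partial>M)"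
    by (rule MB.P.nn_integral_fst[symmetric]) simp
  also have "\<dots> = (\<integral>\<^sup>+a. (\<integral>\<^sup>+b. (\<integral>\<^sup>+s. G (a, b, s) \<partial>count_space (UNIV :: bool set)) \<partial>M) \<partial>M)"
    by (intro nn_integral_cong B.nn_integral_fst[symmetric]) simp
  also have "\<dots> = (\<integral>\<^sup>+a. (\<integral>\<^sup>+b. G (a, b, True) + G (a, b, False) \<partial>M) \<partial>M)"
    by (simp add: nn_integral_count_space_finite UNIV_bool add.commute)
  finally show ?thesis .
qed

context
  fixes e :: bool and f g :: "'a \<Rightarrow> ennreal"
  assumes f [measurable]: "f \<in> borel_measurable M" and g [measurable]: "g \<in> borel_measurable M"
    and f1: "(\<integral>\<^sup>+a. f a \<partial>M) = 1" and g1: "(\<integral>\<^sup>+a. g a \<partial>M) = 1"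
begin

lemma coupling_density_measurable [measurable]:
  "coupling_density M e f g \<in> borel_measurable (coupling_space M)"
proof -
  have "(\<lambda>z. if snd (snd z) then overlap e f g (fst z) * g (fst (snd z))
     else (f (fst z) - overlap e f g (fst z)) * ((g (fst (snd z)) - overlap e f g (fst (snd z))) / (1 - (\<integral>\<^sup>+c. overlap e f g c \<partial>M))))
    \<in> borel_measurable (coupling_space M)"
    by measurable
  then show ?thesis by (simp add: coupling_density_def case_prod_unfold)
qed

lemma overlap_deficit:
  "(\<integral>\<^sup>+a. f a - overlap e f g a \<partial>M) = 1 - (\<integral>\<^sup>+a. overlap e f g a \<partial>M)"
  "(\<integral>\<^sup>+a. g a - overlap e f g a \<partial>M) = 1 - (\<integral>\<^sup>+a. overlap e f g a \<partial>M)"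
proof -
  have "(\<integral>\<^sup>+a. overlap e f g a \<partial>M) \<le> 1"
    using nn_integral_mono[of M "overlap e f g" f] overlap_le(1)[of e f g] f1 by simp
  then have fin: "(\<integral>\<^sup>+a. overlap e f g a \<partial>M) \<noteq> \<infinity>" by (auto simp: top_unique)
  show "(\<integral>\<^sup>+a. f a - overlap e f g a \<partial>M) = 1 - (\<integral>\<^sup>+a. overlap e f g a \<partial>M)"
    "(\<integral>\<^sup>+a. g a - overlap e f g a \<partial>M) = 1 - (\<integral>\<^sup>+a. overlap e f g a \<partial>M)"
    using fin by (simp_all add: nn_integral_diff overlap_le f1 g1)
qed

text \<open>Cancelling the total residual mass \<open>d\<close> is legitimate even for \<open>d = 0\<close>, where \<open>d / d = 0\<close>.\<close>

lemma nn_integral_normalized_deficit: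
  assumes h: "h \<in> {f, g}" and [measurable]: "F \<in> borel_measurable M"
  defines "d \<equiv> 1 - (\<integral>\<^sup>+c. overlap e f g c \<partial>M)"
  shows "(\<integral>\<^sup>+a. (h a - overlap e f g a) * F a \<partial>M) * (d / d) = (\<integral>\<^sup>+a. (h a - overlap e f g a) * F a \<partial>M)"
proof (cases "d = 0")
  case True
  have [measurable]: "h \<in> borel_measurable M" using h by auto
  have "(\<integral>\<^sup>+a. h a - overlap e f g a \<partial>M) = 0"
    using True overlap_deficit h by (auto simp: d_def)
  then have "AE a in M. h a - overlap e f g a = 0"
    by (subst (asm) nn_integral_0_iff_AE) auto
  then have "(\<integral>\<^sup>+a. (h a - overlap e f g a) * F a \<partial>M) = 0"
    by (subst nn_integral_0_iff_AE) auto
  then show ?thesis by simp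
next
  case False
  have "d \<le> 1" by (simp add: d_def)
  then have "d < \<top>" by (rule le_less_trans) simp
  then show ?thesis using False by (simp add: ennreal_divide_self)
qed

lemma nn_integral_coupling_density_True:
  assumes [measurable]: "F \<in> borel_measurable M"
  shows "(\<integral>\<^sup>+z. coupling_density M e f g z * (if snd (snd z) then F (fst z) else 0) \<partial>coupling_space M) =
    (\<integral>\<^sup>+a. overlap e f g a * F a \<partial>M)"
proof -
  have "(\<integral>\<^sup>+z. coupling_density M e f g z * (if snd (snd z) then F (fst z) else 0) \<partial>coupling_space M) =
    (\<integral>\<^sup>+a. (\<integral>\<^sup>+b. (overlap e f g a * F a) * g b \<partial>M) \<partial>M)"
    by (subst nn_integral_coupling_space) (auto simp: coupling_density_def ac_simps intro!: nn_integral_cong)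
  then show ?thesis by (simp add: nn_integral_cmult g1)
qed

lemma nn_integral_coupling_density_fst:
  assumes [measurable]: "F \<in> borel_measurable M"
  shows "(\<integral>\<^sup>+z. coupling_density M e f g z * F (fst z) \<partial>coupling_space M) = (\<integral>\<^sup>+a. f a * F a \<partial>M)"
proof -
  let ?m = "overlap e f g" and ?d = "1 - (\<integral>\<^sup>+c. overlap e f g c \<partial>M)"
  have "(\<integral>\<^sup>+z. coupling_density M e f g z * F (fst z) \<partial>coupling_space M) =
    (\<integral>\<^sup>+a. (\<integral>\<^sup>+b. (?m a * F a) * g b + ((f a - ?m a) * F a) * ((g b - ?m b) / ?d) \<partial>M) \<partial>M)"
    by (subst nn_integral_coupling_space) (auto simp: coupling_density_def ac_simps intro!: nn_integral_cong)
  also have "\<dots> = (\<integral>\<^sup>+a. ?m a * F a + ((f a - ?m a) * F a) * (?d / ?d) \<partial>M)"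
    by (simp add: nn_integral_add nn_integral_cmult nn_integral_divide g1 overlap_deficit)
  also have "\<dots> = (\<integral>\<^sup>+a. ?m a * F a \<partial>M) + (\<integral>\<^sup>+a. (f a - ?m a) * F a \<partial>M) * (?d / ?d)"
    by (simp add: nn_integral_add nn_integral_multc)
  also have "\<dots> = (\<integral>\<^sup>+a. ?m a * F a \<partial>M) + (\<integral>\<^sup>+a. (f a - ?m a) * F a \<partial>M)"
    by (subst nn_integral_normalized_deficit) auto
  also have "\<dots> = (\<integral>\<^sup>+a. (f a - ?m a + ?m a) * F a \<partial>M)"
    by (simp add: nn_integral_add distrib_right add.commute)
  also have "\<dots> = (\<integral>\<^sup>+a. f a * F a \<partial>M)"
    by (simp add: diff_add_cancel_ennreal overlap_le)
  finally show ?thesis .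
qed

lemma nn_integral_coupling_density_snd:
  assumes [measurable]: "F \<in> borel_measurable M"
  shows "(\<integral>\<^sup>+z. coupling_density M e f g z * F (coupled_snd z) \<partial>coupling_space M) = (\<integral>\<^sup>+a. g a * F a \<partial>M)"
proof -
  let ?m = "overlap e f g" and ?d = "1 - (\<integral>\<^sup>+c. overlap e f g c \<partial>M)"
  let ?R = "\<integral>\<^sup>+b. (g b - ?m b) * F b \<partial>M"
  have "(\<integral>\<^sup>+z. coupling_density M e f g z * F (coupled_snd z) \<partial>coupling_space M) =
    (\<integral>\<^sup>+a. (\<integral>\<^sup>+b. (?m a * F a) * g b + (f a - ?m a) * (((g b - ?m b) * F b) / ?d) \<partial>M) \<partial>M)"
    by (subst nn_integral_coupling_space)
       (auto simp: coupling_density_def coupled_snd_def ac_simps divide_ennreal_def intro!: nn_integral_cong)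
  also have "\<dots> = (\<integral>\<^sup>+a. ?m a * F a + (f a - ?m a) * (?R / ?d) \<partial>M)"
    by (simp add: nn_integral_add nn_integral_cmult nn_integral_divide g1)
  also have "\<dots> = (\<integral>\<^sup>+a. ?m a * F a \<partial>M) + ?d * (?R / ?d)"
    by (simp add: nn_integral_add nn_integral_multc overlap_deficit)
  also have "?d * (?R / ?d) = ?R * (?d / ?d)"
    by (simp add: divide_ennreal_def ac_simps)
  also have "\<dots> = ?R"
    by (subst nn_integral_normalized_deficit) auto
  also have "(\<integral>\<^sup>+a. ?m a * F a \<partial>M) + ?R = (\<integral>\<^sup>+a. (g a - ?m a + ?m a) * F a \<partial>M)"
    by (simp add: nn_integral_add distrib_right add.commute)
  also have "\<dots> = (\<integral>\<^sup>+a. g a * F a \<partial>M)"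
    by (simp add: diff_add_cancel_ennreal overlap_le)
  finally show ?thesis .
qed

end

end

section \<open>A bicausal coupling and its cost\<close>

text \<open>Lebesgue measure on paths of length \<open>t\<close>; its measurable sets are those of \<open>path_space t\<close>.\<close>

abbreviation path_lborel :: "nat \<Rightarrow> (nat \<Rightarrow> real^'d) measure" where
  "path_lborel t \<equiv> \<Pi>\<^sub>M s\<in>{1..t}. lborel"

lemma path_space_sets: "sets (path_lborel t) = sets (path_space t)"
  unfolding path_space_def by (intro sets_PiM_cong) auto

lemma path_norm_measurable [measurable]:
  "path_norm T \<in> borel_measurable (path_lborel T)" "path_norm T \<in> borel_measurable (path_space T)"
  unfolding path_norm_def[abs_def] path_space_def
  by (intro borel_measurable_sum borel_measurable_norm measurable_compose[OF measurable_component_singleton]; auto)+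

lemma path_norm_nonneg [simp]: "0 \<le> path_norm T x"
  by (simp add: path_norm_def sum_nonneg)

lemma is_cond_law_cong_sets:
  assumes "sets S = sets S'" "sets R = sets R'"
  shows "is_cond_law N S X R Y K \<longleftrightarrow> is_cond_law N S' X R' Y K"
  using assms measurable_cong_sets[OF assms(1) refl, of "prob_algebra R'"]
  by (simp add: is_cond_law_def prob_algebra_def cong: subprob_algebra_cong)

lemma chain_is_kernel:
  fixes f :: "nat \<Rightarrow> (nat \<Rightarrow> real^'d) \<Rightarrow> real^'d \<Rightarrow> ennreal"
  assumes "density_chain lborel T f" "t < T"
  shows "is_kernel t (density_kernels.chain lborel f T) (\<lambda>x. density lborel (f t x))"
proof -
  interpret density_chain lborel T f by fact
  show ?thesis
    using is_cond_law_chain[OF assms(2)]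
    unfolding is_kernel_def path_prefix_def[abs_def]
    by (subst is_cond_law_cong_sets[OF path_space_sets[symmetric] sets_lborel[symmetric]])
qed

text \<open>Two processes with conditional densities \<open>f\<close> and \<open>g\<close>, and the coupling of their laws in which the paths stay
  together as long as possible and move independently after their first disagreement.\<close>

locale path_pair =
  F: density_chain lborel T f + G: density_chain lborel T g
  for T :: nat and f g :: "nat \<Rightarrow> (nat \<Rightarrow> real^'d) \<Rightarrow> real^'d \<Rightarrow> ennreal"
begin

text \<open>The coupled step after the pasts \<open>x\<close> and \<open>y\<close>.\<close>

definition coupled_kernel :: "nat \<Rightarrow> (nat \<Rightarrow> real^'d) \<times> (nat \<Rightarrow> real^'d) \<Rightarrow> (real^'d) \<times> (real^'d) \<times> bool \<Rightarrow> ennreal" where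
  "coupled_kernel t = (\<lambda>(x, y). coupling_density lborel (\<forall>s\<in>{1..t}. x s = y s) (f t x) (g t y))"

text \<open>The first path encoded by a sequence of triples; \<open>path2\<close> is the second one.\<close>

definition path1 :: "nat \<Rightarrow> (nat \<Rightarrow> (real^'d) \<times> (real^'d) \<times> bool) \<Rightarrow> nat \<Rightarrow> real^'d" where
  "path1 t z = (\<lambda>s\<in>{1..t}. fst (z s))"

definition path2 :: "nat \<Rightarrow> (nat \<Rightarrow> (real^'d) \<times> (real^'d) \<times> bool) \<Rightarrow> nat \<Rightarrow> real^'d" where
  "path2 t z = (\<lambda>s\<in>{1..t}. coupled_snd (z s))"

abbreviation "L \<equiv> (lborel :: (real^'d) measure)"
abbreviation "L3 \<equiv> coupling_space L"

lemma path1_measurable [measurable]: "path1 t \<in> (\<Pi>\<^sub>M s\<in>{1..t}. L3) \<rightarrow>\<^sub>M (\<Pi>\<^sub>M s\<in>{1..t}. L)"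
  unfolding path1_def[abs_def] by measurable

lemma path2_measurable [measurable]: "path2 t \<in> (\<Pi>\<^sub>M s\<in>{1..t}. L3) \<rightarrow>\<^sub>M (\<Pi>\<^sub>M s\<in>{1..t}. L)"
  unfolding path2_def[abs_def] by measurable

lemma agree_measurable [measurable]:
  fixes t :: nat
  shows
  "Measurable.pred ((\<Pi>\<^sub>M s\<in>{1..t}. L) \<Otimes>\<^sub>M (\<Pi>\<^sub>M s\<in>{1..t}. L)) (\<lambda>p. \<forall>s\<in>{1..t}. fst p s = snd p s)"
proof -
  have "Measurable.pred ((\<Pi>\<^sub>M s\<in>{1..t}. L) \<Otimes>\<^sub>M (\<Pi>\<^sub>M s\<in>{1..t}. L)) (\<lambda>p. fst p s = snd p s)"
    if s: "s \<in> {1..t}" for s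
  proof -
    have [measurable]: "(\<lambda>x. x s) \<in> (\<Pi>\<^sub>M s\<in>{1..t}. L) \<rightarrow>\<^sub>M borel"
      using measurable_component_singleton[OF s, of "\<lambda>_. L"] by simp
    show ?thesis by measurable
  qed
  then show ?thesis by (intro pred_intros_finite) auto
qed

lemma coupled_kernel_measurable:
  assumes t: "t < T"
  shows "(\<lambda>(p, a). coupled_kernel t p a) \<in> borel_measurable (((\<Pi>\<^sub>M s\<in>{1..t}. L) \<Otimes>\<^sub>M (\<Pi>\<^sub>M s\<in>{1..t}. L)) \<Otimes>\<^sub>M L3)"
proof -
  let ?P = "\<Pi>\<^sub>M s\<in>{1..t}. L"
  have [measurable]: "(\<lambda>w. f t (u w) (v w)) \<in> borel_measurable W" if "u \<in> W \<rightarrow>\<^sub>M ?P" "v \<in> W \<rightarrow>\<^sub>M L"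
    for W u v
    using measurable_compose[OF measurable_Pair[OF that] F.kernel_measurable[OF t]] by simp
  have [measurable]: "(\<lambda>w. g t (u w) (v w)) \<in> borel_measurable W" if "u \<in> W \<rightarrow>\<^sub>M ?P" "v \<in> W \<rightarrow>\<^sub>M L"
    for W u v
    using measurable_compose[OF measurable_Pair[OF that] G.kernel_measurable[OF t]] by simp
  have [measurable]: "(\<lambda>w. overlap (\<forall>s\<in>{1..t}. fst (p w) s = snd (p w) s) (f t (fst (p w))) (g t (snd (p w))) (v w)) \<in> borel_measurable W"
    if [measurable]: "p \<in> W \<rightarrow>\<^sub>M ?P \<Otimes>\<^sub>M ?P" "v \<in> W \<rightarrow>\<^sub>M L" for W p v
  proof -
    have [measurable]: "Measurable.pred W (\<lambda>w. \<forall>s\<in>{1..t}. fst (p w) s = snd (p w) s)"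
      using measurable_compose[OF that(1) agree_measurable] by simp
    show ?thesis unfolding overlap_def by measurable
  qed
  have "(\<lambda>w. coupled_kernel t (fst w) (snd w)) \<in> borel_measurable ((?P \<Otimes>\<^sub>M ?P) \<Otimes>\<^sub>M L3)"
    unfolding coupled_kernel_def coupling_density_def case_prod_unfold by measurable
  then show ?thesis by (simp add: case_prod_unfold)
qed

text \<open>The coupled step as a kernel on sequences of triples.\<close>

definition joint_kernel :: "nat \<Rightarrow> (nat \<Rightarrow> (real^'d) \<times> (real^'d) \<times> bool) \<Rightarrow> (real^'d) \<times> (real^'d) \<times> bool \<Rightarrow> ennreal" where
  "joint_kernel t z = coupled_kernel t (path1 t z, path2 t z)"

lemma
  assumes "t < T" "x \<in> space (\<Pi>\<^sub>M s\<in>{1..t}. L)" "y \<in> space (\<Pi>\<^sub>M s\<in>{1..t}. L)"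
  shows f_slice: "f t x \<in> borel_measurable L" "(\<integral>\<^sup>+a. f t x a \<partial>L) = 1"
    and g_slice: "g t y \<in> borel_measurable L" "(\<integral>\<^sup>+a. g t y a \<partial>L) = 1"
  using F.kernel_slice_measurable F.kernel_integral G.kernel_slice_measurable G.kernel_integral assms
  by auto

lemma path_space12:
  assumes "z \<in> space (\<Pi>\<^sub>M s\<in>{1..t}. L3)"
  shows "path1 t z \<in> space (\<Pi>\<^sub>M s\<in>{1..t}. L)" "path2 t z \<in> space (\<Pi>\<^sub>M s\<in>{1..t}. L)"
  using measurable_space[OF path1_measurable assms] measurable_space[OF path2_measurable assms] .

lemma nn_integral_coupled_kernel:
  assumes t: "t < T" and x: "x \<in> space (\<Pi>\<^sub>M s\<in>{1..t}. L)" and y: "y \<in> space (\<Pi>\<^sub>M s\<in>{1..t}. L)"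
    and H: "H \<in> borel_measurable L"
  shows "(\<integral>\<^sup>+a. coupled_kernel t (x, y) a * H (fst a) \<partial>L3) = (\<integral>\<^sup>+a. f t x a * H a \<partial>L)"
    and "(\<integral>\<^sup>+a. coupled_kernel t (x, y) a * H (coupled_snd a) \<partial>L3) = (\<integral>\<^sup>+a. g t y a * H a \<partial>L)"
    and "coupled_kernel t (x, y) \<in> borel_measurable L3"
  using F.nn_integral_coupling_density_fst F.nn_integral_coupling_density_snd F.coupling_density_measurable
    f_slice[OF t x y] g_slice[OF t x y] H
  by (auto simp: coupled_kernel_def)

lemma distr_coupled_kernel:
  assumes t: "t < T" and x: "x \<in> space (\<Pi>\<^sub>M s\<in>{1..t}. L)" and y: "y \<in> space (\<Pi>\<^sub>M s\<in>{1..t}. L)"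
  shows "distr (density L3 (coupled_kernel t (x, y))) L fst = density L (f t x)"
    and "distr (density L3 (coupled_kernel t (x, y))) L coupled_snd = density L (g t y)"
proof -
  note [measurable] = nn_integral_coupled_kernel(3)[OF t x y measurable_const[of 0]] f_slice(1)[OF t x y] g_slice(1)[OF t x y]
  show "distr (density L3 (coupled_kernel t (x, y))) L fst = density L (f t x)"
  proof (rule measure_eqI)
    fix A assume "A \<in> sets (distr (density L3 (coupled_kernel t (x, y))) L fst)"
    then have A [measurable]: "A \<in> sets L" by simp
    have "emeasure (distr (density L3 (coupled_kernel t (x, y))) L fst) A =
      (\<integral>\<^sup>+a. indicator A a \<partial>distr (density L3 (coupled_kernel t (x, y))) L fst)"
      using A by simp
    also have "\<dots> = (\<integral>\<^sup>+a. coupled_kernel t (x, y) a * indicator A (fst a) \<partial>L3)"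
      by (simp add: nn_integral_distr nn_integral_density)
    also have "\<dots> = emeasure (density L (f t x)) A"
      by (subst nn_integral_coupled_kernel(1)[OF t x y]) (use A in \<open>simp_all add: emeasure_density\<close>)
    finally show "emeasure (distr (density L3 (coupled_kernel t (x, y))) L fst) A = emeasure (density L (f t x)) A" .
  qed simp
  show "distr (density L3 (coupled_kernel t (x, y))) L coupled_snd = density L (g t y)"
  proof (rule measure_eqI)
    fix A assume "A \<in> sets (distr (density L3 (coupled_kernel t (x, y))) L coupled_snd)"
    then have A [measurable]: "A \<in> sets L" by simp
    have "emeasure (distr (density L3 (coupled_kernel t (x, y))) L coupled_snd) A =
      (\<integral>\<^sup>+a. indicator A a \<partial>distr (density L3 (coupled_kernel t (x, y))) L coupled_snd)"
      using A by simp
    also have "\<dots> = (\<integral>\<^sup>+a. coupled_kernel t (x, y) a * indicator A (coupled_snd a) \<partial>L3)"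
      by (simp add: nn_integral_distr nn_integral_density)
    also have "\<dots> = emeasure (density L (g t y)) A"
      by (subst nn_integral_coupled_kernel(2)[OF t x y]) (use A in \<open>simp_all add: emeasure_density\<close>)
    finally show "emeasure (distr (density L3 (coupled_kernel t (x, y))) L coupled_snd) A = emeasure (density L (g t y)) A" .
  qed simp
qed

sublocale J: density_chain L3 T joint_kernel
proof -
  interpret L3: sigma_finite_measure L3 by (rule F.sigma_finite_coupling_space)
  show "density_chain L3 T joint_kernel"
  proof
    fix t assume t: "t < T"
    have "(\<lambda>w. ((path1 t (fst w), path2 t (fst w)), snd w)) \<in>
      (\<Pi>\<^sub>M s\<in>{1..t}. L3) \<Otimes>\<^sub>M L3 \<rightarrow>\<^sub>M ((\<Pi>\<^sub>M s\<in>{1..t}. L) \<Otimes>\<^sub>M (\<Pi>\<^sub>M s\<in>{1..t}. L)) \<Otimes>\<^sub>M L3"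
      by measurable
    from measurable_compose[OF this coupled_kernel_measurable[OF t]]
    show "(\<lambda>(z, a). joint_kernel t z a) \<in> borel_measurable ((\<Pi>\<^sub>M s\<in>{1..t}. L3) \<Otimes>\<^sub>M L3)"
      by (simp add: joint_kernel_def case_prod_unfold)
  next
    fix t z assume t: "t < T" and z: "z \<in> space (\<Pi>\<^sub>M s\<in>{1..t}. L3)"
    show "(\<integral>\<^sup>+a. joint_kernel t z a \<partial>L3) = 1"
      using nn_integral_coupled_kernel(1)[OF t path_space12[OF z], of "\<lambda>_. 1"] f_slice(2)[OF t path_space12[OF z]]
      by (simp add: joint_kernel_def)
  qed
qed

text \<open>The pair of coupled paths. Its law under the chain of triples is the coupling.\<close>

definition both :: "(nat \<Rightarrow> (real^'d) \<times> (real^'d) \<times> bool) \<Rightarrow> (nat \<Rightarrow> real^'d) \<times> (nat \<Rightarrow> real^'d)" where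
  "both z = (path1 T z, path2 T z)"

definition coupling :: "((nat \<Rightarrow> real^'d) \<times> (nat \<Rightarrow> real^'d)) measure" where
  "coupling = distr (J.chain T) (F.chain T \<Otimes>\<^sub>M G.chain T) both"

lemma both_measurable [measurable]: "both \<in> J.chain T \<rightarrow>\<^sub>M F.chain T \<Otimes>\<^sub>M G.chain T"
  unfolding both_def[abs_def] by measurable

lemma distr_path1: "distr (J.chain T) (F.chain T) (path1 T) = F.chain T"
proof -
  have "distr (J.chain T) (\<Pi>\<^sub>M s\<in>{1..T}. L) (path1 T) = F.chain T"
    unfolding path1_def[abs_def]
    by (rule distr_chain[OF J.density_kernels_axioms F.density_kernels_axioms])
      (auto simp: joint_kernel_def distr_coupled_kernel path_space12 path1_def[symmetric] simp del: One_nat_def)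
  then show ?thesis by (simp cong: distr_cong)
qed

lemma distr_path2: "distr (J.chain T) (G.chain T) (path2 T) = G.chain T"
proof -
  have "distr (J.chain T) (\<Pi>\<^sub>M s\<in>{1..T}. L) (path2 T) = G.chain T"
    unfolding path2_def[abs_def]
    by (rule distr_chain[OF J.density_kernels_axioms G.density_kernels_axioms])
      (auto simp: joint_kernel_def distr_coupled_kernel path_space12 path2_def[symmetric] simp del: One_nat_def)
  then show ?thesis by (simp cong: distr_cong)
qed

lemma coupling_in_Cpl: "coupling \<in> Cpl (F.chain T) (G.chain T)"
proof -
  interpret J: prob_space "J.chain T" by (rule J.prob_space_chain) simp
  have "prob_space coupling"
    unfolding coupling_def by (rule J.prob_space_distr) measurable
  moreover have "distr coupling (F.chain T) fst = F.chain T" "distr coupling (G.chain T) snd = G.chain T"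
    unfolding coupling_def
    by (subst distr_distr; simp add: comp_def both_def distr_path1 distr_path2)+
  ultimately show ?thesis
    by (simp add: Cpl_def space_prob_algebra coupling_def)
qed

text \<open>The conditional law of the next pair of points under the coupling.\<close>

definition pair_kernel :: "nat \<Rightarrow> (nat \<Rightarrow> real^'d) \<times> (nat \<Rightarrow> real^'d) \<Rightarrow> ((real^'d) \<times> (real^'d)) measure" where
  "pair_kernel t p = distr (density L3 (coupled_kernel t p)) (borel \<Otimes>\<^sub>M borel) (\<lambda>a. (fst a, coupled_snd a))"

lemma density_coupled_kernel_prob_algebra:
  assumes t: "t < T"
  shows "(\<lambda>p. density L3 (coupled_kernel t p)) \<in> (\<Pi>\<^sub>M s\<in>{1..t}. L) \<Otimes>\<^sub>M (\<Pi>\<^sub>M s\<in>{1..t}. L) \<rightarrow>\<^sub>M prob_algebra L3"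
proof (rule J.density_prob_algebra[OF coupled_kernel_measurable[OF t]])
  fix p assume p: "p \<in> space ((\<Pi>\<^sub>M s\<in>{1..t}. L) \<Otimes>\<^sub>M (\<Pi>\<^sub>M s\<in>{1..t}. L))"
  obtain x y where xy: "p = (x, y)" by (cases p)
  then have *: "x \<in> space (\<Pi>\<^sub>M s\<in>{1..t}. L)" "y \<in> space (\<Pi>\<^sub>M s\<in>{1..t}. L)"
    using p by (auto simp: space_pair_measure)
  show "(\<integral>\<^sup>+a. coupled_kernel t p a \<partial>L3) = 1"
    using nn_integral_coupled_kernel(1)[OF t *, of "\<lambda>_. 1"] f_slice(2)[OF t *] xy by simp
qed

lemma pair_kernel_prob_algebra:
  assumes t: "t < T"
  shows "pair_kernel t \<in> (\<Pi>\<^sub>M s\<in>{1..t}. L) \<Otimes>\<^sub>M (\<Pi>\<^sub>M s\<in>{1..t}. L) \<rightarrow>\<^sub>M prob_algebra (borel \<Otimes>\<^sub>M borel)"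
proof -
  have "(\<lambda>a. (fst a, coupled_snd a)) \<in> L3 \<rightarrow>\<^sub>M borel \<Otimes>\<^sub>M borel"
    using coupled_snd_measurable[of L] by measurable
  from measurable_compose[OF density_coupled_kernel_prob_algebra[OF t] measurable_distr_prob_space[OF this]]
  show ?thesis by (simp add: pair_kernel_def[abs_def])
qed

lemma pair_kernel_in_Cpl:
  assumes t: "t < T" and x: "x \<in> space (\<Pi>\<^sub>M s\<in>{1..t}. L)" and y: "y \<in> space (\<Pi>\<^sub>M s\<in>{1..t}. L)"
  shows "pair_kernel t (x, y) \<in> Cpl (density L (f t x)) (density L (g t y))"
proof -
  have "(x, y) \<in> space ((\<Pi>\<^sub>M s\<in>{1..t}. L) \<Otimes>\<^sub>M (\<Pi>\<^sub>M s\<in>{1..t}. L))"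
    using x y by (simp add: space_pair_measure)
  from measurable_space[OF pair_kernel_prob_algebra[OF t] this]
  have p: "prob_space (pair_kernel t (x, y))" and s: "sets (pair_kernel t (x, y)) = sets (borel \<Otimes>\<^sub>M borel)"
    by (simp_all add: space_prob_algebra)
  have s': "sets (density L (f t x) \<Otimes>\<^sub>M density L (g t y)) = sets (borel \<Otimes>\<^sub>M borel)"
    by (intro sets_pair_measure_cong) auto
  have [measurable]: "(\<lambda>a. (fst a, coupled_snd a)) \<in> density L3 (coupled_kernel t (x, y)) \<rightarrow>\<^sub>M borel \<Otimes>\<^sub>M borel"
    using coupled_snd_measurable[of L] by measurable
  have "distr (pair_kernel t (x, y)) (density L (f t x)) fst = distr (density L3 (coupled_kernel t (x, y))) L fst"
    unfolding pair_kernel_def by (subst distr_distr) (auto simp: comp_def cong: distr_cong)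
  moreover have "distr (pair_kernel t (x, y)) (density L (g t y)) snd = distr (density L3 (coupled_kernel t (x, y))) L coupled_snd"
    unfolding pair_kernel_def by (subst distr_distr) (auto simp: comp_def cong: distr_cong)
  ultimately show ?thesis
    using p s s' distr_coupled_kernel[OF t x y] by (simp add: Cpl_def space_prob_algebra)
qed

lemma coupling_is_pair_kernel:
  assumes t: "t < T"
  shows "is_pair_kernel t coupling (pair_kernel t)"
proof -
  let ?S = "(\<Pi>\<^sub>M s\<in>{1..t}. L) \<Otimes>\<^sub>M (\<Pi>\<^sub>M s\<in>{1..t}. L)"
  have pre [measurable]: "path_prefix t \<in> (\<Pi>\<^sub>M s\<in>{1..T}. L) \<rightarrow>\<^sub>M (\<Pi>\<^sub>M s\<in>{1..t}. L)"
    unfolding path_prefix_def[abs_def] using t by (intro measurable_restrict_subset) auto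
  have comp [measurable]: "(\<lambda>x. x (Suc t)) \<in> (\<Pi>\<^sub>M s\<in>{1..T}. L) \<rightarrow>\<^sub>M borel"
    using t measurable_component_singleton[of "Suc t" "{1..T}" "\<lambda>_. L"] by simp
  have "is_cond_law (distr (J.chain T) (F.chain T \<Otimes>\<^sub>M G.chain T) both)
       ?S (\<lambda>(x, y). (path_prefix t x, path_prefix t y))
       (borel \<Otimes>\<^sub>M borel) (\<lambda>(x, y). (x (Suc t), y (Suc t))) (pair_kernel t)"
  proof (rule is_cond_law_distr[OF J.is_cond_law_chain[OF t]])
    show "(\<lambda>z. restrict z {1..t}) \<in> J.chain T \<rightarrow>\<^sub>M (\<Pi>\<^sub>M s\<in>{1..t}. L3)"
      using t measurable_restrict_subset[of "{1..t}" "{1..T}" "\<lambda>_. L3"] by (simp cong: measurable_cong_sets)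
    show "(\<lambda>z. z (Suc t)) \<in> J.chain T \<rightarrow>\<^sub>M L3"
      using t measurable_component_singleton[of "Suc t" "{1..T}" "\<lambda>_. L3"] by (simp cong: measurable_cong_sets)
    show "(\<lambda>(x, y). (path_prefix t x, path_prefix t y)) \<in> F.chain T \<Otimes>\<^sub>M G.chain T \<rightarrow>\<^sub>M ?S"
      by measurable
    show "(\<lambda>(x, y). (x (Suc t), y (Suc t))) \<in> F.chain T \<Otimes>\<^sub>M G.chain T \<rightarrow>\<^sub>M borel \<Otimes>\<^sub>M borel"
      by measurable
    show "(\<lambda>z. (path1 t z, path2 t z)) \<in> (\<Pi>\<^sub>M s\<in>{1..t}. L3) \<rightarrow>\<^sub>M ?S"
      by measurable
    show "(\<lambda>a. (fst a, coupled_snd a)) \<in> L3 \<rightarrow>\<^sub>M borel \<Otimes>\<^sub>M borel"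
      using coupled_snd_measurable[of L] by measurable
    show "pair_kernel t \<in> ?S \<rightarrow>\<^sub>M prob_algebra (borel \<Otimes>\<^sub>M borel)"
      by (rule pair_kernel_prob_algebra[OF t])
    fix z
    show "(case both z of (x, y) \<Rightarrow> (path_prefix t x, path_prefix t y)) = (path1 t (restrict z {1..t}), path2 t (restrict z {1..t}))"
      using t by (auto simp: both_def path1_def path2_def path_prefix_def restrict_def fun_eq_iff)
    show "(case both z of (x, y) \<Rightarrow> (x (Suc t), y (Suc t))) = (fst (z (Suc t)), coupled_snd (z (Suc t)))"
      using t by (auto simp: both_def path1_def path2_def)
    show "pair_kernel t (path1 t z, path2 t z) = distr (density L3 (joint_kernel t z)) (borel \<Otimes>\<^sub>M borel) (\<lambda>a. (fst a, coupled_snd a))"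
      by (simp add: pair_kernel_def joint_kernel_def)
  qed measurable
  then show ?thesis
    unfolding is_pair_kernel_def coupling_def
    by (subst is_cond_law_cong_sets[OF _ refl, of _ ?S]) (auto intro!: sets_pair_measure_cong simp: path_space_sets simp del: One_nat_def)
qed

lemma coupling_bicausal: "coupling \<in> Cpl_bc T (F.chain T) (G.chain T)"
  unfolding Cpl_bc_def
proof (intro CollectI conjI ballI)
  show "coupling \<in> Cpl (F.chain T) (G.chain T)" by (rule coupling_in_Cpl)
next
  fix t assume "t \<in> {1..<T}"
  then have t: "t < T" by simp
  have pre: "path_prefix t x \<in> space (\<Pi>\<^sub>M s\<in>{1..t}. L)" if "x \<in> space (\<Pi>\<^sub>M s\<in>{1..T}. L)" for x
    using that t by (auto simp: path_prefix_def space_PiM)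
  have "AE (x, y) in coupling. pair_kernel t (path_prefix t x, path_prefix t y)
      \<in> Cpl (density L (f t (path_prefix t x))) (density L (g t (path_prefix t y)))"
    by (rule AE_I2) (auto simp: coupling_def space_pair_measure intro!: pair_kernel_in_Cpl t pre)
  then show "\<exists>K\<mu> K\<nu> K\<pi>. is_kernel t (F.chain T) K\<mu> \<and> is_kernel t (G.chain T) K\<nu> \<and> is_pair_kernel t coupling K\<pi> \<and>
       (AE (x, y) in coupling. K\<pi> (path_prefix t x, path_prefix t y) \<in> Cpl (K\<mu> (path_prefix t x)) (K\<nu> (path_prefix t y)))"
    using chain_is_kernel[OF F.density_chain_axioms t] chain_is_kernel[OF G.density_chain_axioms t]
      coupling_is_pair_kernel[OF t] by blast
qed


sublocale O: density_kernels L T "\<lambda>t x. overlap True (f t x) (g t x)"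
proof
  fix t assume t: "t < T"
  show "(\<lambda>(x, a). overlap True (f t x) (g t x) a) \<in> borel_measurable ((\<Pi>\<^sub>M s\<in>{1..t}. L) \<Otimes>\<^sub>M L)"
    using borel_measurable_min[OF F.kernel_measurable[OF t] G.kernel_measurable[OF t]]
    by (simp only: overlap_def case_prod_unfold if_True min.commute)
qed

text \<open>The flags record that the two paths have stayed together up to time \<open>t\<close>.\<close>

definition merged :: "nat \<Rightarrow> (nat \<Rightarrow> (real^'d) \<times> (real^'d) \<times> bool) \<Rightarrow> bool" where
  "merged t z \<longleftrightarrow> (\<forall>s\<in>{1..t}. snd (snd (z s)))"

lemma merged_measurable [measurable]: "Measurable.pred (\<Pi>\<^sub>M s\<in>{1..t}. L3) (merged t)"
proof -
  have "Measurable.pred (\<Pi>\<^sub>M s\<in>{1..t}. L3) (\<lambda>z. snd (snd (z s)))" if s: "s \<in> {1..t}" for s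
  proof -
    have [measurable]: "(\<lambda>z. z s) \<in> (\<Pi>\<^sub>M s\<in>{1..t}. L3) \<rightarrow>\<^sub>M L3"
      using s by (rule measurable_component_singleton)
    show ?thesis by measurable
  qed
  then show ?thesis unfolding merged_def[abs_def] by (intro pred_intros_finite) auto
qed

lemma merged_path2: "merged t z \<Longrightarrow> path2 t z = path1 t z"
  by (auto simp: merged_def path1_def path2_def coupled_snd_def case_prod_unfold fun_eq_iff restrict_def)

text \<open>On the event that the paths have stayed together, their common law has the product of the overlaps of the
  conditional densities as its density.\<close>

lemma nn_integral_merged:
  assumes "t \<le> T" "H \<in> borel_measurable (\<Pi>\<^sub>M s\<in>{1..t}. L)"
  shows "(\<integral>\<^sup>+z. (if merged t z then H (path1 t z) else 0) \<partial>J.chain t) = (\<integral>\<^sup>+x. H x \<partial>O.chain t)"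
  using assms
proof (induction t arbitrary: H)
  case 0
  note [measurable] = 0(2)
  have "(\<integral>\<^sup>+z. (if merged 0 z then H (path1 0 z) else 0) \<partial>J.chain 0) =
      (if merged 0 (\<lambda>_. undefined) then H (path1 0 (\<lambda>_. undefined)) else 0)"
    by (rule J.nn_integral_chain_0) measurable
  also have "\<dots> = H (\<lambda>_. undefined)"
    by (simp add: merged_def path1_def restrict_def)
  also have "\<dots> = (\<integral>\<^sup>+x. H x \<partial>O.chain 0)"
    by (rule O.nn_integral_chain_0[symmetric]) (rule 0(2))
  finally show ?case .
next
  case (Suc t)
  then have t: "t < T" by simp
  note H [measurable] = Suc.prems(2)
  have ins: "{1..Suc t} = insert (Suc t) {1..t}" by auto
  have upd: "(\<lambda>(x, a). x(Suc t := a)) \<in> (\<Pi>\<^sub>M s\<in>{1..t}. L) \<Otimes>\<^sub>M L \<rightarrow>\<^sub>M (\<Pi>\<^sub>M s\<in>{1..Suc t}. L)"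
    unfolding ins by (rule measurable_add_dim)
  have H': "(\<lambda>(x, a). H (x(Suc t := a))) \<in> borel_measurable ((\<Pi>\<^sub>M s\<in>{1..t}. L) \<Otimes>\<^sub>M L)"
    using measurable_compose[OF upd H] by (simp only: case_prod_unfold)
  define Q where "Q = (\<lambda>x. \<integral>\<^sup>+a. overlap True (f t x) (g t x) a * H (x(Suc t := a)) \<partial>L)"
  have "(\<lambda>p. overlap True (f t (fst p)) (g t (fst p)) (snd p) * H ((fst p)(Suc t := snd p))) \<in>
      borel_measurable ((\<Pi>\<^sub>M s\<in>{1..t}. L) \<Otimes>\<^sub>M L)"
    using O.kernel_measurable[OF t] H' unfolding case_prod_unfold by (rule borel_measurable_times_ennreal)
  from F.borel_measurable_nn_integral_fst[OF this]
  have Q: "Q \<in> borel_measurable (\<Pi>\<^sub>M s\<in>{1..t}. L)"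
    by (simp add: Q_def)
  have "(\<integral>\<^sup>+z. (if merged (Suc t) z then H (path1 (Suc t) z) else 0) \<partial>J.chain (Suc t)) =
    (\<integral>\<^sup>+z. (\<integral>\<^sup>+a. joint_kernel t z a * (if merged (Suc t) (z(Suc t := a)) then H (path1 (Suc t) (z(Suc t := a))) else 0) \<partial>L3) \<partial>J.chain t)"
    by (rule J.nn_integral_chain_Suc[OF t]) measurable
  also have "\<dots> = (\<integral>\<^sup>+z. (if merged t z then Q (path1 t z) else 0) \<partial>J.chain t)"
  proof (rule nn_integral_cong)
    fix z assume "z \<in> space (J.chain t)"
    then have z: "z \<in> space (\<Pi>\<^sub>M s\<in>{1..t}. L3)" by (simp only: J.space_chain)
    let ?x = "path1 t z"
    note x = path_space12(1)[OF z]
    have merged_Suc: "merged (Suc t) (z(Suc t := a)) \<longleftrightarrow> merged t z \<and> snd (snd a)" for a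
      unfolding merged_def ins by auto
    have path1_Suc: "path1 (Suc t) (z(Suc t := a)) = ?x(Suc t := fst a)" for a
      by (auto simp: path1_def restrict_def fun_eq_iff)
    show "(\<integral>\<^sup>+a. joint_kernel t z a * (if merged (Suc t) (z(Suc t := a)) then H (path1 (Suc t) (z(Suc t := a))) else 0) \<partial>L3)
      = (if merged t z then Q ?x else 0)"
    proof (cases "merged t z")
      case True
      have Hx: "(\<lambda>a. H (?x(Suc t := a))) \<in> borel_measurable L"
        using measurable_compose[OF measurable_Pair1'[OF x] H'] by simp
      have "joint_kernel t z = coupling_density L True (f t ?x) (g t ?x)"
        by (simp add: joint_kernel_def coupled_kernel_def merged_path2[OF True])
      then have "(\<integral>\<^sup>+a. joint_kernel t z a * (if merged (Suc t) (z(Suc t := a)) then H (path1 (Suc t) (z(Suc t := a))) else 0) \<partial>L3)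
        = (\<integral>\<^sup>+a. coupling_density L True (f t ?x) (g t ?x) a * (if snd (snd a) then H (?x(Suc t := fst a)) else 0) \<partial>L3)"
        by (simp only: merged_Suc path1_Suc True simp_thms)
      also have "\<dots> = Q ?x"
        unfolding Q_def
        by (rule F.nn_integral_coupling_density_True[OF f_slice(1)[OF t x x] g_slice(1)[OF t x x] f_slice(2)[OF t x x] g_slice(2)[OF t x x] Hx])
      finally show ?thesis using True by simp
    qed (simp add: merged_Suc)
  qed
  also have "\<dots> = (\<integral>\<^sup>+x. Q x \<partial>O.chain t)"
    using t by (intro Suc.IH Q) simp
  also have "\<dots> = (\<integral>\<^sup>+x. H x \<partial>O.chain (Suc t))"
    unfolding Q_def by (rule O.nn_integral_chain_Suc[OF t H, symmetric])
  finally show ?case .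
qed

text \<open>The transport cost vanishes where the paths have stayed together and is at most the sum of the two path norms
  elsewhere. Twice the path norm on the merged event is added to the left-hand side, which avoids subtraction in
  \<open>ennreal\<close>.\<close>

lemma AW1_le_overlap:
  "AW1 T (F.chain T) (G.chain T) + 2 * (\<integral>\<^sup>+x. path_norm T x \<partial>O.chain T)
    \<le> (\<integral>\<^sup>+x. path_norm T x \<partial>F.chain T) + (\<integral>\<^sup>+x. path_norm T x \<partial>G.chain T)"
proof -
  have [measurable]: "(\<lambda>w. path_diff T (u w) (v w)) \<in> W \<rightarrow>\<^sub>M (\<Pi>\<^sub>M s\<in>{1..T}. L)"
    if "u \<in> W \<rightarrow>\<^sub>M (\<Pi>\<^sub>M s\<in>{1..T}. L)" "v \<in> W \<rightarrow>\<^sub>M (\<Pi>\<^sub>M s\<in>{1..T}. L)" for W :: "'z measure" and u v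
  proof -
    have "(\<lambda>w. u w s - v w s) \<in> W \<rightarrow>\<^sub>M L" if s: "s \<in> {1..T}" for s
      using measurable_compose[OF \<open>u \<in> _\<close> measurable_component_singleton[OF s]]
        measurable_compose[OF \<open>v \<in> _\<close> measurable_component_singleton[OF s]]
      by simp
    then show ?thesis unfolding path_diff_def by (rule measurable_restrict)
  qed
  have "AW1 T (F.chain T) (G.chain T) \<le> (\<integral>\<^sup>+(x, y). ennreal (path_norm T (path_diff T x y)) \<partial>coupling)"
    unfolding AW1_def by (rule INF_lower[OF coupling_bicausal])
  also have "\<dots> = (\<integral>\<^sup>+z. ennreal (path_norm T (path_diff T (path1 T z) (path2 T z))) \<partial>J.chain T)"
    unfolding coupling_def case_prod_unfold by (subst nn_integral_distr) (simp_all add: both_def)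
  finally have AW1_le: "AW1 T (F.chain T) (G.chain T) \<le> \<dots>" .
  have "(\<lambda>x. ennreal (path_norm T x)) \<in> borel_measurable (\<Pi>\<^sub>M s\<in>{1..T}. L)" by measurable
  note merged_eq = nn_integral_merged[OF order_refl this]
  have "AW1 T (F.chain T) (G.chain T) + 2 * (\<integral>\<^sup>+x. path_norm T x \<partial>O.chain T) \<le>
    (\<integral>\<^sup>+z. ennreal (path_norm T (path_diff T (path1 T z) (path2 T z))) \<partial>J.chain T) +
    2 * (\<integral>\<^sup>+z. (if merged T z then ennreal (path_norm T (path1 T z)) else 0) \<partial>J.chain T)"
    unfolding merged_eq using AW1_le by (rule add_right_mono)
  also have "\<dots> = (\<integral>\<^sup>+z. ennreal (path_norm T (path_diff T (path1 T z) (path2 T z))) +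
      2 * (if merged T z then ennreal (path_norm T (path1 T z)) else 0) \<partial>J.chain T)"
    by (simp add: nn_integral_add nn_integral_cmult)
  also have "\<dots> \<le> (\<integral>\<^sup>+z. ennreal (path_norm T (path1 T z)) + ennreal (path_norm T (path2 T z)) \<partial>J.chain T)"
  proof (rule nn_integral_mono)
    fix z
    show "ennreal (path_norm T (path_diff T (path1 T z) (path2 T z))) +
      2 * (if merged T z then ennreal (path_norm T (path1 T z)) else 0)
      \<le> ennreal (path_norm T (path1 T z)) + ennreal (path_norm T (path2 T z))"
    proof (cases "merged T z")
      case True
      then show ?thesis
        by (simp add: merged_path2 path_diff_def path_norm_def mult_2)
    next
      case False
      have "path_norm T (path_diff T x y) \<le> path_norm T x + path_norm T y" for x y :: "nat \<Rightarrow> real^'d"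
        by (auto simp: path_norm_def path_diff_def sum.distrib[symmetric] intro!: sum_mono norm_triangle_ineq4)
      then show ?thesis using False by (simp add: ennreal_plus[symmetric] del: ennreal_plus)
    qed
  qed
  also have "\<dots> = (\<integral>\<^sup>+z. path_norm T (path1 T z) \<partial>J.chain T) + (\<integral>\<^sup>+z. path_norm T (path2 T z) \<partial>J.chain T)"
    by (rule nn_integral_add) measurable
  also have "(\<integral>\<^sup>+z. path_norm T (path1 T z) \<partial>J.chain T) = (\<integral>\<^sup>+x. path_norm T x \<partial>distr (J.chain T) (F.chain T) (path1 T))"
    by (rule nn_integral_distr[symmetric]) measurable
  also have "(\<integral>\<^sup>+z. path_norm T (path2 T z) \<partial>J.chain T) = (\<integral>\<^sup>+x. path_norm T x \<partial>distr (J.chain T) (G.chain T) (path2 T))"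
    by (rule nn_integral_distr[symmetric]) measurable
  finally show ?thesis unfolding distr_path1 distr_path2 .
qed

end

section \<open>Gaussian smoothing\<close>

text \<open>The density of \<open>N(0, \<sigma>\<^sup>2 I)\<close> on a single \<open>\<real>\<^sup>d\<close>.\<close>

definition gauss :: "real \<Rightarrow> real^'d \<Rightarrow> real" where
  "gauss \<sigma> v = (\<Prod>i\<in>UNIV. normal_density 0 \<sigma> (v $ i))"

lemma borel_measurable_vec_nth [measurable]: "(\<lambda>v :: real^'d. v $ i) \<in> borel_measurable borel"
  by (intro borel_measurable_continuous_onI continuous_intros)

lemma gauss_measurable [measurable]: "gauss \<sigma> \<in> borel_measurable borel"
  unfolding gauss_def[abs_def] by measurable

lemma gauss_nonneg [simp]: "0 \<le> gauss \<sigma> v"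
  by (simp add: gauss_def prod_nonneg)

lemma gauss_pos: "0 < \<sigma> \<Longrightarrow> 0 < gauss \<sigma> v"
  by (simp add: gauss_def prod_pos normal_density_pos)

lemma gauss_bound: "gauss \<sigma> (v :: real^'d) \<le> (1 / sqrt (2 * pi * \<sigma>\<^sup>2)) ^ CARD('d)"
proof -
  have "normal_density 0 \<sigma> r \<le> 1 / sqrt (2 * pi * \<sigma>\<^sup>2)" for r
  proof -
    have "normal_density 0 \<sigma> r \<le> 1 / sqrt (2 * pi * \<sigma>\<^sup>2) * 1"
      unfolding normal_density_def by (intro mult_left_mono) auto
    then show ?thesis by simp
  qed
  then have "gauss \<sigma> v \<le> (\<Prod>i\<in>(UNIV :: 'd set). 1 / sqrt (2 * pi * \<sigma>\<^sup>2))"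
    unfolding gauss_def by (intro prod_mono) simp
  then show ?thesis by simp
qed

lemma nn_integral_lborel_prod_vec:
  fixes h :: "'d::finite \<Rightarrow> real \<Rightarrow> ennreal"
  assumes [measurable]: "\<And>i. h i \<in> borel_measurable borel"
  shows "(\<integral>\<^sup>+v. (\<Prod>i\<in>UNIV. h i (v $ i)) \<partial>(lborel :: (real^'d) measure)) = (\<Prod>i\<in>UNIV. \<integral>\<^sup>+r. h i r \<partial>lborel)"
proof -
  let ?ax = "\<lambda>i::'d. axis i (1::real)"
  have inj: "inj ?ax" by (auto simp: inj_def axis_eq_axis)
  have B: "Basis = range ?ax" by (auto simp: Basis_vec_def)
  have idx: "axis_index (?ax i) = i" for i
    using axis_inverse[of "?ax i"] by (auto simp: axis_eq_axis)
  have "(\<integral>\<^sup>+v. (\<Prod>i\<in>UNIV. h i (v $ i)) \<partial>(lborel :: (real^'d) measure)) =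
      (\<integral>\<^sup>+v. (\<Prod>b\<in>Basis. h (axis_index b) (v \<bullet> b)) \<partial>(lborel :: (real^'d) measure))"
    unfolding B by (simp add: prod.reindex[OF inj] idx cart_eq_inner_axis)
  also have "\<dots> = (\<Prod>b\<in>(Basis :: (real^'d) set). \<integral>\<^sup>+r. h (axis_index b) r \<partial>lborel)"
    by (rule nn_integral_lborel_prod) auto
  also have "\<dots> = (\<Prod>i\<in>UNIV. \<integral>\<^sup>+r. h i r \<partial>lborel)"
    unfolding B by (simp add: prod.reindex[OF inj] idx)
  finally show ?thesis .
qed

lemma nn_integral_normal_density:
  assumes "0 < \<sigma>"
  shows "(\<integral>\<^sup>+r. ennreal (normal_density 0 \<sigma> r) \<partial>lborel) = 1"
  using assms by (subst nn_integral_eq_integral) auto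

lemma nn_integral_gauss:
  assumes "0 < \<sigma>"
  shows "(\<integral>\<^sup>+v. ennreal (gauss \<sigma> (v :: real^'d)) \<partial>lborel) = 1"
proof -
  have "(\<integral>\<^sup>+v. ennreal (gauss \<sigma> (v :: real^'d)) \<partial>lborel) = (\<integral>\<^sup>+v. (\<Prod>i\<in>UNIV. ennreal (normal_density 0 \<sigma> ((v :: real^'d) $ i))) \<partial>lborel)"
    by (simp add: gauss_def prod_ennreal)
  also have "\<dots> = (\<Prod>i\<in>(UNIV :: 'd set). \<integral>\<^sup>+r. ennreal (normal_density 0 \<sigma> r) \<partial>lborel)"
    by (rule nn_integral_lborel_prod_vec) measurable
  finally show ?thesis by (simp add: nn_integral_normal_density[OF assms])
qed

lemma prod_less_top_ennreal:
  fixes f :: "'i \<Rightarrow> ennreal"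
  shows "(\<And>i. i \<in> I \<Longrightarrow> f i < \<infinity>) \<Longrightarrow> prod f I < \<infinity>"
  by (induction I rule: infinite_finite_induct) (auto simp: ennreal_mult_less_top)

lemma nn_integral_norm_gauss_finite:
  assumes \<sigma>: "0 < \<sigma>"
  shows "(\<integral>\<^sup>+v. ennreal (norm v) * ennreal (gauss \<sigma> (v :: real^'d)) \<partial>lborel) < \<infinity>"
proof -
  have coord: "(\<integral>\<^sup>+v. ennreal \<bar>v $ j\<bar> * ennreal (gauss \<sigma> (v :: real^'d)) \<partial>lborel) < \<infinity>" for j
  proof -
    define h where "h i r = (if i = j then ennreal \<bar>r\<bar> else 1) * ennreal (normal_density 0 \<sigma> r)" for i :: 'd and r
    have [measurable]: "h i \<in> borel_measurable borel" for i unfolding h_def by measurable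
    have "(\<Prod>i\<in>UNIV. if i = j then ennreal \<bar>v $ i\<bar> else 1) = ennreal \<bar>v $ j\<bar>" for v :: "real^'d"
      by (simp add: prod.delta)
    then have "ennreal \<bar>v $ j\<bar> * ennreal (gauss \<sigma> v) = (\<Prod>i\<in>UNIV. h i (v $ i))" for v :: "real^'d"
      by (simp add: h_def prod.distrib gauss_def prod_ennreal)
    then have "(\<integral>\<^sup>+v. ennreal \<bar>v $ j\<bar> * ennreal (gauss \<sigma> (v :: real^'d)) \<partial>lborel) = (\<Prod>i\<in>UNIV. \<integral>\<^sup>+r. h i r \<partial>lborel)"
      by (simp add: nn_integral_lborel_prod_vec)
    also have "\<dots> < \<infinity>"
    proof -
      have "(\<integral>\<^sup>+r. h i r \<partial>lborel) < \<infinity>" for i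
      proof (cases "i = j")
        case True
        have "(\<integral>\<^sup>+r. h i r \<partial>lborel) = (\<integral>\<^sup>+r. ennreal (normal_density 0 \<sigma> r * \<bar>r - 0\<bar> ^ 1) \<partial>lborel)"
          by (simp add: h_def True ennreal_mult[symmetric] mult.commute)
        also have "\<dots> < \<infinity>"
          using integrable_normal_moment_abs[OF \<sigma>, of 0 1] by (subst nn_integral_eq_integral) auto
        finally show ?thesis .
      qed (simp add: h_def nn_integral_normal_density[OF \<sigma>])
      then show ?thesis by (intro prod_less_top_ennreal) simp
    qed
    finally show ?thesis .
  qed
  have "(\<integral>\<^sup>+v. ennreal (norm v) * ennreal (gauss \<sigma> (v :: real^'d)) \<partial>lborel) \<le>
      (\<integral>\<^sup>+v. (\<Sum>j\<in>UNIV. ennreal \<bar>v $ j\<bar> * ennreal (gauss \<sigma> (v :: real^'d))) \<partial>lborel)"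
  proof (intro nn_integral_mono)
    fix v :: "real^'d"
    have "ennreal (norm v) \<le> (\<Sum>j\<in>UNIV. ennreal \<bar>v $ j\<bar>)"
      using norm_le_l1_cart[of v] by (simp add: sum_ennreal ennreal_leI)
    then show "ennreal (norm v) * ennreal (gauss \<sigma> v) \<le> (\<Sum>j\<in>UNIV. ennreal \<bar>v $ j\<bar> * ennreal (gauss \<sigma> v))"
      by (simp add: sum_distrib_right[symmetric] mult_right_mono)
  qed
  also have "\<dots> = (\<Sum>j\<in>UNIV. \<integral>\<^sup>+v. ennreal \<bar>v $ j\<bar> * ennreal (gauss \<sigma> (v :: real^'d)) \<partial>lborel)"
    by (rule nn_integral_sum) measurable
  also have "\<dots> < \<infinity>" using coord by (simp add: less_top)
  finally show ?thesis .
qed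

lemma nn_integral_lborel_translate:
  fixes h :: "'a::euclidean_space \<Rightarrow> ennreal"
  assumes "h \<in> borel_measurable borel"
  shows "(\<integral>\<^sup>+v. h (c + v) \<partial>lborel) = (\<integral>\<^sup>+v. h v \<partial>lborel)"
  using assms by (subst (2) lborel_distr_plus[of c, symmetric]) (simp add: nn_integral_distr)

lemma nn_integral_gauss_shift:
  assumes "0 < \<sigma>"
  shows "(\<integral>\<^sup>+v. ennreal (gauss \<sigma> ((v :: real^'d) - c)) \<partial>lborel) = 1"
  using nn_integral_lborel_translate[of "\<lambda>v. ennreal (gauss \<sigma> (v - c))" c] nn_integral_gauss[OF assms, where 'd='d]
  by simp

interpretation path_lborel: product_sigma_finite "\<lambda>_ :: nat. lborel :: (real^'d) measure" ..

lemma path_add_measurable [measurable]: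
  "(\<lambda>(x, y). path_add T x y) \<in> path_lborel T \<Otimes>\<^sub>M path_lborel T \<rightarrow>\<^sub>M path_lborel T"
  unfolding path_add_def by measurable

lemma distr_path_add:
  assumes z: "z \<in> space (path_lborel T :: (nat \<Rightarrow> real^'d) measure)"
  shows "distr (path_lborel T) (path_lborel T) (path_add T z) = path_lborel T"
proof (rule path_lborel.PiM_eqI)
  fix A :: "nat \<Rightarrow> (real^'d) set" assume A: "\<And>i. i \<in> {1..T} \<Longrightarrow> A i \<in> sets lborel"
  have meas: "path_add T z \<in> path_lborel T \<rightarrow>\<^sub>M path_lborel T"
    using measurable_compose[OF measurable_Pair1'[OF z] path_add_measurable] by simp
  have pre: "path_add T z -` Pi\<^sub>E {1..T} A \<inter> space (path_lborel T) = Pi\<^sub>E {1..T} (\<lambda>t. (\<lambda>v. z t + v) -` A t)"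
    by (auto simp: path_add_def space_PiM PiE_iff)
  have [measurable]: "(\<lambda>v. z t + v) -` A t \<in> sets borel" if "t \<in> {1..T}" for t
    using measurable_sets[of "\<lambda>v. z t + v" borel borel "A t"] A[OF that] by simp
  have "emeasure (distr (path_lborel T) (path_lborel T) (path_add T z)) (Pi\<^sub>E {1..T} A) =
      emeasure (path_lborel T) (Pi\<^sub>E {1..T} (\<lambda>t. (\<lambda>v. z t + v) -` A t))"
    unfolding pre[symmetric] by (rule emeasure_distr[OF meas]) (auto intro!: sets_PiM_I_finite A)
  also have "\<dots> = (\<Prod>t\<in>{1..T}. emeasure lborel ((\<lambda>v. z t + v) -` A t))"
    by (rule path_lborel.emeasure_PiM) auto
  also have "\<dots> = (\<Prod>t\<in>{1..T}. emeasure lborel (A t))"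
  proof (rule prod.cong[OF refl])
    fix t assume t: "t \<in> {1..T}"
    have "emeasure lborel (A t) = emeasure (distr lborel borel ((+) (z t))) (A t)"
      by (simp add: lborel_distr_plus)
    also have "\<dots> = emeasure lborel ((\<lambda>v. z t + v) -` A t)"
      using A[OF t] by (subst emeasure_distr) auto
    finally show "emeasure lborel ((\<lambda>v. z t + v) -` A t) = emeasure lborel (A t)" by simp
  qed
  finally show "emeasure (distr (path_lborel T) (path_lborel T) (path_add T z)) (Pi\<^sub>E {1..T} A) = (\<Prod>t\<in>{1..T}. emeasure lborel (A t))" .
qed simp_all

lemma gaussian_eq:
  "gaussian T \<sigma> = density (path_lborel T) (\<lambda>x. \<Prod>t\<in>{1..T}. ennreal (gauss \<sigma> (x t)))"
  unfolding gaussian_def gauss_def[symmetric] by (simp add: prod_ennreal)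

lemma gauss_prod_measurable [measurable]:
  "(\<lambda>x. \<Prod>t\<in>{1..T}. ennreal (gauss \<sigma> (x t))) \<in> borel_measurable (path_lborel T)"
  by (intro borel_measurable_prod_ennreal measurable_compose[OF measurable_component_singleton]) auto

lemma sets_gaussian [simp, measurable_cong]: "sets (gaussian T \<sigma>) = sets (path_lborel T)"
  by (simp add: gaussian_eq)

lemma prob_space_gaussian:
  assumes "0 < \<sigma>"
  shows "prob_space (gaussian T \<sigma> :: (nat \<Rightarrow> real^'d) measure)"
proof
  have "emeasure (gaussian T \<sigma> :: (nat \<Rightarrow> real^'d) measure) (space (gaussian T \<sigma>)) = (\<integral>\<^sup>+x. (\<Prod>t\<in>{1..T}. ennreal (gauss \<sigma> (x t))) * indicator (space (path_lborel T)) x \<partial>(path_lborel T :: (nat \<Rightarrow> real^'d) measure))"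
    unfolding gaussian_eq space_density by (rule emeasure_density) auto
  also have "\<dots> = (\<integral>\<^sup>+x. (\<Prod>t\<in>{1..T}. ennreal (gauss \<sigma> (x t))) \<partial>(path_lborel T :: (nat \<Rightarrow> real^'d) measure))"
    by (intro nn_integral_cong) simp
  also have "\<dots> = (\<Prod>t\<in>{1..T}. \<integral>\<^sup>+v. ennreal (gauss \<sigma> (v :: real^'d)) \<partial>lborel)"
    by (rule path_lborel.product_nn_integral_prod) auto
  also have "\<dots> = 1" by (simp add: nn_integral_gauss[OF assms])
  finally show "emeasure (gaussian T \<sigma> :: (nat \<Rightarrow> real^'d) measure) (space (gaussian T \<sigma>)) = 1" .
qed

lemma nn_integral_path_norm_gaussian_finite:
  assumes \<sigma>: "0 < \<sigma>"
  shows "(\<integral>\<^sup>+x. path_norm T x \<partial>(gaussian T \<sigma> :: (nat \<Rightarrow> real^'d) measure)) < \<infinity>"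
proof -
  have coord: "(\<integral>\<^sup>+x. ennreal (norm (x s)) \<partial>(gaussian T \<sigma> :: (nat \<Rightarrow> real^'d) measure)) < \<infinity>" if s: "s \<in> {1..T}" for s
  proof -
    define h where "h t v = (if t = s then ennreal (norm v) else 1) * ennreal (gauss \<sigma> v)" for t :: nat and v :: "real^'d"
    have [measurable]: "h t \<in> borel_measurable borel" for t unfolding h_def by measurable
    have [measurable]: "(\<lambda>x. ennreal (norm (x s))) \<in> borel_measurable (path_lborel T :: (nat \<Rightarrow> real^'d) measure)"
      by (intro measurable_compose[OF measurable_component_singleton[OF s]]) auto
    have "(\<Prod>t\<in>{1..T}. if t = s then ennreal (norm (x t)) else 1) = ennreal (norm (x s))" for x :: "nat \<Rightarrow> real^'d"
      using s by (simp add: prod.delta)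
    then have h_eq: "(\<Prod>t\<in>{1..T}. ennreal (gauss \<sigma> (x t))) * ennreal (norm (x s)) = (\<Prod>t\<in>{1..T}. h t (x t))" for x :: "nat \<Rightarrow> real^'d"
      by (simp add: h_def prod.distrib mult.commute)
    have "(\<integral>\<^sup>+x. ennreal (norm (x s)) \<partial>(gaussian T \<sigma> :: (nat \<Rightarrow> real^'d) measure)) =
        (\<integral>\<^sup>+x. (\<Prod>t\<in>{1..T}. ennreal (gauss \<sigma> (x t))) * ennreal (norm (x s)) \<partial>(path_lborel T :: (nat \<Rightarrow> real^'d) measure))"
      unfolding gaussian_eq by (rule nn_integral_density) measurable
    also have "\<dots> = (\<integral>\<^sup>+x. (\<Prod>t\<in>{1..T}. h t (x t)) \<partial>path_lborel T)"
      by (simp only: h_eq)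
    also have "\<dots> = (\<Prod>t\<in>{1..T}. \<integral>\<^sup>+v. h t v \<partial>lborel)"
      by (rule path_lborel.product_nn_integral_prod) auto
    also have "\<dots> < \<infinity>"
    proof -
      have "(\<integral>\<^sup>+v. h t v \<partial>lborel) < \<infinity>" for t
        using nn_integral_norm_gauss_finite[OF \<sigma>, where 'd='d] nn_integral_gauss[OF \<sigma>, where 'd='d]
        by (cases "t = s") (simp_all add: h_def)
      then show ?thesis by (intro prod_less_top_ennreal) simp
    qed
    finally show ?thesis .
  qed
  have "(\<integral>\<^sup>+x. path_norm T x \<partial>(gaussian T \<sigma> :: (nat \<Rightarrow> real^'d) measure)) =
      (\<integral>\<^sup>+x. (\<Sum>s\<in>{1..T}. ennreal (norm (x s))) \<partial>(gaussian T \<sigma> :: (nat \<Rightarrow> real^'d) measure))"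
    by (simp add: path_norm_def sum_ennreal)
  also have "\<dots> = (\<Sum>s\<in>{1..T}. \<integral>\<^sup>+x. ennreal (norm (x s)) \<partial>(gaussian T \<sigma> :: (nat \<Rightarrow> real^'d) measure))"
    using measurable_component_singleton[of _ "{1..T}" "\<lambda>_. lborel :: (real^'d) measure"]
    by (intro nn_integral_sum) (simp cong: measurable_cong_sets)
  also have "\<dots> < \<infinity>" using coord by (simp add: less_top)
  finally show ?thesis .
qed

lemma (in prob_space) expectation_pos:
  fixes f :: "'a \<Rightarrow> real"
  assumes int: "integrable M f" and pos: "\<And>x. 0 < f x"
  shows "0 < expectation f"
proof -
  have "expectation f \<noteq> 0"
  proof
    assume "expectation f = 0"
    then have "AE x in M. f x = 0"
      using int pos by (subst (asm) integral_nonneg_eq_0_iff_AE) (auto simp: less_imp_le)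
    then have "AE x in M. False" using pos by (auto elim!: eventually_mono simp: less_le)
    then show False using AE_False by simp
  qed
  moreover have "0 \<le> expectation f" using pos by (intro integral_nonneg_AE) (auto simp: less_imp_le)
  ultimately show ?thesis by simp
qed

text \<open>The Gaussian transition density from \<open>z\<close> to \<open>x\<close>, restricted to the first \<open>t\<close> coordinates.\<close>

definition gauss_path :: "real \<Rightarrow> nat \<Rightarrow> (nat \<Rightarrow> real^'d) \<Rightarrow> (nat \<Rightarrow> real^'d) \<Rightarrow> real" where
  "gauss_path \<sigma> t x z = (\<Prod>s\<in>{1..t}. gauss \<sigma> (x s - z s))"

text \<open>The density of the first \<open>t\<close> coordinates under the convolution of \<open>\<mu>\<close> with the Gaussian.\<close>

definition smoothed :: "real \<Rightarrow> (nat \<Rightarrow> real^'d) measure \<Rightarrow> nat \<Rightarrow> (nat \<Rightarrow> real^'d) \<Rightarrow> real" where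
  "smoothed \<sigma> \<mu> t x = (\<integral>z. gauss_path \<sigma> t x z \<partial>\<mu>)"

text \<open>The conditional density of coordinate \<open>t + 1\<close> given the first \<open>t\<close> under the convolution. The denominator is
  positive everywhere because the Gaussian density is.\<close>

definition smoothed_kernel :: "real \<Rightarrow> (nat \<Rightarrow> real^'d) measure \<Rightarrow> nat \<Rightarrow> (nat \<Rightarrow> real^'d) \<Rightarrow> real^'d \<Rightarrow> ennreal" where
  "smoothed_kernel \<sigma> \<mu> t x a = ennreal (smoothed \<sigma> \<mu> (Suc t) (x(Suc t := a)) / smoothed \<sigma> \<mu> t x)"

lemma gauss_path_nonneg [simp]: "0 \<le> gauss_path \<sigma> t x z"
  by (simp add: gauss_path_def prod_nonneg)

lemma gauss_path_pos: "0 < \<sigma> \<Longrightarrow> 0 < gauss_path \<sigma> t x z"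
  by (simp add: gauss_path_def prod_pos gauss_pos)

lemma gauss_path_bound:
  "gauss_path \<sigma> t x (z :: nat \<Rightarrow> real^'d) \<le> ((1 / sqrt (2 * pi * \<sigma>\<^sup>2)) ^ CARD('d)) ^ t"
proof -
  have "gauss_path \<sigma> t x z \<le> (\<Prod>s\<in>{1..t}. (1 / sqrt (2 * pi * \<sigma>\<^sup>2)) ^ CARD('d))"
    unfolding gauss_path_def by (intro prod_mono) (simp add: gauss_bound)
  then show ?thesis by simp
qed

lemma gauss_path_measurable:
  assumes "t \<le> u" "t \<le> T"
  shows "(\<lambda>p. gauss_path \<sigma> t (fst p) (snd p)) \<in> borel_measurable (path_lborel u \<Otimes>\<^sub>M path_lborel T)"
  unfolding gauss_path_def
proof (rule borel_measurable_prod)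
  fix s assume s: "s \<in> {1..t}"
  have [measurable]: "(\<lambda>x. x s) \<in> path_lborel u \<rightarrow>\<^sub>M (borel :: (real^'d) measure)" "(\<lambda>x. x s) \<in> path_lborel T \<rightarrow>\<^sub>M (borel :: (real^'d) measure)"
    using s assms measurable_component_singleton[of s "{1..u}" "\<lambda>_. lborel :: (real^'d) measure"]
      measurable_component_singleton[of s "{1..T}" "\<lambda>_. lborel :: (real^'d) measure"] by auto
  show "(\<lambda>p. gauss \<sigma> (fst p s - snd p s)) \<in> borel_measurable (path_lborel u \<Otimes>\<^sub>M path_lborel T)"
    by measurable
qed

lemma gauss_path_cong: "(\<And>s. s \<in> {1..t} \<Longrightarrow> x s = y s) \<Longrightarrow> gauss_path \<sigma> t x z = gauss_path \<sigma> t y z"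
  by (simp add: gauss_path_def)

lemma gauss_path_Suc: "gauss_path \<sigma> (Suc t) (x(Suc t := a)) z = gauss_path \<sigma> t x z * gauss \<sigma> (a - z (Suc t))"
  by (simp add: gauss_path_def)

lemma smoothed_cong: "(\<And>s. s \<in> {1..t} \<Longrightarrow> x s = y s) \<Longrightarrow> smoothed \<sigma> \<mu> t x = smoothed \<sigma> \<mu> t y"
  unfolding smoothed_def by (intro Bochner_Integration.integral_cong refl gauss_path_cong)

locale smoothing = prob_space \<mu> for \<mu> :: "(nat \<Rightarrow> real^'d) measure" +
  fixes T :: nat and \<sigma> :: real
  assumes sets_\<mu>: "sets \<mu> = sets (path_space T)" and \<sigma>: "0 < \<sigma>"
begin

lemma sets_\<mu>' [measurable_cong]: "sets \<mu> = sets (path_lborel T)"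
  by (simp add: sets_\<mu> path_space_sets del: One_nat_def)

lemma gauss_path_measurable' [measurable]:
  "t \<le> T \<Longrightarrow> (\<lambda>p. gauss_path \<sigma> t (fst p) (snd p)) \<in> borel_measurable (path_lborel t \<Otimes>\<^sub>M \<mu>)"
  using gauss_path_measurable[of t t T \<sigma>]
  by (simp add: measurable_cong_sets[OF sets_pair_measure_cong[OF refl sets_\<mu>'] refl])

lemma integrable_gauss_path:
  assumes t: "t \<le> T"
  shows "integrable \<mu> (gauss_path \<sigma> t x)"
proof (rule integrable_const_bound)
  show "AE z in \<mu>. norm (gauss_path \<sigma> t x z) \<le> ((1 / sqrt (2 * pi * \<sigma>\<^sup>2)) ^ CARD('d)) ^ t"
    by (simp add: gauss_path_bound)
  have "restrict x {1..t} \<in> space (path_lborel t)" by (simp add: space_PiM)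
  from measurable_compose[OF measurable_Pair1'[OF this] gauss_path_measurable'[OF t]]
  have "gauss_path \<sigma> t (restrict x {1..t}) \<in> borel_measurable \<mu>" by simp
  moreover have "gauss_path \<sigma> t (restrict x {1..t}) = gauss_path \<sigma> t x"
    by (intro ext gauss_path_cong) simp
  ultimately show "gauss_path \<sigma> t x \<in> borel_measurable \<mu>" by simp
qed

lemma smoothed_pos: "t \<le> T \<Longrightarrow> 0 < smoothed \<sigma> \<mu> t x"
  unfolding smoothed_def using integrable_gauss_path gauss_path_pos[OF \<sigma>] by (rule expectation_pos)

lemma smoothed_0: "smoothed \<sigma> \<mu> 0 x = 1"
  by (simp add: smoothed_def gauss_path_def prob_space)

lemma ennreal_smoothed: "t \<le> T \<Longrightarrow> ennreal (smoothed \<sigma> \<mu> t x) = (\<integral>\<^sup>+z. gauss_path \<sigma> t x z \<partial>\<mu>)"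
  unfolding smoothed_def by (intro nn_integral_eq_integral[symmetric] integrable_gauss_path) auto

lemma smoothed_measurable:
  assumes t: "t \<le> T"
  shows "smoothed \<sigma> \<mu> t \<in> borel_measurable (path_lborel t)"
  unfolding smoothed_def[abs_def]
  using gauss_path_measurable'[OF t] by (intro borel_measurable_lebesgue_integral) (simp add: case_prod_unfold)

lemma smoothed_measurable_T:
  assumes t: "t \<le> T"
  shows "smoothed \<sigma> \<mu> t \<in> borel_measurable (path_lborel T)"
proof -
  have "(\<lambda>x. smoothed \<sigma> \<mu> t (restrict x {1..t})) \<in> borel_measurable (path_lborel T)"
    using t by (intro measurable_compose[OF measurable_restrict_subset smoothed_measurable]) auto
  moreover have "smoothed \<sigma> \<mu> t (restrict x {1..t}) = smoothed \<sigma> \<mu> t x" for x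
    by (rule smoothed_cong) simp
  ultimately show ?thesis by simp
qed

lemma nn_integral_smoothed_Suc:
  assumes t: "t < T"
  shows "(\<integral>\<^sup>+a. smoothed \<sigma> \<mu> (Suc t) (x(Suc t := a)) \<partial>lborel) = smoothed \<sigma> \<mu> t x"
proof -
  interpret pair_sigma_finite "lborel :: (real^'d) measure" \<mu> ..
  have [measurable]: "(\<lambda>z. z (Suc t)) \<in> \<mu> \<rightarrow>\<^sub>M borel"
    using t measurable_component_singleton[of "Suc t" "{1..T}" "\<lambda>_. lborel :: (real^'d) measure"]
    by (simp add: measurable_cong_sets[OF sets_\<mu>' refl])
  have [measurable]: "gauss_path \<sigma> t x \<in> borel_measurable \<mu>"
    using integrable_gauss_path[of t x] t by auto
  have "(\<integral>\<^sup>+a. smoothed \<sigma> \<mu> (Suc t) (x(Suc t := a)) \<partial>lborel) =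
      (\<integral>\<^sup>+a. (\<integral>\<^sup>+z. ennreal (gauss_path \<sigma> t x z) * ennreal (gauss \<sigma> (a - z (Suc t))) \<partial>\<mu>) \<partial>lborel)"
    using t by (simp add: ennreal_smoothed gauss_path_Suc ennreal_mult)
  also have "\<dots> = (\<integral>\<^sup>+z. (\<integral>\<^sup>+a. ennreal (gauss_path \<sigma> t x z) * ennreal (gauss \<sigma> (a - z (Suc t))) \<partial>lborel) \<partial>\<mu>)"
    by (rule Fubini'[symmetric]) measurable
  also have "\<dots> = (\<integral>\<^sup>+z. gauss_path \<sigma> t x z \<partial>\<mu>)"
    by (simp add: nn_integral_cmult nn_integral_gauss_shift[OF \<sigma>])
  also have "\<dots> = smoothed \<sigma> \<mu> t x" using t by (simp add: ennreal_smoothed)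
  finally show ?thesis .
qed

sublocale K: density_chain lborel T "smoothed_kernel \<sigma> \<mu>"
proof
  fix t assume t: "t < T"
  have ins: "{1..Suc t} = insert (Suc t) {1..t}" by auto
  have upd: "(\<lambda>(x, a). x(Suc t := a)) \<in> path_lborel t \<Otimes>\<^sub>M lborel \<rightarrow>\<^sub>M (path_lborel (Suc t) :: (nat \<Rightarrow> real^'d) measure)"
    unfolding ins by (rule measurable_add_dim)
  have [measurable]: "(\<lambda>p. smoothed \<sigma> \<mu> (Suc t) ((fst p)(Suc t := snd p))) \<in> borel_measurable (path_lborel t \<Otimes>\<^sub>M lborel)"
    using measurable_compose[OF upd smoothed_measurable[of "Suc t"]] t by (simp only: case_prod_unfold Suc_leI)
  have [measurable]: "smoothed \<sigma> \<mu> t \<in> borel_measurable (path_lborel t)"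
    using t by (intro smoothed_measurable) simp
  show "(\<lambda>(x, a). smoothed_kernel \<sigma> \<mu> t x a) \<in> borel_measurable (path_lborel t \<Otimes>\<^sub>M lborel)"
    unfolding smoothed_kernel_def case_prod_unfold by measurable
  fix x :: "nat \<Rightarrow> real^'d" assume x: "x \<in> space (path_lborel t)"
  have pos: "0 < smoothed \<sigma> \<mu> t x" using t by (intro smoothed_pos) simp
  have "(\<lambda>p. ennreal (smoothed \<sigma> \<mu> (Suc t) ((fst p)(Suc t := snd p)))) \<in> borel_measurable (path_lborel t \<Otimes>\<^sub>M lborel)"
    by measurable
  from measurable_compose[OF measurable_Pair1'[OF x] this]
  have meas: "(\<lambda>a. ennreal (smoothed \<sigma> \<mu> (Suc t) (x(Suc t := a)))) \<in> borel_measurable lborel"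
    by simp
  have "(\<integral>\<^sup>+a. smoothed_kernel \<sigma> \<mu> t x a \<partial>lborel) =
      (\<integral>\<^sup>+a. ennreal (smoothed \<sigma> \<mu> (Suc t) (x(Suc t := a))) / ennreal (smoothed \<sigma> \<mu> t x) \<partial>lborel)"
    unfolding smoothed_kernel_def using pos t smoothed_pos[of "Suc t"]
    by (intro nn_integral_cong divide_ennreal[symmetric]) (auto intro: less_imp_le)
  also have "\<dots> = 1"
    using pos by (simp only: nn_integral_divide[OF meas] nn_integral_smoothed_Suc[OF t] divide_ennreal less_imp_le)
      simp
  finally show "(\<integral>\<^sup>+a. smoothed_kernel \<sigma> \<mu> t x a \<partial>lborel) = 1" .
qed

lemma smoothed_kernel_component:
  "s < T \<Longrightarrow> smoothed_kernel \<sigma> \<mu> s (restrict x {1..s}) (x (Suc s)) = ennreal (smoothed \<sigma> \<mu> (Suc s) x / smoothed \<sigma> \<mu> s x)"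
  unfolding smoothed_kernel_def
  by (intro arg_cong[where f=ennreal] arg_cong2[where f="(/)"] smoothed_cong) auto

text \<open>The product of the conditional densities telescopes.\<close>

lemma chain_eq: "K.chain T = density (path_lborel T) (smoothed \<sigma> \<mu> T)"
proof -
  have "(\<Prod>s<T. smoothed_kernel \<sigma> \<mu> s (restrict x {1..s}) (x (Suc s))) = ennreal (smoothed \<sigma> \<mu> T x)" for x
  proof -
    have "(\<Prod>s<T. smoothed_kernel \<sigma> \<mu> s (restrict x {1..s}) (x (Suc s))) =
        (\<Prod>s<T. ennreal (smoothed \<sigma> \<mu> (Suc s) x / smoothed \<sigma> \<mu> s x))"
      by (intro prod.cong refl smoothed_kernel_component) simp
    also have "\<dots> = ennreal (\<Prod>s<T. smoothed \<sigma> \<mu> (Suc s) x / smoothed \<sigma> \<mu> s x)"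
      by (intro prod_ennreal divide_nonneg_nonneg less_imp_le[OF smoothed_pos]) auto
    also have "(\<Prod>s<T. smoothed \<sigma> \<mu> (Suc s) x / smoothed \<sigma> \<mu> s x) = smoothed \<sigma> \<mu> T x / smoothed \<sigma> \<mu> 0 x"
      using less_imp_neq[OF smoothed_pos] by (intro prod_lessThan_telescope) (metis less_imp_le)
    also have "\<dots> = smoothed \<sigma> \<mu> T x" by (simp add: smoothed_0)
    finally show ?thesis .
  qed
  then show ?thesis unfolding K.chain_def by (simp only:)
qed

lemma add_gaussian_measurable [measurable]:
  "(\<lambda>(z, w). path_add T z w) \<in> \<mu> \<Otimes>\<^sub>M gaussian T \<sigma> \<rightarrow>\<^sub>M path_space T"
  using path_add_measurable[of T]
  by (simp only: measurable_cong_sets[OF sets_pair_measure_cong[OF sets_\<mu>' sets_gaussian] path_space_sets[symmetric]])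

text \<open>The convolution is thus the law of a process with explicit conditional densities.\<close>

lemma chain_eq_convolution: "path_convolution T \<mu> (gaussian T \<sigma>) = K.chain T"
proof (rule measure_eqI)
  show "sets (path_convolution T \<mu> (gaussian T \<sigma>)) = sets (K.chain T)"
    by (simp add: path_convolution_def path_space_sets del: One_nat_def)
  fix A assume "A \<in> sets (path_convolution T \<mu> (gaussian T \<sigma>))"
  then have A' [measurable]: "A \<in> sets (path_space T)" by (simp add: path_convolution_def)
  then have A [measurable]: "A \<in> sets (path_lborel T)" by (simp add: path_space_sets del: One_nat_def)
  interpret G: prob_space "gaussian T \<sigma> :: (nat \<Rightarrow> real^'d) measure" by (rule prob_space_gaussian[OF \<sigma>])
  interpret pl: sigma_finite_measure "path_lborel T :: (nat \<Rightarrow> real^'d) measure"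
    by (rule path_lborel.sigma_finite) simp
  interpret pair_sigma_finite "path_lborel T :: (nat \<Rightarrow> real^'d) measure" \<mu> ..
  have addw: "path_add T z \<in> path_lborel T \<rightarrow>\<^sub>M path_lborel T" if "z \<in> space (path_lborel T)" for z :: "nat \<Rightarrow> real^'d"
    using measurable_compose[OF measurable_Pair1'[OF that] path_add_measurable] by simp
  have sp: "space \<mu> = space (path_lborel T)" by (rule sets_eq_imp_space_eq[OF sets_\<mu>'])
  have gp [measurable]: "(\<lambda>p. gauss_path \<sigma> T (fst p) (snd p)) \<in> borel_measurable (path_lborel T \<Otimes>\<^sub>M \<mu>)"
    by measurable
  have "emeasure (path_convolution T \<mu> (gaussian T \<sigma>)) A =
      (\<integral>\<^sup>+p. indicator A (path_add T (fst p) (snd p)) \<partial>(\<mu> \<Otimes>\<^sub>M gaussian T \<sigma>))"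
    unfolding path_convolution_def
    by (subst nn_integral_indicator[symmetric], simp, subst nn_integral_distr) (auto simp: case_prod_unfold)
  also have "\<dots> = (\<integral>\<^sup>+z. (\<integral>\<^sup>+w. indicator A (path_add T z w) \<partial>gaussian T \<sigma>) \<partial>\<mu>)"
    using add_gaussian_measurable A' by (subst G.nn_integral_fst[symmetric]) (auto simp: case_prod_unfold)
  also have "\<dots> = (\<integral>\<^sup>+z. (\<integral>\<^sup>+x. ennreal (gauss_path \<sigma> T x z) * indicator A x \<partial>path_lborel T) \<partial>\<mu>)"
  proof (intro nn_integral_cong)
    fix z assume "z \<in> space \<mu>"
    then have z: "z \<in> space (path_lborel T)" by (simp only: sp)
    note [measurable] = addw[OF z]
    have gz [measurable]: "(\<lambda>x. gauss_path \<sigma> T x z) \<in> borel_measurable (path_lborel T)"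
      using measurable_compose[OF measurable_Pair2'[OF z] gauss_path_measurable[of T T T \<sigma>]] by simp
    have shift: "(\<Prod>t\<in>{1..T}. ennreal (gauss \<sigma> (w t))) = ennreal (gauss_path \<sigma> T (path_add T z w) z)" for w
      by (simp add: gauss_path_def path_add_def prod_ennreal)
    have "(\<integral>\<^sup>+w. indicator A (path_add T z w) \<partial>gaussian T \<sigma>) =
        (\<integral>\<^sup>+w. (\<Prod>t\<in>{1..T}. ennreal (gauss \<sigma> (w t))) * indicator A (path_add T z w) \<partial>path_lborel T)"
      unfolding gaussian_eq by (rule nn_integral_density) measurable
    also have "\<dots> = (\<integral>\<^sup>+w. ennreal (gauss_path \<sigma> T (path_add T z w) z) * indicator A (path_add T z w) \<partial>path_lborel T)"
      by (simp only: shift)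
    also have "\<dots> = (\<integral>\<^sup>+x. ennreal (gauss_path \<sigma> T x z) * indicator A x \<partial>distr (path_lborel T) (path_lborel T) (path_add T z))"
      by (rule nn_integral_distr[symmetric]) measurable
    finally show "(\<integral>\<^sup>+w. indicator A (path_add T z w) \<partial>gaussian T \<sigma>) =
        (\<integral>\<^sup>+x. ennreal (gauss_path \<sigma> T x z) * indicator A x \<partial>path_lborel T)"
      by (simp only: distr_path_add[OF z])
  qed
  also have "\<dots> = (\<integral>\<^sup>+x. (\<integral>\<^sup>+z. ennreal (gauss_path \<sigma> T x z) * indicator A x \<partial>\<mu>) \<partial>path_lborel T)"
    by (rule Fubini') measurable
  also have "\<dots> = (\<integral>\<^sup>+x. ennreal (smoothed \<sigma> \<mu> T x) * indicator A x \<partial>path_lborel T)"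
    using integrable_gauss_path[of T] by (simp add: nn_integral_multc ennreal_smoothed)
  also have "\<dots> = emeasure (K.chain T) A"
    unfolding chain_eq by (intro emeasure_density[symmetric] A measurable_compose[OF smoothed_measurable measurable_ennreal]) simp
  finally show "emeasure (path_convolution T \<mu> (gaussian T \<sigma>)) A = emeasure (K.chain T) A" .
qed

lemma nn_integral_convolution:
  assumes [measurable]: "H \<in> borel_measurable (path_space T)"
  shows "(\<integral>\<^sup>+x. H x \<partial>path_convolution T \<mu> (gaussian T \<sigma>)) = (\<integral>\<^sup>+z. (\<integral>\<^sup>+w. H (path_add T z w) \<partial>gaussian T \<sigma>) \<partial>\<mu>)"
proof -
  interpret G: prob_space "gaussian T \<sigma> :: (nat \<Rightarrow> real^'d) measure" by (rule prob_space_gaussian[OF \<sigma>])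
  have "(\<integral>\<^sup>+x. H x \<partial>path_convolution T \<mu> (gaussian T \<sigma>)) = (\<integral>\<^sup>+p. H (path_add T (fst p) (snd p)) \<partial>(\<mu> \<Otimes>\<^sub>M gaussian T \<sigma>))"
    unfolding path_convolution_def by (subst nn_integral_distr) (auto simp: case_prod_unfold)
  also have "\<dots> = (\<integral>\<^sup>+z. (\<integral>\<^sup>+w. H (path_add T z w) \<partial>gaussian T \<sigma>) \<partial>\<mu>)"
    using measurable_compose[OF add_gaussian_measurable assms] by (subst G.nn_integral_fst[symmetric]) (auto simp: case_prod_unfold)
  finally show ?thesis .
qed

end

section \<open>Convergence of the smoothed adapted distance\<close>

text \<open>The density with which the two smoothed paths stay together throughout.\<close>

definition overlap_density :: "nat \<Rightarrow> real \<Rightarrow> (nat \<Rightarrow> real^'d) measure \<Rightarrow> (nat \<Rightarrow> real^'d) measure \<Rightarrow> (nat \<Rightarrow> real^'d) \<Rightarrow> real" where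
  "overlap_density T \<sigma> \<mu> \<nu> x = (\<Prod>s<T. min (smoothed \<sigma> \<mu> (Suc s) x / smoothed \<sigma> \<mu> s x) (smoothed \<sigma> \<nu> (Suc s) x / smoothed \<sigma> \<nu> s x))"

lemma overlap_density_measurable:
  assumes "smoothing \<mu> T \<sigma>" "smoothing \<nu> T \<sigma>"
  shows "overlap_density T \<sigma> \<mu> \<nu> \<in> borel_measurable (path_lborel T)"
proof -
  interpret m: smoothing \<mu> T \<sigma> by fact
  interpret n: smoothing \<nu> T \<sigma> by fact
  show ?thesis
    unfolding overlap_density_def[abs_def]
    by (intro borel_measurable_prod borel_measurable_min borel_measurable_divide m.smoothed_measurable_T n.smoothed_measurable_T) auto
qed

lemma smooth_AW1_le_overlap:
  fixes \<mu> \<nu> :: "(nat \<Rightarrow> real^'d) measure"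
  assumes "smoothing \<mu> T \<sigma>" "smoothing \<nu> T \<sigma>"
  shows "smooth_AW1 T \<sigma> \<mu> \<nu> + 2 * (\<integral>\<^sup>+x. ennreal (overlap_density T \<sigma> \<mu> \<nu> x) * ennreal (path_norm T x) \<partial>path_lborel T)
    \<le> (\<integral>\<^sup>+x. path_norm T x \<partial>path_convolution T \<mu> (gaussian T \<sigma>)) + (\<integral>\<^sup>+x. path_norm T x \<partial>path_convolution T \<nu> (gaussian T \<sigma>))"
proof -
  interpret m: smoothing \<mu> T \<sigma> by fact
  interpret n: smoothing \<nu> T \<sigma> by fact
  interpret PP: path_pair T "smoothed_kernel \<sigma> \<mu>" "smoothed_kernel \<sigma> \<nu>" ..
  have nonneg: "0 \<le> smoothed \<sigma> \<mu> (Suc s) x / smoothed \<sigma> \<mu> s x" "0 \<le> smoothed \<sigma> \<nu> (Suc s) x / smoothed \<sigma> \<nu> s x" if "s < T" for s x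
    using that by (auto intro!: divide_nonneg_nonneg less_imp_le[OF m.smoothed_pos] less_imp_le[OF n.smoothed_pos])
  have "(\<Prod>s<T. overlap True (smoothed_kernel \<sigma> \<mu> s (restrict x {1..s})) (smoothed_kernel \<sigma> \<nu> s (restrict x {1..s})) (x (Suc s)))
      = ennreal (overlap_density T \<sigma> \<mu> \<nu> x)" for x
    unfolding overlap_density_def
  proof (subst prod_ennreal[symmetric])
    show "(\<Prod>s<T. overlap True (smoothed_kernel \<sigma> \<mu> s (restrict x {1..s})) (smoothed_kernel \<sigma> \<nu> s (restrict x {1..s})) (x (Suc s)))
      = (\<Prod>s<T. ennreal (min (smoothed \<sigma> \<mu> (Suc s) x / smoothed \<sigma> \<mu> s x) (smoothed \<sigma> \<nu> (Suc s) x / smoothed \<sigma> \<nu> s x)))"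
      by (intro prod.cong refl)
        (simp add: overlap_def m.smoothed_kernel_component n.smoothed_kernel_component
          min_of_mono[OF monoI, of ennreal] ennreal_leI del: One_nat_def)
  qed (use nonneg in auto)
  then have O: "PP.O.chain T = density (path_lborel T) (\<lambda>x. ennreal (overlap_density T \<sigma> \<mu> \<nu> x))"
    unfolding PP.O.chain_def by (simp only:)
  have "(\<integral>\<^sup>+x. path_norm T x \<partial>PP.O.chain T) = (\<integral>\<^sup>+x. ennreal (overlap_density T \<sigma> \<mu> \<nu> x) * ennreal (path_norm T x) \<partial>path_lborel T)"
    unfolding O
    by (intro nn_integral_density measurable_compose[OF overlap_density_measurable[OF assms] measurable_ennreal]) measurable
  then show ?thesis
    using PP.AW1_le_overlap by (simp only: smooth_AW1_def m.chain_eq_convolution n.chain_eq_convolution)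
qed

text \<open>Pointwise convergence of the marginal densities forces the overlap density to converge to the density of \<open>\<mu>\<close>;
  by Fatou's lemma no first moment is lost, so the bound of \<open>smooth_AW1_le_overlap\<close> tends to \<open>0\<close>.\<close>

lemma smooth_AW1_tendsto_0:
  fixes \<mu> :: "(nat \<Rightarrow> real^'d) measure"
  assumes \<mu>: "smoothing \<mu> T \<sigma>" and \<nu>: "\<And>N. smoothing (\<nu> N) T \<sigma>"
    and finite_moment: "(\<integral>\<^sup>+x. path_norm T x \<partial>path_convolution T \<mu> (gaussian T \<sigma>)) < \<infinity>"
    and moments: "(\<lambda>N. \<integral>\<^sup>+x. path_norm T x \<partial>path_convolution T (\<nu> N) (gaussian T \<sigma>))
        \<longlonglongrightarrow> (\<integral>\<^sup>+x. path_norm T x \<partial>path_convolution T \<mu> (gaussian T \<sigma>))"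
    and densities: "AE x in path_lborel T. \<forall>t\<le>T. (\<lambda>N. smoothed \<sigma> (\<nu> N) t x) \<longlonglongrightarrow> smoothed \<sigma> \<mu> t x"
  shows "(\<lambda>N. smooth_AW1 T \<sigma> \<mu> (\<nu> N)) \<longlonglongrightarrow> 0"
proof -
  interpret m: smoothing \<mu> T \<sigma> by fact
  define A where "A = (\<integral>\<^sup>+x. path_norm T x \<partial>path_convolution T \<mu> (gaussian T \<sigma>))"
  define B where "B N = (\<integral>\<^sup>+x. path_norm T x \<partial>path_convolution T (\<nu> N) (gaussian T \<sigma>))" for N
  define C where "C N = (\<integral>\<^sup>+x. ennreal (overlap_density T \<sigma> \<mu> (\<nu> N) x) * ennreal (path_norm T x) \<partial>path_lborel T)" for N
  have A: "A = (\<integral>\<^sup>+x. ennreal (smoothed \<sigma> \<mu> T x) * ennreal (path_norm T x) \<partial>path_lborel T)"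
    unfolding A_def m.chain_eq_convolution m.chain_eq
    by (intro nn_integral_density measurable_compose[OF m.smoothed_measurable[OF order_refl] measurable_ennreal]) measurable
  have telescope: "(\<Prod>s<T. smoothed \<sigma> \<mu> (Suc s) x / smoothed \<sigma> \<mu> s x) = smoothed \<sigma> \<mu> T x" for x
    using prod_lessThan_telescope[of T "\<lambda>s. smoothed \<sigma> \<mu> s x"] less_imp_neq[OF m.smoothed_pos]
    by (metis (no_types, lifting) div_by_1 m.smoothed_0)
  have C_le: "C N \<le> A" for N
    unfolding A C_def
  proof (intro nn_integral_mono mult_right_mono ennreal_leI)
    fix x
    interpret n: smoothing "\<nu> N" T \<sigma> by (rule \<nu>)
    have "overlap_density T \<sigma> \<mu> (\<nu> N) x \<le> (\<Prod>s<T. smoothed \<sigma> \<mu> (Suc s) x / smoothed \<sigma> \<mu> s x)"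
      unfolding overlap_density_def
      by (intro prod_mono) (auto intro!: divide_nonneg_nonneg less_imp_le[OF m.smoothed_pos] less_imp_le[OF n.smoothed_pos])
    then show "overlap_density T \<sigma> \<mu> (\<nu> N) x \<le> smoothed \<sigma> \<mu> T x" by (simp only: telescope)
  qed simp
  have "A = (\<integral>\<^sup>+x. liminf (\<lambda>N. ennreal (overlap_density T \<sigma> \<mu> (\<nu> N) x) * ennreal (path_norm T x)) \<partial>path_lborel T)"
    unfolding A
  proof (rule nn_integral_cong_AE)
    show "AE x in path_lborel T. ennreal (smoothed \<sigma> \<mu> T x) * ennreal (path_norm T x) =
        liminf (\<lambda>N. ennreal (overlap_density T \<sigma> \<mu> (\<nu> N) x) * ennreal (path_norm T x))"
      using densities
    proof eventually_elim
      fix x assume lim: "\<forall>t\<le>T. (\<lambda>N. smoothed \<sigma> (\<nu> N) t x) \<longlonglongrightarrow> smoothed \<sigma> \<mu> t x"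
      have "(\<lambda>N. overlap_density T \<sigma> \<mu> (\<nu> N) x) \<longlonglongrightarrow>
          (\<Prod>s<T. min (smoothed \<sigma> \<mu> (Suc s) x / smoothed \<sigma> \<mu> s x) (smoothed \<sigma> \<mu> (Suc s) x / smoothed \<sigma> \<mu> s x))"
        unfolding overlap_density_def
        using lim less_imp_neq[OF m.smoothed_pos, THEN not_sym]
        by (intro tendsto_prod tendsto_min tendsto_divide tendsto_const) auto
      then have "(\<lambda>N. overlap_density T \<sigma> \<mu> (\<nu> N) x) \<longlonglongrightarrow> smoothed \<sigma> \<mu> T x"
        by (simp only: min.idem telescope)
      then have "(\<lambda>N. ennreal (overlap_density T \<sigma> \<mu> (\<nu> N) x) * ennreal (path_norm T x)) \<longlonglongrightarrow>
          ennreal (smoothed \<sigma> \<mu> T x) * ennreal (path_norm T x)"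
        by (intro tendsto_mult_ennreal tendsto_ennrealI tendsto_const) auto
      from lim_imp_Liminf[OF _ this] show "ennreal (smoothed \<sigma> \<mu> T x) * ennreal (path_norm T x) =
        liminf (\<lambda>N. ennreal (overlap_density T \<sigma> \<mu> (\<nu> N) x) * ennreal (path_norm T x))"
        by simp
    qed
  qed
  also have "\<dots> \<le> liminf C"
    unfolding C_def
    by (intro nn_integral_liminf borel_measurable_times_ennreal
        measurable_compose[OF overlap_density_measurable[OF \<mu> \<nu>] measurable_ennreal]
        measurable_compose[OF path_norm_measurable(1) measurable_ennreal])
  finally have "A \<le> liminf C" .
  moreover have "limsup C \<le> A"
    by (intro Limsup_bounded always_eventually allI C_le)
  moreover have "liminf C \<le> limsup C" by (intro Liminf_le_Limsup) simp
  ultimately have C: "C \<longlonglongrightarrow> A"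
    by (intro tendsto_iff_Liminf_eq_Limsup[THEN iffD2]) auto
  have fin: "A < \<top>" using finite_moment by (simp add: A_def)
  have upper: "smooth_AW1 T \<sigma> \<mu> (\<nu> N) \<le> (A + B N) - 2 * C N" for N
    using smooth_AW1_le_overlap[OF \<mu> \<nu>, of N]
    by (simp only: ennreal_le_minus_iff A_def B_def C_def simp_thms)
  have B: "B \<longlonglongrightarrow> A" using moments by (simp add: A_def B_def[abs_def])
  have "(\<lambda>N. (A + B N) - 2 * C N) \<longlonglongrightarrow> (A + A) - 2 * A"
    using fin by (intro tendsto_diff_ennreal tendsto_add tendsto_const B ennreal_tendsto_cmult C) (auto simp: ennreal_mult_eq_top_iff)
  also have "(A + A) - 2 * A = 0" using fin by (simp add: mult_2)
  finally show ?thesis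
    by (rule tendsto_sandwich[OF _ _ tendsto_const, rotated 2]) (auto intro!: always_eventually upper)
qed

section \<open>Empirical measures\<close>

text \<open>Convergence with countable quantifiers only, for measurability.\<close>

lemma LIMSEQ_iff_inverse_Suc:
  fixes u :: "nat \<Rightarrow> real"
  shows "u \<longlonglongrightarrow> l \<longleftrightarrow> (\<forall>k. \<exists>N0. \<forall>N\<ge>N0. \<bar>u N - l\<bar> < inverse (real (Suc k)))"
proof
  assume "u \<longlonglongrightarrow> l"
  then show "\<forall>k. \<exists>N0. \<forall>N\<ge>N0. \<bar>u N - l\<bar> < inverse (real (Suc k))"
    using LIMSEQ_D[of u l "inverse (real (Suc k))" for k] by (simp del: of_nat_Suc)
next
  assume *: "\<forall>k. \<exists>N0. \<forall>N\<ge>N0. \<bar>u N - l\<bar> < inverse (real (Suc k))"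
  show "u \<longlonglongrightarrow> l"
  proof (rule LIMSEQ_I)
    fix r :: real assume "0 < r"
    then obtain k where "inverse (real (Suc k)) < r" using reals_Archimedean by blast
    then show "\<exists>N0. \<forall>N\<ge>N0. norm (u N - l) < r"
      using * by (metis less_trans real_norm_def)
  qed
qed

lemma empirical_measure_smoothing:
  assumes N: "N \<ge> 1" and \<sigma>: "0 < \<sigma>" and x: "\<And>n. n \<ge> 1 \<Longrightarrow> x n \<in> space (path_space T)"
  shows "smoothing (empirical_measure T N x) T \<sigma>"
proof -
  have "prob_space (uniform_count_measure {1..N})"
    using N by (intro prob_space_uniform_count_measure) auto
  moreover have "x \<in> uniform_count_measure {1..N} \<rightarrow>\<^sub>M path_space T"
    using x by (auto simp: measurable_cong_sets[OF sets_uniform_count_measure_count_space refl])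
  ultimately have "prob_space (empirical_measure T N x)"
    unfolding empirical_measure_def by (rule prob_space.prob_space_distr)
  then show ?thesis
    using \<sigma> by (simp add: smoothing_def smoothing_axioms_def empirical_measure_def)
qed

lemma integral_empirical_measure:
  fixes F :: "(nat \<Rightarrow> real^'d) \<Rightarrow> real"
  assumes x: "\<And>n. n \<ge> 1 \<Longrightarrow> x n \<in> space (path_space T)" and F: "F \<in> borel_measurable (path_space T)"
  shows "(\<integral>z. F z \<partial>empirical_measure T N x) = (\<Sum>n=1..N. F (x n)) / N"
proof -
  have "x \<in> uniform_count_measure {1..N} \<rightarrow>\<^sub>M path_space T"
    using x by (auto simp: measurable_cong_sets[OF sets_uniform_count_measure_count_space refl])
  then show ?thesis
    unfolding empirical_measure_def by (simp add: integral_distr F integral_uniform_count_measure)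
qed

lemma nn_integral_empirical_measure:
  fixes F :: "(nat \<Rightarrow> real^'d) \<Rightarrow> real"
  assumes x: "\<And>n. n \<ge> 1 \<Longrightarrow> x n \<in> space (path_space T)" and F: "F \<in> borel_measurable (path_space T)"
    and F0: "\<And>z. 0 \<le> F z"
  shows "(\<integral>\<^sup>+z. F z \<partial>empirical_measure T N x) = ennreal ((\<Sum>n=1..N. F (x n)) / N)"
proof -
  have "x \<in> uniform_count_measure {1..N} \<rightarrow>\<^sub>M path_space T"
    using x by (auto simp: measurable_cong_sets[OF sets_uniform_count_measure_count_space refl])
  then have "(\<integral>\<^sup>+z. F z \<partial>empirical_measure T N x) = (\<integral>\<^sup>+n. F (x n) \<partial>uniform_count_measure {1..N})"
    unfolding empirical_measure_def using F by (simp add: nn_integral_distr)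
  also have "\<dots> = (\<Sum>n\<in>{1..N}. ennreal (1 / real N) * ennreal (F (x n)))"
    unfolding uniform_count_measure_def by (subst nn_integral_point_measure_finite) simp_all
  also have "\<dots> = (\<Sum>n\<in>{1..N}. ennreal (F (x n) / N))"
    using F0 by (simp add: ennreal_mult[symmetric])
  also have "\<dots> = ennreal ((\<Sum>n=1..N. F (x n)) / N)"
    using F0 by (simp add: sum_divide_distrib)
  finally show ?thesis .
qed

text \<open>An i.i.d. sample \<open>X 1, X 2, \<dots>\<close> from \<open>\<mu>\<close>.\<close>

locale path_sample = P: prob_space P for P :: "'w measure" +
  fixes X :: "nat \<Rightarrow> 'w \<Rightarrow> (nat \<Rightarrow> real^'d)" and T :: nat and \<mu> :: "(nat \<Rightarrow> real^'d) measure"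
  assumes indep: "P.indep_vars (\<lambda>_. path_space T) X {1..}"
    and distr_X: "\<And>n. n \<ge> 1 \<Longrightarrow> distr P (path_space T) (X n) = \<mu>"
begin

lemma X_measurable: "n \<ge> 1 \<Longrightarrow> X n \<in> P \<rightarrow>\<^sub>M path_space T"
  using indep by (simp add: P.indep_vars_def2)

lemma X_space: "\<omega> \<in> space P \<Longrightarrow> n \<ge> 1 \<Longrightarrow> X n \<omega> \<in> space (path_space T)"
  using measurable_space[OF X_measurable] by blast

lemma AE_sample_mean:
  fixes F :: "(nat \<Rightarrow> real^'d) \<Rightarrow> real"
  assumes F: "F \<in> borel_measurable (path_space T)" and F0: "\<And>z. 0 \<le> F z" and int: "integrable \<mu> F"
  shows "AE \<omega> in P. (\<lambda>N. (\<Sum>n=1..N. F (X n \<omega>)) / N) \<longlonglongrightarrow> (\<integral>z. F z \<partial>\<mu>)"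
proof -
  have mean: "P.expectation (\<lambda>\<omega>. F (X 1 \<omega>)) = (\<integral>z. F z \<partial>\<mu>)"
    using integral_distr[OF X_measurable[of 1] F] distr_X[of 1] by simp
  have "AE \<omega> in P. (\<lambda>N. (\<Sum>n=1..N. F (X n \<omega>)) / N) \<longlonglongrightarrow> P.expectation (\<lambda>\<omega>. F (X 1 \<omega>))"
  proof (rule P.strong_law_of_large_numbers_nonneg)
    show "P.indep_vars (\<lambda>_. borel) (\<lambda>n \<omega>. F (X n \<omega>)) {1..}"
      by (rule P.indep_vars_compose2[OF indep]) (rule F)
    show "distr P borel (\<lambda>\<omega>. F (X n \<omega>)) = distr \<mu> borel F" if "n \<ge> 1" for n
      using distr_distr[OF F X_measurable[OF that]] distr_X[OF that] by (simp add: comp_def)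
    show "integrable P (\<lambda>\<omega>. F (X 1 \<omega>))"
      using int integrable_distr_eq[OF X_measurable[of 1] F] distr_X[of 1] by simp
  qed (rule F0)
  then show ?thesis by (simp only: mean)
qed

context
  fixes \<sigma> :: real
  assumes \<sigma>: "0 < \<sigma>"
begin

lemma smoothing_\<mu>: "smoothing \<mu> T \<sigma>"
proof -
  have "prob_space \<mu>" using P.prob_space_distr[OF X_measurable[of 1]] distr_X[of 1] by simp
  moreover have "sets \<mu> = sets (path_space T)" using distr_X[of 1] by auto
  ultimately show ?thesis using \<sigma> by (simp add: smoothing_def smoothing_axioms_def)
qed

interpretation m: smoothing \<mu> T \<sigma> by (rule smoothing_\<mu>)

lemma gauss_path_measurable_X:
  fixes x :: "nat \<Rightarrow> real^'d"
  assumes "t \<le> T"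
  shows "gauss_path \<sigma> t x \<in> borel_measurable (path_space T)"
  using m.integrable_gauss_path[OF assms, of x] by (simp add: measurable_cong_sets[OF m.sets_\<mu> refl, symmetric])

lemma smoothed_empirical:
  assumes "\<omega> \<in> space P" "t \<le> T"
  shows "smoothed \<sigma> (empirical_measure T N (\<lambda>n. X n \<omega>)) t x = (\<Sum>n=1..N. gauss_path \<sigma> t x (X n \<omega>)) / N"
  unfolding smoothed_def
  by (rule integral_empirical_measure[OF X_space[OF assms(1)] gauss_path_measurable_X[OF assms(2)]])

text \<open>At each fixed \<open>x\<close> the densities converge almost surely by the strong law; Fubini's theorem exchanges the
  exceptional null sets.\<close>

lemma AE_smoothed_empirical:
  "AE \<omega> in P. AE x in path_lborel T. \<forall>t\<le>T.
    (\<lambda>N. (\<Sum>n=1..N. gauss_path \<sigma> t x (X n \<omega>)) / N) \<longlonglongrightarrow> smoothed \<sigma> \<mu> t x"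
proof -
  define Q where "Q x \<omega> \<longleftrightarrow> (\<forall>t\<in>{..T}.
    (\<lambda>N. (\<Sum>n=1..N. gauss_path \<sigma> t x (X n \<omega>)) / N) \<longlonglongrightarrow> smoothed \<sigma> \<mu> t x)" for x \<omega>
  interpret pl: sigma_finite_measure "path_lborel T :: (nat \<Rightarrow> real^'d) measure"
    by (rule path_lborel.sigma_finite) simp
  interpret pair_sigma_finite "path_lborel T :: (nat \<Rightarrow> real^'d) measure" P ..
  have Q_iff: "Q x \<omega> \<longleftrightarrow> (\<forall>t\<in>{..T}. \<forall>k. \<exists>N0. \<forall>N. N \<ge> N0 \<longrightarrow>
      \<bar>(\<Sum>n=1..N. gauss_path \<sigma> t x (X n \<omega>)) / N - smoothed \<sigma> \<mu> t x\<bar> < inverse (real (Suc k)))" for x \<omega>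
    unfolding Q_def LIMSEQ_iff_inverse_Suc ..
  have "Measurable.pred (path_lborel T \<Otimes>\<^sub>M P) (\<lambda>p. \<forall>t\<in>{..T}. \<forall>k. \<exists>N0. \<forall>N. N \<ge> N0 \<longrightarrow>
      \<bar>(\<Sum>n=1..N. gauss_path \<sigma> t (fst p) (X n (snd p))) / N - smoothed \<sigma> \<mu> t (fst p)\<bar> < inverse (real (Suc k)))"
  proof (rule pred_intros_finite(3))
    fix t assume "t \<in> {..T}"
    then have t: "t \<le> T" by simp
    have "(\<lambda>p. gauss_path \<sigma> t (fst p) (X n (snd p))) \<in> borel_measurable (path_lborel T \<Otimes>\<^sub>M P)" if "n \<ge> 1" for n
    proof -
      have [measurable]: "X n \<in> P \<rightarrow>\<^sub>M path_lborel T"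
        using X_measurable[OF that] by (simp only: measurable_cong_sets[OF refl path_space_sets])
      have "(\<lambda>p. (fst p, X n (snd p))) \<in> path_lborel T \<Otimes>\<^sub>M P \<rightarrow>\<^sub>M path_lborel T \<Otimes>\<^sub>M path_lborel T"
        by measurable
      from measurable_compose[OF this gauss_path_measurable[OF t t]] show ?thesis by simp
    qed
    then have [measurable]: "(\<lambda>p. \<Sum>n=1..N. gauss_path \<sigma> t (fst p) (X n (snd p))) \<in> borel_measurable (path_lborel T \<Otimes>\<^sub>M P)" for N
      by (intro borel_measurable_sum) auto
    have [measurable]: "(\<lambda>p. smoothed \<sigma> \<mu> t (fst p)) \<in> borel_measurable (path_lborel T \<Otimes>\<^sub>M P)"
      by (rule measurable_compose[OF measurable_fst m.smoothed_measurable_T[OF t]])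
    show "Measurable.pred (path_lborel T \<Otimes>\<^sub>M P) (\<lambda>p. \<forall>k. \<exists>N0. \<forall>N. N \<ge> N0 \<longrightarrow>
      \<bar>(\<Sum>n=1..N. gauss_path \<sigma> t (fst p) (X n (snd p))) / N - smoothed \<sigma> \<mu> t (fst p)\<bar> < inverse (real (Suc k)))"
      by (intro pred_intros_countable pred_intros_logic borel_measurable_pred_less) measurable
  qed simp
  then have Q_meas: "{p \<in> space (path_lborel T \<Otimes>\<^sub>M P). Q (fst p) (snd p)} \<in> sets (path_lborel T \<Otimes>\<^sub>M P)"
    unfolding Q_iff by (rule predE)
  have "AE \<omega> in P. Q x \<omega>" for x
  proof -
    have "AE \<omega> in P. (\<lambda>N. (\<Sum>n=1..N. gauss_path \<sigma> t x (X n \<omega>)) / N) \<longlonglongrightarrow> smoothed \<sigma> \<mu> t x" if "t \<le> T" for t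
      unfolding smoothed_def
      by (rule AE_sample_mean[OF gauss_path_measurable_X[OF that] gauss_path_nonneg m.integrable_gauss_path[OF that]])
    then show ?thesis unfolding Q_def by (intro AE_finite_allI) auto
  qed
  then have "AE x in path_lborel T. AE \<omega> in P. Q x \<omega>" by simp
  then have "AE \<omega> in P. AE x in path_lborel T. Q x \<omega>"
    using AE_commute[OF Q_meas] by simp
  then show ?thesis by (simp only: Q_def Ball_def atMost_iff)
qed

text \<open>The first moment of a convolution is the integral of \<open>g z = E (norm (z + G))\<close> with \<open>G\<close> Gaussian. Since \<open>g\<close> grows at
  most linearly, it is integrable and the strong law applies to it.\<close>

lemma
  assumes moment: "(\<integral>\<^sup>+x. path_norm T x \<partial>\<mu>) < \<infinity>"
  shows smoothed_moment_finite: "(\<integral>\<^sup>+x. path_norm T x \<partial>path_convolution T \<mu> (gaussian T \<sigma>)) < \<infinity>"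
    and AE_smoothed_moment_empirical: "AE \<omega> in P.
      (\<lambda>N. \<integral>\<^sup>+x. path_norm T x \<partial>path_convolution T (empirical_measure T (Suc N) (\<lambda>n. X n \<omega>)) (gaussian T \<sigma>))
        \<longlonglongrightarrow> (\<integral>\<^sup>+x. path_norm T x \<partial>path_convolution T \<mu> (gaussian T \<sigma>))"
proof -
  interpret G: prob_space "gaussian T \<sigma> :: (nat \<Rightarrow> real^'d) measure" by (rule prob_space_gaussian[OF \<sigma>])
  define g where "g z = (\<integral>\<^sup>+w. ennreal (path_norm T (path_add T z w)) \<partial>gaussian T \<sigma>)" for z :: "nat \<Rightarrow> real^'d"
  define c where "c = (\<integral>\<^sup>+w. ennreal (path_norm T w) \<partial>(gaussian T \<sigma> :: (nat \<Rightarrow> real^'d) measure))"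
  have c: "c < \<infinity>" unfolding c_def by (rule nn_integral_path_norm_gaussian_finite[OF \<sigma>])
  have pn: "(\<lambda>x. ennreal (path_norm T x)) \<in> borel_measurable (path_space T)" by measurable
  have g_le: "g z \<le> ennreal (path_norm T z) + c" for z
  proof -
    have "path_norm T (path_add T z w) \<le> path_norm T z + path_norm T w" for w :: "nat \<Rightarrow> real^'d"
      by (auto simp: path_norm_def path_add_def sum.distrib[symmetric] intro!: sum_mono norm_triangle_ineq)
    then have triangle: "ennreal (path_norm T (path_add T z w)) \<le> ennreal (path_norm T z) + ennreal (path_norm T w)"
      for w :: "nat \<Rightarrow> real^'d"
      by (simp add: ennreal_plus[symmetric] ennreal_leI del: ennreal_plus)
    have "g z \<le> (\<integral>\<^sup>+w. ennreal (path_norm T z) + ennreal (path_norm T w) \<partial>(gaussian T \<sigma> :: (nat \<Rightarrow> real^'d) measure))"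
      unfolding g_def by (intro nn_integral_mono triangle)
    also have "\<dots> = (\<integral>\<^sup>+w. ennreal (path_norm T z) \<partial>(gaussian T \<sigma> :: (nat \<Rightarrow> real^'d) measure)) + c"
      unfolding c_def by (rule nn_integral_add) measurable
    finally show ?thesis by (simp add: G.emeasure_space_1)
  qed
  have g_fin: "g z < \<top>" for z
  proof (rule le_less_trans[OF g_le])
    show "ennreal (path_norm T z) + c < \<top>" using c by simp
  qed
  have g_meas: "g \<in> borel_measurable (path_space T)"
  proof -
    have "(\<lambda>(z, w). path_add T z w) \<in> path_space T \<Otimes>\<^sub>M (gaussian T \<sigma> :: (nat \<Rightarrow> real^'d) measure) \<rightarrow>\<^sub>M path_space T"
      using m.add_gaussian_measurable
      by (simp add: measurable_cong_sets[OF sets_pair_measure_cong[OF m.sets_\<mu> refl] refl])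
    from G.borel_measurable_nn_integral_fst[OF measurable_compose[OF this pn]]
    show ?thesis by (simp add: g_def[abs_def])
  qed
  define F where "F z = enn2real (g z)" for z
  have F: "ennreal (F z) = g z" for z using g_fin by (simp add: F_def)
  have F_meas: "F \<in> borel_measurable (path_space T)" unfolding F_def using g_meas by measurable
  have F0: "0 \<le> F z" for z by (simp add: F_def)
  have pn\<mu>: "(\<lambda>x. ennreal (path_norm T x)) \<in> borel_measurable \<mu>" and F\<mu>: "F \<in> borel_measurable \<mu>"
    using pn F_meas by (simp_all only: measurable_cong_sets[OF m.sets_\<mu> refl])
  have conv_\<mu>: "(\<integral>\<^sup>+x. path_norm T x \<partial>path_convolution T \<mu> (gaussian T \<sigma>)) = (\<integral>\<^sup>+z. F z \<partial>\<mu>)"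
    using m.nn_integral_convolution[OF pn] by (simp add: F g_def)
  have "(\<integral>\<^sup>+z. F z \<partial>\<mu>) \<le> (\<integral>\<^sup>+z. ennreal (path_norm T z) + c \<partial>\<mu>)"
    unfolding F by (intro nn_integral_mono g_le)
  also have "\<dots> = (\<integral>\<^sup>+z. ennreal (path_norm T z) \<partial>\<mu>) + c"
    using pn\<mu> by (subst nn_integral_add) (auto simp: m.emeasure_space_1)
  also have "\<dots> < \<infinity>" using moment c by simp
  finally have fin: "(\<integral>\<^sup>+z. F z \<partial>\<mu>) < \<infinity>" .
  then show "(\<integral>\<^sup>+x. path_norm T x \<partial>path_convolution T \<mu> (gaussian T \<sigma>)) < \<infinity>"
    by (simp only: conv_\<mu>)
  have int: "integrable \<mu> F"
    using fin F0 F\<mu> by (intro integrableI_nonneg) auto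
  have mean: "(\<integral>\<^sup>+z. F z \<partial>\<mu>) = ennreal (\<integral>z. F z \<partial>\<mu>)"
    using int F0 by (intro nn_integral_eq_integral) auto
  show "AE \<omega> in P.
      (\<lambda>N. \<integral>\<^sup>+x. path_norm T x \<partial>path_convolution T (empirical_measure T (Suc N) (\<lambda>n. X n \<omega>)) (gaussian T \<sigma>))
        \<longlonglongrightarrow> (\<integral>\<^sup>+x. path_norm T x \<partial>path_convolution T \<mu> (gaussian T \<sigma>))"
    using AE_sample_mean[OF F_meas F0 int] AE_space
  proof eventually_elim
    fix \<omega> assume lim: "(\<lambda>N. (\<Sum>n=1..N. F (X n \<omega>)) / N) \<longlonglongrightarrow> (\<integral>z. F z \<partial>\<mu>)" and \<omega>: "\<omega> \<in> space P"
    have "(\<integral>\<^sup>+x. path_norm T x \<partial>path_convolution T (empirical_measure T (Suc N) (\<lambda>n. X n \<omega>)) (gaussian T \<sigma>))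
        = ennreal ((\<Sum>n=1..Suc N. F (X n \<omega>)) / Suc N)" for N
    proof -
      interpret e: smoothing "empirical_measure T (Suc N) (\<lambda>n. X n \<omega>)" T \<sigma>
        by (rule empirical_measure_smoothing[OF _ \<sigma> X_space[OF \<omega>]]) auto
      have "(\<integral>\<^sup>+x. path_norm T x \<partial>path_convolution T (empirical_measure T (Suc N) (\<lambda>n. X n \<omega>)) (gaussian T \<sigma>))
          = (\<integral>\<^sup>+z. F z \<partial>empirical_measure T (Suc N) (\<lambda>n. X n \<omega>))"
        using e.nn_integral_convolution[OF pn] by (simp add: F g_def)
      also have "\<dots> = ennreal ((\<Sum>n=1..Suc N. F (X n \<omega>)) / Suc N)"
        by (rule nn_integral_empirical_measure[OF X_space[OF \<omega>] F_meas F0])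
      finally show ?thesis .
    qed
    then show "(\<lambda>N. \<integral>\<^sup>+x. path_norm T x \<partial>path_convolution T (empirical_measure T (Suc N) (\<lambda>n. X n \<omega>)) (gaussian T \<sigma>))
        \<longlonglongrightarrow> (\<integral>\<^sup>+x. path_norm T x \<partial>path_convolution T \<mu> (gaussian T \<sigma>))"
      unfolding conv_\<mu> mean using tendsto_ennrealI[OF LIMSEQ_Suc[OF lim]] by (simp only:)
  qed
qed

end

end

theorem theorem4p7:
  fixes T :: nat and \<mu> :: "(nat \<Rightarrow> real^'d) measure"
    and P :: "'w measure" and X :: "nat \<Rightarrow> 'w \<Rightarrow> (nat \<Rightarrow> real^'d)" and \<sigma> :: real
  assumes "T \<ge> 1"
    and "\<mu> \<in> P1 T"
    and "prob_space P"
    and "prob_space.indep_vars P (\<lambda>_. path_space T) X {1..}"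
    and "\<And>n. n \<ge> 1 \<Longrightarrow> distr P (path_space T) (X n) = \<mu>"
    and "0 < \<sigma>" and "\<sigma> \<le> 1"
  shows "AE \<omega> in P.
    (\<lambda>N. smooth_AW1 T \<sigma> \<mu> (empirical_measure T N (\<lambda>n. X n \<omega>))) \<longlonglongrightarrow> 0"
proof -
  interpret P: prob_space P by fact
  interpret path_sample P X T \<mu>
    by unfold_locales (use assms in auto)
  have moment: "(\<integral>\<^sup>+x. path_norm T x \<partial>\<mu>) < \<infinity>" using assms(2) by (simp add: P1_def)
  show ?thesis
    using AE_smoothed_empirical[OF assms(6)] AE_smoothed_moment_empirical[OF assms(6) moment] AE_space
  proof eventually_elim
    fix \<omega>
    assume dens: "AE x in path_lborel T. \<forall>t\<le>T.
        (\<lambda>N. (\<Sum>n=1..N. gauss_path \<sigma> t x (X n \<omega>)) / N) \<longlonglongrightarrow> smoothed \<sigma> \<mu> t x"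
      and mom: "(\<lambda>N. \<integral>\<^sup>+x. path_norm T x \<partial>path_convolution T (empirical_measure T (Suc N) (\<lambda>n. X n \<omega>)) (gaussian T \<sigma>))
        \<longlonglongrightarrow> (\<integral>\<^sup>+x. path_norm T x \<partial>path_convolution T \<mu> (gaussian T \<sigma>))"
      and \<omega>: "\<omega> \<in> space P"
    \<comment> \<open>The index is shifted because the empirical measure of an empty sample is not a probability measure.\<close>
    have "(\<lambda>N. smooth_AW1 T \<sigma> \<mu> (empirical_measure T (Suc N) (\<lambda>n. X n \<omega>))) \<longlonglongrightarrow> 0"
    proof (rule smooth_AW1_tendsto_0[OF smoothing_\<mu>[OF assms(6)] _ smoothed_moment_finite[OF assms(6) moment] mom])
      show "smoothing (empirical_measure T (Suc N) (\<lambda>n. X n \<omega>)) T \<sigma>" for N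
        by (rule empirical_measure_smoothing[OF _ assms(6) X_space[OF \<omega>]]) auto
      show "AE x in path_lborel T. \<forall>t\<le>T.
          (\<lambda>N. smoothed \<sigma> (empirical_measure T (Suc N) (\<lambda>n. X n \<omega>)) t x) \<longlonglongrightarrow> smoothed \<sigma> \<mu> t x"
        using dens
      proof eventually_elim
        fix x assume lim: "\<forall>t\<le>T. (\<lambda>N. (\<Sum>n=1..N. gauss_path \<sigma> t x (X n \<omega>)) / N) \<longlonglongrightarrow> smoothed \<sigma> \<mu> t x"
        show "\<forall>t\<le>T. (\<lambda>N. smoothed \<sigma> (empirical_measure T (Suc N) (\<lambda>n. X n \<omega>)) t x) \<longlonglongrightarrow> smoothed \<sigma> \<mu> t x"
        proof (intro allI impI)
          fix t assume t: "t \<le> T"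
          show "(\<lambda>N. smoothed \<sigma> (empirical_measure T (Suc N) (\<lambda>n. X n \<omega>)) t x) \<longlonglongrightarrow> smoothed \<sigma> \<mu> t x"
            using LIMSEQ_Suc[OF lim[rule_format, OF t]] by (simp only: smoothed_empirical[OF assms(6) \<omega> t])
        qed
      qed
    qed
    then show "(\<lambda>N. smooth_AW1 T \<sigma> \<mu> (empirical_measure T N (\<lambda>n. X n \<omega>))) \<longlonglongrightarrow> 0"
      by (rule LIMSEQ_imp_Suc)
  qed
qed

end
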